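(* Let $K$ be a field, let $L$ be a finite simple distributive lattice and let $P$ be the poset of join irreducible elements of $L$. Let $I_L\subset S=K[x_\alpha : \alpha\in L]$ be the ideal generated by the binomials $x_\alpha x_\beta - x_{\alpha\wedge\beta}x_{\alpha\vee\beta}$ with $\alpha,\beta\in L$ incomparable. Then $I_L$ has a linear resolution if and only if $P$ is the sum of a chain and an isolated element.
   Context: An element $\alpha\in L$ is join irreducible if $\alpha\neq\min L$ and whenever $\alpha=\beta\vee\gamma$ with $\beta,\gamma\in L$, then $\alpha=\beta$ or $\alpha=\gamma$. The set $P$ of join irreducible elements carries the partial order induced from $L$. By Birkhoff's theorem, $L$ is isomorphic to the lattice $\mathcal{I}(P)$ of poset ideals (down-closed subsets) of $P$, ordered by inclusion. $L$ is called simple if there is no $p\in P$ with the property that for every $q\in P$ either $q\leq p$ or $q\geq p$. "$P$ is the sum of a chain and an isolated element" means that, as a set, $P$ is the disjoint union of a chain $C$ and a single element $q$, where $q$ is incomparable with every element of $C$. $S=K[x_\alpha:\alpha\in L]$ is the polynomial ring over $K$ with its standard grading ($\deg x_\alpha=1$). The ideal $I_L$ is generated by quadrics; it is said to have a linear resolution if its Castelnuovo–Mumford regularity as a graded $S$-module equals $2$ (equivalently, $I_L\neq 0$ and $\operatorname{Tor}_i^S(I_L,K)_j=0$ for all $i$ and all $j\neq i+2$). In particular, the zero ideal is not regarded as having a linear resolution. *)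

theory Defs
  imports Complex_Main "HOL-Library.Poly_Mapping" "HOL-Library.Extended_Real"
begin

section \<open>Join irreducible elements and simple lattices\<close>

definition join_irreducible :: "'l::{finite,distrib_lattice} \<Rightarrow> bool" where
  "join_irreducible a \<longleftrightarrow>
     a \<noteq> Inf_fin UNIV \<and> (\<forall>b c. a = sup b c \<longrightarrow> a = b \<or> a = c)"

definition join_irreducibles :: "'l::{finite,distrib_lattice} set" where
  "join_irreducibles = {a. join_irreducible a}"

definition simple_lattice :: "'l::{finite,distrib_lattice} itself \<Rightarrow> bool" where
  "simple_lattice _ \<longleftrightarrow>
     \<not> (\<exists>p\<in>(join_irreducibles :: 'l set). \<forall>q\<in>join_irreducibles. q \<le> p \<or> q \<ge> p)"

definition chain_plus_isolated :: "'p::order set \<Rightarrow> bool" where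
  "chain_plus_isolated P \<longleftrightarrow>
     (\<exists>C q. P = C \<union> {q} \<and> q \<notin> C \<and> Complete_Partial_Order.chain (\<le>) C \<and>
            (\<forall>c\<in>C. \<not> c \<le> q \<and> \<not> q \<le> c))"


section \<open>The polynomial ring and the join-meet ideal\<close>

text \<open>
  A polynomial is a finitely supported family of coefficients indexed by monomials, and a
  monomial is a finitely supported family of exponents.  Multiplication is the convolution
  product of \<^theory>\<open>HOL-Library.Poly_Mapping\<close>.
\<close>

type_synonym 'v monom = "'v \<Rightarrow>\<^sub>0 nat"
type_synonym ('v, 'k) mpoly = "'v monom \<Rightarrow>\<^sub>0 'k"

definition var :: "'v \<Rightarrow> ('v, 'k::comm_ring_1) mpoly" where
  "var a = Poly_Mapping.single (Poly_Mapping.single a 1) 1"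

definition monom_degree :: "'v monom \<Rightarrow> nat" where
  "monom_degree m = (\<Sum>a\<in>Poly_Mapping.keys m. Poly_Mapping.lookup m a)"

definition homogeneous :: "int \<Rightarrow> ('v, 'k::comm_ring_1) mpoly \<Rightarrow> bool" where
  "homogeneous d p \<longleftrightarrow> (\<forall>m\<in>Poly_Mapping.keys p. int (monom_degree m) = d)"

definition const_coeff :: "('v, 'k::comm_ring_1) mpoly \<Rightarrow> 'k" where
  "const_coeff p = Poly_Mapping.lookup p 0"

text \<open>The span of a set in the ring, viewed as a module over itself, is the ideal it generates.\<close>

definition join_meet_ideal :: "('l::{finite,distrib_lattice}, 'k::field) mpoly set" where
  "join_meet_ideal = module.span (*)
     {var a * var b - var (inf a b) * var (sup a b) | a b. \<not> a \<le> b \<and> \<not> b \<le> a}"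


section \<open>Graded free resolutions, Tor and regularity\<close>

text \<open>
  Elements of the free module of rank $n$ are the functions on the natural numbers that
  vanish from $n$ on.
\<close>

definition free_mod :: "nat \<Rightarrow> (nat \<Rightarrow> 'r::comm_ring_1) set" where
  "free_mod n = {v. \<forall>k\<ge>n. v k = 0}"

definition mat_map ::
  "nat \<Rightarrow> nat \<Rightarrow> (nat \<Rightarrow> nat \<Rightarrow> 'r::comm_ring_1) \<Rightarrow> (nat \<Rightarrow> 'r) \<Rightarrow> nat \<Rightarrow> 'r" where
  "mat_map m n A v = (\<lambda>r. if r < m then \<Sum>c<n. A r c * v c else 0)"

text \<open>
  The data of a sequence $\cdots \to F_2 \to F_1 \to F_0 \to S$ of finitely generated graded
  free modules: the module $F_i$ has the basis $e_0, \dots, e_{n-1}$ with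
  $n =$ \<open>frank F i\<close>, where $e_k$ sits in degree \<open>fdeg F i k\<close>; \<open>faug F\<close> is the row of
  the map $F_0 \to S$ and \<open>fdiff F i\<close> is the matrix of $F_{i+1} \to F_i$.
\<close>

record 'r graded_free =
  frank :: "nat \<Rightarrow> nat"
  fdeg :: "nat \<Rightarrow> nat \<Rightarrow> int"
  faug :: "nat \<Rightarrow> 'r"
  fdiff :: "nat \<Rightarrow> nat \<Rightarrow> nat \<Rightarrow> 'r"

definition aug_map :: "('v, 'k::field) mpoly graded_free \<Rightarrow> (nat \<Rightarrow> ('v, 'k) mpoly) \<Rightarrow> ('v, 'k) mpoly"
  where "aug_map F v = (\<Sum>c<frank F 0. faug F c * v c)"

definition diff_map ::
  "('v, 'k::field) mpoly graded_free \<Rightarrow> nat \<Rightarrow> (nat \<Rightarrow> ('v, 'k) mpoly) \<Rightarrow> nat \<Rightarrow> ('v, 'k) mpoly"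
  where "diff_map F i = mat_map (frank F i) (frank F (Suc i)) (fdiff F i)"

text \<open>
  All maps are homogeneous of degree 0, and
  $\cdots \to F_2 \to F_1 \to F_0 \to I \to 0$ is exact.
\<close>

definition graded_free_resolution ::
  "('v, 'k::field) mpoly graded_free \<Rightarrow> ('v, 'k) mpoly set \<Rightarrow> bool" where
  "graded_free_resolution F I \<longleftrightarrow>
     (\<forall>c<frank F 0. homogeneous (fdeg F 0 c) (faug F c)) \<and>
     (\<forall>i. \<forall>r<frank F i. \<forall>c<frank F (Suc i).
        homogeneous (fdeg F (Suc i) c - fdeg F i r) (fdiff F i r c)) \<and>
     aug_map F ` free_mod (frank F 0) = I \<and>
     {v \<in> free_mod (frank F 0). aug_map F v = 0} = diff_map F 0 ` free_mod (frank F 1) \<and>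
     (\<forall>i. {v \<in> free_mod (frank F (Suc i)). diff_map F i v = (\<lambda>_. 0)} =
          diff_map F (Suc i) ` free_mod (frank F (Suc (Suc i))))"

text \<open>
  Tensoring with $K = S/(x_\alpha : \alpha)$ replaces $F_i$ by a graded $K$-vector space on the
  same basis and every matrix entry by its constant coefficient.  The strand of degree $j$ is
  spanned by the basis elements of degree $j$.
\<close>

definition tensor_strand :: "('v, 'k::field) mpoly graded_free \<Rightarrow> nat \<Rightarrow> int \<Rightarrow> (nat \<Rightarrow> 'k) set" where
  "tensor_strand F i j = {w \<in> free_mod (frank F i). \<forall>k. w k \<noteq> 0 \<longrightarrow> fdeg F i k = j}"

definition tensor_diff ::
  "('v, 'k::field) mpoly graded_free \<Rightarrow> nat \<Rightarrow> (nat \<Rightarrow> 'k) \<Rightarrow> nat \<Rightarrow> 'k" where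
  "tensor_diff F i =
     mat_map (frank F i) (frank F (Suc i)) (\<lambda>r c. const_coeff (fdiff F i r c))"

definition tor_cycles :: "('v, 'k::field) mpoly graded_free \<Rightarrow> nat \<Rightarrow> int \<Rightarrow> (nat \<Rightarrow> 'k) set" where
  "tor_cycles F i j =
     {w \<in> tensor_strand F i j. \<forall>h. i = Suc h \<longrightarrow> tensor_diff F h w = (\<lambda>_. 0)}"

definition tor_boundaries :: "('v, 'k::field) mpoly graded_free \<Rightarrow> nat \<Rightarrow> int \<Rightarrow> (nat \<Rightarrow> 'k) set" where
  "tor_boundaries F i j = tensor_diff F i ` tensor_strand F (Suc i) j"

text \<open>
  $\mathrm{Tor}_i^S(I, K)_j = 0$.  Since Tor does not depend on the resolution, it is enough
  that the homology vanishes for one graded free resolution of $I$; every homogeneous ideal in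
  finitely many variables has one.
\<close>

definition tor_vanishes :: "('v, 'k::field) mpoly set \<Rightarrow> nat \<Rightarrow> int \<Rightarrow> bool" where
  "tor_vanishes I i j \<longleftrightarrow>
     (\<exists>F. graded_free_resolution F I \<and> tor_cycles F i j = tor_boundaries F i j)"

text \<open>
  The Castelnuovo-Mumford regularity of a homogeneous ideal as a graded module.  The zero
  ideal has regularity $-\infty$.
\<close>

definition regularity :: "('v, 'k::field) mpoly set \<Rightarrow> ereal" where
  "regularity I = Sup {ereal (real_of_int (j - int i)) | i j. \<not> tor_vanishes I i j}"

text \<open>For ideals generated by quadrics, such as the join-meet ideal.\<close>

definition has_linear_resolution :: "('v, 'k::field) mpoly set \<Rightarrow> bool" where
  "has_linear_resolution I \<longleftrightarrow> regularity I = 2"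

end

theory Submission
  imports Defs "HOL-Library.Function_Algebras"
begin

text \<open>
  Write $S$ for the polynomial ring and $R = S/I_L$.  Tor can be read off from any graded free
  resolution or from Koszul homology, so $I_L$ has a linear resolution if and only if $L$ is not a
  chain and the Koszul homology of $R$ with respect to the variables satisfies
  $H_i(R)_j = 0$ for $j > i + 1$.

  Suppose that this vanishing holds.  It persists for the sequence of variables followed by the
  forms $\theta_r$, the sums of all variables of rank $r$.  Modulo $(\theta) + I_L$ every variable
  is nilpotent, since $x_a \theta_r$ expresses $x_a^2$ by products $x_{a \wedge b} x_{a \vee b}$; as
  $(\theta) + I_L$ kills Koszul homology, the variables can be removed again one at a time, and it
  follows that every quadric lies in $(\theta) + I_L$.  If $P$ contains an antichain with three
  elements, or if there are two incomparable elements followed by two incomparable elements in the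
  construction of a chain of ideals of $P$, then a cycle of ideals of two fixed cardinalities at
  distance 1 or 2 gives a linear functional that contradicts this.  A simple $P$ without such
  configurations is the sum of a chain and an isolated element.

  Conversely, if $P$ is a chain with an isolated element $q$ and $u$ does not lie above $q$, put
  $J_u = I_L + (x_a : a \not\geq u)$.  Then $x_u$ is a nonzerodivisor modulo $J_u$, the ideal
  $(J_u + x_u) : x_{u \vee q}$ is generated by variables, and $J_u + (x_u, x_{u \vee q})$ is
  again of the form $J_{u'}$, or is generated by all variables.  Induction along this chain shows
  the vanishing for $I_L$, and a linear resolution is then constructed by choosing bases of the
  lowest graded pieces of the successive syzygy modules.
\<close>

section \<open>Koszul complexes\<close>

text \<open>Vanishing of Tor is existential here: each pair (i, j) may be witnessed by its own
  resolution, and non-vanishing is a claim about all resolutions. Koszul homology serves as common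
  measure because it mentions no resolution. A chain carries all homological degrees at once and
  homogeneity is imposed on its coefficients: a coefficient of degree d at e_T has internal degree d
  + |T|, so that regularity becomes one bound on coefficient degrees. For a linear form, the
  connecting maps preserve the coefficient degree, the shifts in homological and internal degree
  cancelling; the long exact sequences thus turn into short computations with explicit chains. The
  forms theta_r enter because the obstruction to linearity becomes visible modulo them: their Koszul
  homology in degree 0 is an algebra in which every quadric would have to vanish, and this is
  refuted by a functional with values 0, 1 and -1 along a cycle, over any field.\<close>

definition is_ideal :: "'r::comm_ring_1 set \<Rightarrow> bool" where
  "is_ideal J \<longleftrightarrow> 0 \<in> J \<and> (\<forall>a\<in>J. \<forall>b\<in>J. a + b \<in> J) \<and> (\<forall>r. \<forall>a\<in>J. r * a \<in> J)"

lemma ideal_zero: "is_ideal J \<Longrightarrow> 0 \<in> J"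
  and ideal_add: "is_ideal J \<Longrightarrow> a \<in> J \<Longrightarrow> b \<in> J \<Longrightarrow> a + b \<in> J"
  and ideal_mult: "is_ideal J \<Longrightarrow> a \<in> J \<Longrightarrow> r * a \<in> J"
  by (auto simp: is_ideal_def)

lemma ideal_mult_right: "is_ideal J \<Longrightarrow> a \<in> J \<Longrightarrow> a * r \<in> J"
  by (simp add: ideal_mult mult.commute[of a])

lemma ideal_minus: "is_ideal J \<Longrightarrow> a \<in> J \<Longrightarrow> - a \<in> J"
  using ideal_mult[of J a "- 1"] by simp

lemma ideal_diff: "is_ideal J \<Longrightarrow> a \<in> J \<Longrightarrow> b \<in> J \<Longrightarrow> a - b \<in> J"
  using ideal_add[of J a "- b"] ideal_minus[of J b] by simp

lemma ideal_sum: "is_ideal J \<Longrightarrow> (\<And>i. i \<in> A \<Longrightarrow> f i \<in> J) \<Longrightarrow> sum f A \<in> J"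
  by (induct A rule: infinite_finite_induct) (auto simp: ideal_zero ideal_add)

lemma ideal_singleton_zero: "is_ideal {0}"
  by (simp add: is_ideal_def)

definition ideal_plus :: "'r::comm_ring_1 set \<Rightarrow> 'r \<Rightarrow> 'r set" where
  "ideal_plus J y = {g + y * h | g h. g \<in> J}"

lemma ideal_plusI: "g \<in> J \<Longrightarrow> g + y * h \<in> ideal_plus J y"
  by (auto simp: ideal_plus_def)

lemma ideal_plusE:
  assumes "p \<in> ideal_plus J y"
  obtains g h where "g \<in> J" "p = g + y * h"
  using assms by (auto simp: ideal_plus_def)

lemma is_ideal_ideal_plus:
  assumes "is_ideal J" shows "is_ideal (ideal_plus J y)"
  unfolding is_ideal_def
proof (intro conjI ballI allI)
  show "0 \<in> ideal_plus J y"
    using ideal_plusI[OF ideal_zero[OF assms], of y 0] by simp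
next
  fix a b assume "a \<in> ideal_plus J y" "b \<in> ideal_plus J y"
  then obtain g h g' h' where *: "g \<in> J" "a = g + y * h" "g' \<in> J" "b = g' + y * h'"
    by (auto elim!: ideal_plusE)
  then have "a + b = (g + g') + y * (h + h')" by (simp add: algebra_simps)
  moreover have "(g + g') + y * (h + h') \<in> ideal_plus J y"
    using * by (intro ideal_plusI ideal_add[OF assms])
  ultimately show "a + b \<in> ideal_plus J y" by metis
next
  fix a r assume "a \<in> ideal_plus J y"
  then obtain g h where *: "g \<in> J" "a = g + y * h" by (auto elim!: ideal_plusE)
  then have "r * a = r * g + y * (r * h)" by (simp add: algebra_simps)
  moreover have "r * g + y * (r * h) \<in> ideal_plus J y"
    using * by (intro ideal_plusI ideal_mult[OF assms])
  ultimately show "r * a \<in> ideal_plus J y" by metis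
qed

lemma ideal_subset_ideal_plus: "J \<subseteq> ideal_plus J y"
  using ideal_plusI[of _ J y 0] by auto

lemma ideal_plus_self: "is_ideal J \<Longrightarrow> y * h \<in> ideal_plus J y"
  using ideal_plusI[OF ideal_zero, of J y h] by simp

text \<open>
  A chain of the Koszul complex on \<open>ys\<close> assigns a coefficient to each list of length
  \<open>length ys\<close>; the list with entry \<open>True\<close> exactly at the positions in $T$ stands for $e_T$.
  Values at lists of other lengths are meaningless.  The recursion presents the complex as the
  mapping cone of multiplication by the first element.
\<close>

fun kd :: "'r::comm_ring_1 list \<Rightarrow> (bool list \<Rightarrow> 'r) \<Rightarrow> bool list \<Rightarrow> 'r" where
  "kd [] z bs = 0"
| "kd (y # ys) z [] = 0"
| "kd (y # ys) z (b # bs) =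
     (if b then - kd ys (\<lambda>c. z (True # c)) bs
      else kd ys (\<lambda>c. z (False # c)) bs + y * z (True # bs))"

lemma kd_add: "kd ys (\<lambda>c. z c + w c) bs = kd ys z bs + kd ys w bs"
proof (induct ys arbitrary: z w bs)
  case (Cons y ys) then show ?case by (cases bs) (auto simp: algebra_simps)
qed auto

lemma kd_scale: "kd ys (\<lambda>c. r * z c) bs = r * kd ys z bs"
proof (induct ys arbitrary: z bs)
  case (Cons y ys) then show ?case by (cases bs) (auto simp: algebra_simps)
qed auto

lemma kd_minus: "kd ys (\<lambda>c. - z c) bs = - kd ys z bs"
  using kd_scale[of ys "- 1" z bs] by simp

lemma kd_diff: "kd ys (\<lambda>c. z c - w c) bs = kd ys z bs - kd ys w bs"
  using kd_add[of ys z "\<lambda>c. - w c" bs] by (simp add: kd_minus)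

lemma kd_zero [simp]: "kd ys (\<lambda>c. 0) bs = 0"
  using kd_scale[of ys 0 "\<lambda>c. 0" bs] by simp

lemma kd_sum: "kd ys (\<lambda>c. \<Sum>i\<in>A. z i c) bs = (\<Sum>i\<in>A. kd ys (z i) bs)"
  by (induct A rule: infinite_finite_induct) (auto simp: kd_add)

lemma kd_cong:
  assumes "\<And>c. length c = length ys \<Longrightarrow> z c = w c" "length bs = length ys"
  shows "kd ys z bs = kd ys w bs"
  using assms
proof (induct ys arbitrary: z w bs)
  case (Cons y ys)
  obtain b c where bs: "bs = b # c" "length c = length ys" using Cons.prems(2) by (cases bs) auto
  have "kd ys (\<lambda>c. z (b # c)) c = kd ys (\<lambda>c. w (b # c)) c" for b
    using Cons.prems(1) bs(2) by (intro Cons.hyps) auto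
  then show ?case using bs Cons.prems(1)[of "True # c"] by simp
qed auto

lemma kd_kd: "kd ys (kd ys z) bs = 0"
proof (induct ys arbitrary: z bs)
  case (Cons y ys) then show ?case
    by (cases bs) (auto simp: kd_add kd_minus kd_scale)
qed auto

lemma kd_in_ideal:
  assumes "is_ideal J" "\<And>c. length c = length ys \<Longrightarrow> z c \<in> J" "length bs = length ys"
  shows "kd ys z bs \<in> J"
  using assms(2,3)
proof (induct ys arbitrary: z bs)
  case (Cons y ys)
  then show ?case
    by (cases bs) (auto intro!: ideal_add[OF assms(1)] ideal_minus[OF assms(1)] ideal_mult[OF assms(1)] Cons.hyps)
qed (simp add: ideal_zero[OF assms(1)])

abbreviation kzero :: "'a list \<Rightarrow> bool list" where
  "kzero ys \<equiv> replicate (length ys) False"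

text \<open>\<open>kzero ys\<close> stands for the empty set, so the chain sits in homological
  degree 0, where nothing is left to map to. In this way ring elements are treated as
  cycles.\<close>

lemma kd_unit_chain:
  "length bs = length ys \<Longrightarrow> kd ys (\<lambda>c. if c = kzero ys then p else 0) bs = 0"
proof (induct ys arbitrary: bs)
  case (Cons y ys) then show ?case by (cases bs) auto
qed auto

fun kjoin :: "(bool list \<Rightarrow> 'r) \<Rightarrow> (bool list \<Rightarrow> 'r) \<Rightarrow> bool list \<Rightarrow> 'r::comm_ring_1" where
  "kjoin z' z'' [] = 0"
| "kjoin z' z'' (b # c) = (if b then z'' c else z' c)"

text \<open>Exterior multiplication by the basis element of \<open>t\<close>, a homotopy from multiplication by \<open>t\<close> to 0.\<close>

fun kw :: "'r \<Rightarrow> 'r list \<Rightarrow> (bool list \<Rightarrow> 'r) \<Rightarrow> bool list \<Rightarrow> 'r::comm_ring_1" where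
  "kw t [] z bs = 0"
| "kw t (y # ys) z [] = 0"
| "kw t (y # ys) z (b # bs) =
     (if y = t then (if b then z (False # bs) else 0)
      else if b then - kw t ys (\<lambda>c. z (True # c)) bs
      else kw t ys (\<lambda>c. z (False # c)) bs)"

lemma kw_add: "kw t ys (\<lambda>c. z c + w c) bs = kw t ys z bs + kw t ys w bs"
proof (induct ys arbitrary: z w bs)
  case (Cons y ys) then show ?case by (cases bs) (auto simp: algebra_simps)
qed auto

lemma kw_scale: "kw t ys (\<lambda>c. r * z c) bs = r * kw t ys z bs"
proof (induct ys arbitrary: z bs)
  case (Cons y ys) then show ?case by (cases bs) (auto simp: algebra_simps)
qed auto

lemma kw_minus: "kw t ys (\<lambda>c. - z c) bs = - kw t ys z bs"
  using kw_scale[of t ys "- 1" z bs] by simp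

lemma kw_in_ideal:
  assumes "is_ideal J" "\<And>c. length c = length ys \<Longrightarrow> z c \<in> J" "length bs = length ys"
  shows "kw t ys z bs \<in> J"
  using assms(2,3)
proof (induct ys arbitrary: z bs)
  case (Cons y ys)
  then show ?case
    by (cases bs) (auto intro!: ideal_minus[OF assms(1)] Cons.hyps simp: ideal_zero[OF assms(1)])
qed (simp add: ideal_zero[OF assms(1)])

text \<open>\<open>kw\<close> works at the first occurrence of \<open>t\<close>, so repeated entries
  are harmless. The identity shows that every entry of the list kills Koszul homology.\<close>

lemma kw_homotopy:
  assumes "t \<in> set ys" "length bs = length ys"
  shows "kd ys (kw t ys z) bs + kw t ys (kd ys z) bs = t * z bs"
  using assms
proof (induct ys arbitrary: z bs)
  case (Cons y ys)
  obtain b bs' where bs: "bs = b # bs'" "length bs' = length ys"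
    using Cons.prems by (cases bs) auto
  show ?case
  proof (cases "y = t")
    case True then show ?thesis using bs by auto
  next
    case False
    then have t: "t \<in> set ys" using Cons.prems by auto
    have IH: "kd ys (kw t ys z) bs' = t * z bs' - kw t ys (kd ys z) bs'" for z
      using Cons.hyps[OF t bs(2), of z] by (simp add: algebra_simps)
    show ?thesis using bs False by (auto simp: kd_minus kw_minus kw_add kw_scale IH)
  qed
qed auto

fun ksign :: "bool list \<Rightarrow> 'r::comm_ring_1" where
  "ksign [] = 1"
| "ksign (b # bs) = (if b then - ksign bs else ksign bs)"

lemma kd_ksign: "kd ys (\<lambda>c. ksign c * z c) bs = - ksign bs * kd ys z bs"
proof (induct ys arbitrary: z bs)
  case (Cons y ys)
  then show ?case
    by (cases bs) (auto simp: Cons.hyps kd_minus distrib_left mult.left_commute)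
qed auto

text \<open>The recursion of \<open>kd\<close> peels off the first element, whereas the rank sums
  are appended at the end. The last basis vector has to pass those before it, whence the
  sign.\<close>

lemma kd_snoc:
  assumes "length bs = length ys"
  shows "kd (ys @ [t]) z (bs @ [b]) =
    (if b then kd ys (\<lambda>c. z (c @ [True])) bs
     else kd ys (\<lambda>c. z (c @ [False])) bs + ksign bs * (t * z (bs @ [True])))"
  using assms
proof (induct ys arbitrary: z bs)
  case (Cons y ys)
  then show ?case by (cases bs) (auto simp: add_ac)
qed auto

section \<open>Exactness of the Koszul complex on a regular sequence\<close>

definition koszul_gen :: "'r::comm_ring_1 list \<Rightarrow> 'r set" where
  "koszul_gen ys = {kd ys w (kzero ys) | w. True}"

lemma koszul_gen_Nil: "koszul_gen [] = {0}"
  by (simp add: koszul_gen_def)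

lemma koszul_gen_Cons: "koszul_gen (y # ys) = ideal_plus (koszul_gen ys) y"
proof
  show "koszul_gen (y # ys) \<subseteq> ideal_plus (koszul_gen ys) y"
    by (auto simp: koszul_gen_def ideal_plus_def)
  show "ideal_plus (koszul_gen ys) y \<subseteq> koszul_gen (y # ys)"
  proof
    fix p assume "p \<in> ideal_plus (koszul_gen ys) y"
    then obtain w h where "p = kd ys w (kzero ys) + y * h"
      by (auto simp: koszul_gen_def elim!: ideal_plusE)
    then have "p = kd (y # ys) (kjoin w (\<lambda>_. h)) (kzero (y # ys))" by simp
    then show "p \<in> koszul_gen (y # ys)" unfolding koszul_gen_def by blast
  qed
qed

lemma is_ideal_koszul_gen: "is_ideal (koszul_gen ys)"
  by (induct ys) (simp_all add: koszul_gen_Nil koszul_gen_Cons is_ideal_ideal_plus ideal_singleton_zero)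

lemma koszul_genI: "kd ys w (kzero ys) \<in> koszul_gen ys"
  unfolding koszul_gen_def by blast

text \<open>Homology concentrated in homological degree 0. Since a chain has components in all
  degrees, its degree 0 component must be required separately to lie in the ideal generated by
  \<open>ys\<close>, which \<open>koszul_gen ys\<close> presents as the set of boundaries in degree
  0.\<close>

definition koszul_exact :: "'r::comm_ring_1 list \<Rightarrow> bool" where
  "koszul_exact ys \<longleftrightarrow> (\<forall>z. (\<forall>bs. length bs = length ys \<longrightarrow> kd ys z bs = 0) \<and>
     z (kzero ys) \<in> koszul_gen ys \<longrightarrow>
     (\<exists>w. \<forall>bs. length bs = length ys \<longrightarrow> z bs = kd ys w bs))"

lemma koszul_exact_Nil: "koszul_exact []"
  by (simp add: koszul_exact_def koszul_gen_Nil)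

text \<open>The complex on \<open>y # ys\<close> is the mapping cone of multiplication by
  \<open>y\<close>. The only possible new homology in positive degree is the kernel of
  \<open>y\<close> on the degree 0 homology, which \<open>nzd\<close> makes trivial.\<close>

lemma koszul_exact_Cons:
  assumes ex: "koszul_exact ys"
    and nzd: "\<And>p. y * p \<in> koszul_gen ys \<Longrightarrow> p \<in> koszul_gen ys"
  shows "koszul_exact (y # ys)"
  unfolding koszul_exact_def
proof (intro allI impI, elim conjE)
  fix z assume cyc: "\<forall>bs. length bs = length (y # ys) \<longrightarrow> kd (y # ys) z bs = 0"
    and z0: "z (kzero (y # ys)) \<in> koszul_gen (y # ys)"
  define z' where "z' = (\<lambda>c. z (False # c))"
  define z'' where "z'' = (\<lambda>c. z (True # c))"
  have c1: "kd ys z' bs + y * z'' bs = 0" if "length bs = length ys" for bs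
    using cyc[rule_format, of "False # bs"] that by (simp add: z'_def z''_def)
  have c2: "kd ys z'' bs = 0" if "length bs = length ys" for bs
    using cyc[rule_format, of "True # bs"] that by (simp add: z''_def)
  have "y * z'' (kzero ys) = kd ys (\<lambda>c. - z' c) (kzero ys)"
    using c1[of "kzero ys"] by (simp add: kd_minus algebra_simps eq_neg_iff_add_eq_0)
  then have "y * z'' (kzero ys) \<in> koszul_gen ys" using koszul_genI by metis
  then have "z'' (kzero ys) \<in> koszul_gen ys" by (rule nzd)
  then obtain u where u: "\<And>bs. length bs = length ys \<Longrightarrow> z'' bs = kd ys u bs"
    using ex c2 unfolding koszul_exact_def by metis
  obtain g h where g: "g \<in> koszul_gen ys" and z'0: "z' (kzero ys) = g + y * h"
    using z0 unfolding koszul_gen_Cons by (auto simp: z'_def elim!: ideal_plusE)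
  \<comment> \<open>A change in homological degree 0 does not affect the differential. This value
    cancels \<open>y * h\<close> and makes the degree 0 component of \<open>v\<close> equal to
    \<open>g\<close>, as exactness for \<open>ys\<close> demands.\<close>
  define t where "t = (- h - u (kzero ys))"
  define u' where "u' = (\<lambda>c. u c + (if c = kzero ys then t else 0))"
  have u': "kd ys u' bs = z'' bs" if "length bs = length ys" for bs
    using that by (simp add: u'_def kd_add kd_unit_chain u)
  define v where "v = (\<lambda>c. z' c + y * u' c)"
  have "kd ys v bs = 0" if "length bs = length ys" for bs
    using c1[OF that] by (simp add: v_def kd_add kd_scale u'[OF that])
  moreover have "v (kzero ys) = g"
    by (simp add: v_def u'_def t_def z'0 algebra_simps)
  ultimately obtain w where w: "\<And>bs. length bs = length ys \<Longrightarrow> v bs = kd ys w bs"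
    using ex g unfolding koszul_exact_def by metis
  have "z bs = kd (y # ys) (kjoin w (\<lambda>c. - u' c)) bs" if "length bs = length (y # ys)" for bs
  proof -
    from that obtain b c where bs: "bs = b # c" "length c = length ys" by (cases bs) auto
    show ?thesis
    proof (cases b)
      case True then show ?thesis using bs by (simp add: kd_minus u' z''_def)
    next
      case False
      have "kd ys w c - y * u' c = z' c" using w[OF bs(2)] by (simp add: v_def algebra_simps)
      then show ?thesis using bs False by (simp add: z'_def)
    qed
  qed
  then show "\<exists>w. \<forall>bs. length bs = length (y # ys) \<longrightarrow> z bs = kd (y # ys) w bs" by blast
qed

section \<open>Graded polynomials\<close>

abbreviation (input) lkp where "lkp \<equiv> Poly_Mapping.lookup"
abbreviation (input) ks where "ks \<equiv> Poly_Mapping.keys"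
abbreviation (input) sgl where "sgl \<equiv> Poly_Mapping.single"

lemma lookup_single_mult_add:
  fixes p :: "('v, 'k::comm_ring_1) mpoly"
  shows "lkp (sgl m c * p) (m + k) = c * lkp p k"
proof -
  have "lkp (sgl m c * p) (m + k) = (\<Sum>l. (c when m = l) * (\<Sum>q. lkp p q when m + k = l + q))"
    by (simp add: lookup_mult lookup_single)
  also have "\<dots> = (\<Sum>l. c * (\<Sum>q. lkp p q when m + k = l + q) when m = l)"
    by (simp add: when_mult)
  also have "\<dots> = c * (\<Sum>q. lkp p q when k = q)" by simp
  finally show ?thesis by simp
qed

lemma poly_eq_sum_monomials: "p = (\<Sum>m\<in>ks p. sgl m (lkp p m))"
  by (rule poly_mapping_eqI) (simp add: lookup_sum lookup_single when_def not_in_keys_iff_lookup_eq_zero)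

lemma keys_monom_add: "ks (m + n :: 'v \<Rightarrow>\<^sub>0 nat) = ks m \<union> ks n"
  by (auto simp: in_keys_iff lookup_add)

lemma monom_degree_eq_sum: "monom_degree (m :: 'v::finite monom) = (\<Sum>a\<in>UNIV. lkp m a)"
  unfolding monom_degree_def by (rule sum.mono_neutral_left) (auto simp: in_keys_iff)

lemma monom_degree_add [simp]:
  "monom_degree (m + n :: 'v::finite monom) = monom_degree m + monom_degree n"
  by (simp add: monom_degree_eq_sum lookup_add sum.distrib)

lemma monom_degree_zero [simp]: "monom_degree 0 = 0"
  by (simp add: monom_degree_def)

lemma monom_degree_single [simp]: "monom_degree (sgl a n) = n"
  by (simp add: monom_degree_def)

lemma monom_degree_eq_0_iff: "monom_degree (m :: 'v monom) = 0 \<longleftrightarrow> m = 0"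
  by (auto simp: monom_degree_def in_keys_iff intro!: poly_mapping_eqI)

lemma monom_split:
  assumes "a \<in> ks (m :: 'v monom)"
  obtains m' where "m = sgl a 1 + m'"
proof
  show "m = sgl a 1 + (m - sgl a 1)"
    using assms by (intro poly_mapping_eqI)
      (auto simp: lookup_add lookup_minus lookup_single when_def in_keys_iff)
qed

lemma homogeneous_zero [simp]: "homogeneous d 0"
  by (simp add: homogeneous_def)

lemma homogeneous_add: "homogeneous d p \<Longrightarrow> homogeneous d q \<Longrightarrow> homogeneous d (p + q)"
  using keys_add[of p q] by (fastforce simp: homogeneous_def)

lemma homogeneous_minus: "homogeneous d p \<Longrightarrow> homogeneous d (- p)"
  by (simp add: homogeneous_def in_keys_iff)

lemma homogeneous_diff: "homogeneous d p \<Longrightarrow> homogeneous d q \<Longrightarrow> homogeneous d (p - q)"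
  using homogeneous_add[of d p "- q"] homogeneous_minus[of d q] by simp

lemma homogeneous_sum: "(\<And>i. i \<in> A \<Longrightarrow> homogeneous d (f i)) \<Longrightarrow> homogeneous d (sum f A)"
  by (induct A rule: infinite_finite_induct) (auto intro: homogeneous_add)

lemma homogeneous_mult:
  fixes p q :: "('v::finite, 'k::comm_ring_1) mpoly"
  assumes "homogeneous d p" "homogeneous e q"
  shows "homogeneous (d + e) (p * q)"
  using assms keys_mult[of p q] by (fastforce simp: homogeneous_def)

lemma homogeneous_single: "homogeneous (int (monom_degree m)) (sgl m c)"
  by (simp add: homogeneous_def)

lemma homogeneous_var: "homogeneous 1 (var a)"
  unfolding var_def using homogeneous_single[of "sgl a 1" 1] by simp

lemma homogeneous_const: "homogeneous 0 (sgl 0 c)"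
  using homogeneous_single[of 0 c] by simp

definition hcomp :: "int \<Rightarrow> ('v, 'k::comm_ring_1) mpoly \<Rightarrow> ('v, 'k) mpoly" where
  "hcomp d p = (\<Sum>m\<in>ks p. if int (monom_degree m) = d then sgl m (lkp p m) else 0)"

lemma lookup_hcomp: "lkp (hcomp d p) m = (if int (monom_degree m) = d then lkp p m else 0)"
proof -
  have "lkp (hcomp d p) m =
    (\<Sum>n\<in>ks p. if n = m then (if int (monom_degree m) = d then lkp p m else 0) else 0)"
    unfolding hcomp_def lookup_sum by (rule sum.cong) (auto simp: lookup_single when_def)
  then show ?thesis by (auto simp: sum.delta in_keys_iff)
qed

lemma hcomp_add: "hcomp d (p + q) = hcomp d p + hcomp d q"
  by (rule poly_mapping_eqI) (simp add: lookup_hcomp lookup_add)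

lemma hcomp_zero [simp]: "hcomp d 0 = 0"
  by (simp add: hcomp_def)

lemma hcomp_minus: "hcomp d (- p) = - hcomp d p"
  by (rule poly_mapping_eqI) (simp add: lookup_hcomp)

lemma hcomp_diff: "hcomp d (p - q) = hcomp d p - hcomp d q"
  by (rule poly_mapping_eqI) (simp add: lookup_hcomp lookup_minus)

lemma hcomp_sum: "hcomp d (sum f A) = (\<Sum>i\<in>A. hcomp d (f i))"
  by (induct A rule: infinite_finite_induct) (auto simp: hcomp_add)

lemma homogeneous_hcomp: "homogeneous d (hcomp d p)"
  by (auto simp: homogeneous_def in_keys_iff lookup_hcomp split: if_splits)

lemma hcomp_homogeneous: "homogeneous d p \<Longrightarrow> hcomp d p = p"
  by (rule poly_mapping_eqI) (auto simp: homogeneous_def lookup_hcomp in_keys_iff)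

lemma hcomp_eq_0:
  assumes "\<And>m. m \<in> ks p \<Longrightarrow> int (monom_degree m) \<noteq> d" shows "hcomp d p = 0"
  using assms by (intro poly_mapping_eqI) (auto simp: lookup_hcomp in_keys_iff)

lemma homogeneous_neg_degree: "homogeneous d p \<Longrightarrow> d < 0 \<Longrightarrow> p = 0"
  using hcomp_homogeneous[of d p] hcomp_eq_0[of p d] by fastforce

lemma hcomp_mult:
  fixes p y :: "('v::finite, 'k::comm_ring_1) mpoly"
  assumes "homogeneous e y"
  shows "hcomp d (y * p) = y * hcomp (d - e) p"
proof -
  define q where "q = p - hcomp (d - e) p"
  have q: "int (monom_degree m) \<noteq> d - e" if "m \<in> ks q" for m
    using that by (auto simp: q_def in_keys_iff lookup_minus lookup_hcomp)
  have "hcomp d (y * q) = 0"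
  proof (rule hcomp_eq_0)
    fix m assume "m \<in> ks (y * q)"
    then obtain a b where "a \<in> ks y" "b \<in> ks q" "m = a + b" using keys_mult[of y q] by auto
    then show "int (monom_degree m) \<noteq> d"
      using assms q[of b] by (auto simp: homogeneous_def)
  qed
  moreover have "hcomp d (y * hcomp (d - e) p) = y * hcomp (d - e) p"
    using homogeneous_mult[OF assms homogeneous_hcomp[of "d - e" p]] hcomp_homogeneous by force
  moreover have "y * p = y * q + y * hcomp (d - e) p" by (simp add: q_def algebra_simps)
  ultimately show ?thesis by (simp add: hcomp_add)
qed

lemma sum_hcomp: "p = (\<Sum>d\<in>(\<lambda>m. int (monom_degree m)) ` ks p. hcomp d p)"
proof (rule poly_mapping_eqI)
  fix m
  show "lkp p m = lkp (\<Sum>d\<in>(\<lambda>m. int (monom_degree m)) ` ks p. hcomp d p) m"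
    by (cases "m \<in> ks p") (auto simp: lookup_sum lookup_hcomp in_keys_iff intro!: sum.neutral)
qed

lemma const_coeff_add: "const_coeff (p + q) = const_coeff p + const_coeff q"
  and const_coeff_diff: "const_coeff (p - q) = const_coeff p - const_coeff q"
  and const_coeff_zero [simp]: "const_coeff 0 = 0"
  by (simp_all add: const_coeff_def lookup_add lookup_minus)

lemma const_coeff_sum: "const_coeff (sum f A) = (\<Sum>i\<in>A. const_coeff (f i))"
  by (simp add: const_coeff_def lookup_sum)

text \<open>A product of monomials is 1 only if both factors are, so a polynomial without constant
  term keeps this property under multiplication.\<close>

lemma const_coeff_mult:
  fixes p q :: "('v, 'k::comm_ring_1) mpoly"
  shows "const_coeff (p * q) = const_coeff p * const_coeff q"
proof -
  define p' where "p' = p - sgl 0 (const_coeff p)"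
  have p': "0 \<notin> ks p'" by (simp add: p'_def in_keys_iff lookup_minus const_coeff_def)
  have "0 \<notin> ks (p' * q)"
  proof
    assume "0 \<in> ks (p' * q)"
    then obtain a b where ab: "a \<in> ks p'" "(0 :: 'v monom) = a + b" using keys_mult[of p' q] by auto
    have "ks a \<union> ks b = {}" using ab(2) keys_monom_add[of a b] by (metis keys_zero)
    then have "a = 0" by (simp add: poly_mapping_eqI not_in_keys_iff_lookup_eq_zero)
    then show False using ab(1) p' by simp
  qed
  then have "const_coeff (p' * q) = 0" by (simp add: const_coeff_def in_keys_iff)
  moreover have "const_coeff (sgl 0 (const_coeff p) * q) = const_coeff p * const_coeff q"
    using lookup_single_mult_add[of 0 "const_coeff p" q 0] by (simp add: const_coeff_def)
  moreover have "p * q = p' * q + sgl 0 (const_coeff p) * q" by (simp add: p'_def algebra_simps)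
  ultimately show ?thesis by (simp add: const_coeff_add)
qed

lemma const_coeff_homogeneous: "homogeneous d p \<Longrightarrow> d \<noteq> 0 \<Longrightarrow> const_coeff p = 0"
  unfolding homogeneous_def const_coeff_def
  by (metis in_keys_iff monom_degree_zero of_nat_0)

lemma const_coeff_var [simp]: "const_coeff (var a) = 0"
  using const_coeff_homogeneous[OF homogeneous_var] by simp

lemma const_coeff_single [simp]: "const_coeff (sgl 0 c) = c"
  by (simp add: const_coeff_def)

lemma homogeneous_0_eq_const: "homogeneous 0 p \<Longrightarrow> p = sgl 0 (const_coeff p)"
  by (rule poly_mapping_eqI)
    (auto simp: homogeneous_def const_coeff_def in_keys_iff lookup_single when_def monom_degree_eq_0_iff)

lemma homogeneous_0_const_coeff_0: "homogeneous 0 p \<Longrightarrow> const_coeff p = 0 \<Longrightarrow> p = 0"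
  using homogeneous_0_eq_const[of p] by simp

section \<open>Graded ideals and ideals generated by variables\<close>

definition graded_ideal :: "('v, 'k::comm_ring_1) mpoly set \<Rightarrow> bool" where
  "graded_ideal J \<longleftrightarrow> is_ideal J \<and> (\<forall>p\<in>J. \<forall>d. hcomp d p \<in> J)"

lemma graded_idealD: "graded_ideal J \<Longrightarrow> is_ideal J"
  "graded_ideal J \<Longrightarrow> p \<in> J \<Longrightarrow> hcomp d p \<in> J"
  by (auto simp: graded_ideal_def)

lemma graded_ideal_plus:
  fixes y :: "('v::finite, 'k::comm_ring_1) mpoly"
  assumes "graded_ideal J" "homogeneous e y"
  shows "graded_ideal (ideal_plus J y)"
  unfolding graded_ideal_def
proof (intro conjI ballI allI)
  show "is_ideal (ideal_plus J y)" using is_ideal_ideal_plus graded_idealD(1)[OF assms(1)] .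
  fix p d assume "p \<in> ideal_plus J y"
  then obtain g h where "g \<in> J" "p = g + y * h" by (rule ideal_plusE)
  then have "hcomp d p = hcomp d g + y * hcomp (d - e) h"
    by (simp add: hcomp_add hcomp_mult[OF assms(2)])
  moreover have "hcomp d g + y * hcomp (d - e) h \<in> ideal_plus J y"
    using ideal_plusI graded_idealD(2)[OF assms(1) \<open>g \<in> J\<close>] .
  ultimately show "hcomp d p \<in> ideal_plus J y" by metis
qed

lemma module_mult: "module ((*) :: 'r::comm_ring_1 \<Rightarrow> 'r \<Rightarrow> 'r)"
  by unfold_locales (auto simp: algebra_simps)

lemma is_ideal_span: "is_ideal (module.span (*) B)"
  unfolding is_ideal_def
  using module.span_zero[OF module_mult] module.span_add[OF module_mult] module.span_scale[OF module_mult]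
  by blast

lemma graded_ideal_span:
  fixes B :: "('v::finite, 'k::comm_ring_1) mpoly set"
  assumes "\<And>b. b \<in> B \<Longrightarrow> homogeneous e b"
  shows "graded_ideal (module.span (*) B)"
  unfolding graded_ideal_def
proof (intro conjI is_ideal_span ballI allI)
  fix p d assume "p \<in> module.span (*) B"
  then show "hcomp d p \<in> module.span (*) B"
  proof (induct rule: module.span_induct_alt[OF module_mult, consumes 1, case_names base step])
    case base then show ?case by (simp add: module.span_zero[OF module_mult])
  next
    case (step c x y)
    have "hcomp d (c * x) = hcomp (d - e) c * x"
      using hcomp_mult[OF assms[OF step(1)], of d c] by (simp add: mult.commute)
    then show ?case using step
      by (auto simp: hcomp_add intro!: ideal_add[OF is_ideal_span] ideal_mult[OF is_ideal_span]
          intro: module.span_base[OF module_mult])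
  qed
qed

text \<open>The ideal generated by the variables in \<open>U\<close>, described by its monomials so
  that primality can be checked term by term; \<open>vars_ideal_insert\<close> ties it to
  generators.\<close>

definition vars_ideal :: "'v set \<Rightarrow> ('v, 'k::comm_ring_1) mpoly set" where
  "vars_ideal U = {p. \<forall>m\<in>ks p. \<exists>v\<in>U. v \<in> ks m}"

lemma is_ideal_vars_ideal: "is_ideal (vars_ideal U)"
  unfolding is_ideal_def
proof (intro conjI ballI allI)
  show "0 \<in> vars_ideal U" by (simp add: vars_ideal_def)
next
  fix a b :: "('a, 'b) mpoly" assume "a \<in> vars_ideal U" "b \<in> vars_ideal U"
  then show "a + b \<in> vars_ideal U"
    using keys_add[of a b] unfolding vars_ideal_def by blast
next
  fix r a :: "('a, 'b) mpoly" assume a: "a \<in> vars_ideal U"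
  show "r * a \<in> vars_ideal U" unfolding vars_ideal_def
  proof (intro CollectI ballI)
    fix m assume "m \<in> ks (r * a)"
    then obtain n k where "m = n + k" "k \<in> ks a" using keys_mult[of r a] by auto
    then show "\<exists>v\<in>U. v \<in> ks m" using a by (auto simp: vars_ideal_def keys_monom_add)
  qed
qed

lemma graded_ideal_vars_ideal: "graded_ideal (vars_ideal U)"
  unfolding graded_ideal_def
proof (intro conjI is_ideal_vars_ideal ballI allI)
  fix p :: "('a, 'b) mpoly" and d assume p: "p \<in> vars_ideal U"
  have "ks (hcomp d p) \<subseteq> ks p" by (auto simp: in_keys_iff lookup_hcomp split: if_splits)
  then show "hcomp d p \<in> vars_ideal U" using p unfolding vars_ideal_def by blast
qed

lemma var_in_vars_ideal: "v \<in> U \<Longrightarrow> var v \<in> vars_ideal U"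
  by (simp add: vars_ideal_def var_def)

lemma vars_ideal_insert: "vars_ideal (insert v U) = ideal_plus (vars_ideal U) (var v)"
proof
  show "vars_ideal (insert v U) \<subseteq> (ideal_plus (vars_ideal U) (var v) :: ('a, 'b) mpoly set)"
  proof
    fix p :: "('a, 'b) mpoly" assume p: "p \<in> vars_ideal (insert v U)"
    have "(\<Sum>m\<in>ks p. sgl m (lkp p m)) \<in> ideal_plus (vars_ideal U) (var v)"
    proof (rule ideal_sum[OF is_ideal_ideal_plus[OF is_ideal_vars_ideal]])
      fix m assume m: "m \<in> ks p"
      show "sgl m (lkp p m) \<in> ideal_plus (vars_ideal U) (var v)"
      proof (cases "v \<in> ks m")
        case True
        then obtain m' where "m = sgl v 1 + m'" by (rule monom_split)
        then have "sgl m (lkp p m) = var v * sgl m' (lkp p m)"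
          by (simp add: var_def mult_single)
        then show ?thesis using ideal_plus_self[OF is_ideal_vars_ideal] by metis
      next
        case False
        then have "sgl m (lkp p m) \<in> vars_ideal U" using p m by (auto simp: vars_ideal_def)
        then show ?thesis using ideal_subset_ideal_plus by blast
      qed
    qed
    then show "p \<in> ideal_plus (vars_ideal U) (var v)" using poly_eq_sum_monomials[of p] by metis
  qed
  have "vars_ideal U \<subseteq> (vars_ideal (insert v U) :: ('a, 'b) mpoly set)"
    by (auto simp: vars_ideal_def)
  then show "ideal_plus (vars_ideal U) (var v) \<subseteq> (vars_ideal (insert v U) :: ('a, 'b) mpoly set)"
    by (auto elim!: ideal_plusE intro!: ideal_add ideal_mult_right is_ideal_vars_ideal var_in_vars_ideal)
qed

lemma vars_ideal_empty: "vars_ideal {} = {0}"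
  unfolding vars_ideal_def by (auto intro!: poly_mapping_eqI simp: in_keys_iff)

text \<open>Multiplication by \<open>var v\<close> shifts the monomials of \<open>p\<close>
  injectively and adds only \<open>v\<close>, which does not belong to \<open>U\<close>.\<close>

lemma vars_ideal_prime:
  assumes "var v * p \<in> vars_ideal U" "v \<notin> U"
  shows "p \<in> vars_ideal U"
  unfolding vars_ideal_def
proof (intro CollectI ballI)
  fix m assume "m \<in> ks p"
  then have "sgl v 1 + m \<in> ks (var v * p)"
    using lookup_single_mult_add[of "sgl v 1" 1 p m] by (simp add: var_def in_keys_iff)
  then obtain u where "u \<in> U" "u \<in> ks (sgl v 1 + m)"
    using assms(1) unfolding vars_ideal_def by blast
  then show "\<exists>u\<in>U. u \<in> ks m" using assms(2) by (auto simp: keys_monom_add)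
qed

lemma koszul_gen_vars: "koszul_gen (map var vs) = vars_ideal (set vs)"
  by (induct vs) (simp_all add: koszul_gen_Nil vars_ideal_empty koszul_gen_Cons vars_ideal_insert)

lemma koszul_exact_vars: "distinct vs \<Longrightarrow> koszul_exact (map var vs)"
  by (induct vs) (auto intro!: koszul_exact_Nil koszul_exact_Cons simp: koszul_gen_vars
      intro: vars_ideal_prime)

lemma vars_ideal_UNIV: "p \<in> vars_ideal UNIV \<longleftrightarrow> const_coeff p = 0"
proof
  assume "p \<in> vars_ideal UNIV"
  then have "0 \<notin> ks p" by (auto simp: vars_ideal_def)
  then show "const_coeff p = 0" by (simp add: const_coeff_def in_keys_iff)
next
  assume c: "const_coeff p = 0"
  show "p \<in> vars_ideal UNIV" unfolding vars_ideal_def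
  proof (intro CollectI ballI)
    fix m assume "m \<in> ks p"
    then have "m \<noteq> 0" using c by (auto simp: const_coeff_def in_keys_iff)
    then have "\<exists>v. lkp m v \<noteq> 0" by (metis lookup_zero poly_mapping_eqI)
    then show "\<exists>v\<in>UNIV. v \<in> ks m" by (simp add: in_keys_iff)
  qed
qed

section \<open>Vanishing of Koszul homology\<close>

abbreviation linear_forms :: "('v, 'k::comm_ring_1) mpoly list \<Rightarrow> bool" where
  "linear_forms ys \<equiv> (\<forall>y\<in>set ys. homogeneous 1 y)"

definition koszul_cycle where
  "koszul_cycle ys J z \<longleftrightarrow> (\<forall>bs. length bs = length ys \<longrightarrow> kd ys z bs \<in> J)"

definition koszul_boundary where
  "koszul_boundary ys J z \<longleftrightarrow> (\<exists>w. \<forall>bs. length bs = length ys \<longrightarrow> z bs - kd ys w bs \<in> J)"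

text \<open>
  Cycles whose coefficients lie in $(S/J)_d$, $d \geq c$, are boundaries.  For \<open>ys\<close> the list of
  variables this says that $S/J$ has regularity less than $c$.
\<close>

definition koszul_vanishes ::
  "('v, 'k::comm_ring_1) mpoly list \<Rightarrow> ('v, 'k) mpoly set \<Rightarrow> int \<Rightarrow> bool" where
  "koszul_vanishes ys J c \<longleftrightarrow> (\<forall>z d. c \<le> d \<longrightarrow> (\<forall>bs. homogeneous d (z bs)) \<longrightarrow>
     koszul_cycle ys J z \<longrightarrow> koszul_boundary ys J z)"

lemma koszul_vanishesD:
  assumes "koszul_vanishes ys J c" "c \<le> d" "\<And>bs. homogeneous d (z bs)" "koszul_cycle ys J z"
  shows "koszul_boundary ys J z"
  using assms unfolding koszul_vanishes_def by blast

lemma hcomp_kd: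
  fixes ys :: "('v::finite, 'k::comm_ring_1) mpoly list"
  assumes "linear_forms ys"
  shows "hcomp d (kd ys w bs) = kd ys (\<lambda>c. hcomp (d - 1) (w c)) bs"
  using assms
proof (induct ys arbitrary: w bs)
  case (Cons y ys)
  then show ?case by (cases bs) (auto simp: hcomp_add hcomp_minus hcomp_mult)
qed simp

lemma homogeneous_kd:
  fixes ys :: "('v::finite, 'k::comm_ring_1) mpoly list"
  assumes "linear_forms ys" "\<And>c. homogeneous (d - 1) (z c)"
  shows "homogeneous d (kd ys z bs)"
proof -
  have "hcomp d (kd ys z bs) = kd ys z bs"
    by (simp add: hcomp_kd[OF assms(1)] hcomp_homogeneous assms(2))
  then show ?thesis using homogeneous_hcomp by metis
qed

lemma homogeneous_kw:
  fixes ys :: "('v::finite, 'k::comm_ring_1) mpoly list"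
  assumes "\<And>c. homogeneous d (z c)" shows "homogeneous d (kw t ys z bs)"
  using assms
proof (induct ys arbitrary: z bs)
  case (Cons y ys)
  then show ?case by (cases bs) (auto intro: homogeneous_minus)
qed simp

lemma homogeneous_ksign: "homogeneous d p \<Longrightarrow> homogeneous d (ksign bs * p)"
  by (induct bs) (auto intro: homogeneous_minus)

lemma koszul_boundary_homogeneous:
  fixes ys :: "('v::finite, 'k::comm_ring_1) mpoly list"
  assumes "koszul_boundary ys J z" "graded_ideal J" "linear_forms ys" "\<And>bs. homogeneous d (z bs)"
  obtains w where "\<And>c. homogeneous (d - 1) (w c)"
    "\<And>bs. length bs = length ys \<Longrightarrow> z bs - kd ys w bs \<in> J"
proof -
  obtain w where w: "\<And>bs. length bs = length ys \<Longrightarrow> z bs - kd ys w bs \<in> J"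
    using assms(1) unfolding koszul_boundary_def by blast
  have "z bs - kd ys (\<lambda>c. hcomp (d - 1) (w c)) bs \<in> J" if "length bs = length ys" for bs
    using graded_idealD(2)[OF assms(2) w[OF that], of d]
    by (simp add: hcomp_diff hcomp_kd[OF assms(3)] hcomp_homogeneous[OF assms(4)])
  then show ?thesis using that[of "\<lambda>c. hcomp (d - 1) (w c)"] homogeneous_hcomp by blast
qed

lemma ideal_plus_homogeneous:
  fixes y :: "('v::finite, 'k::comm_ring_1) mpoly"
  assumes "p \<in> ideal_plus J y" "graded_ideal J" "homogeneous 1 y" "homogeneous d p"
  shows "\<exists>h. homogeneous (d - 1) h \<and> p - y * h \<in> J"
proof -
  obtain g h where gh: "g \<in> J" "p = g + y * h" using assms(1) by (rule ideal_plusE)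
  have "p = hcomp d g + y * hcomp (d - 1) h"
    using hcomp_homogeneous[OF assms(4)] by (simp add: gh(2) hcomp_add hcomp_mult[OF assms(3)])
  then have "p - y * hcomp (d - 1) h \<in> J" using graded_idealD(2)[OF assms(2) gh(1), of d] by simp
  then show ?thesis using homogeneous_hcomp by blast
qed

text \<open>The long exact sequence of 0 -> S/(J : b)(-1) -> S/J -> S/(J + (b)) -> 0, written out
  with chains. The twist by the degree of \<open>b\<close> accounts for
  \<open>c - 1\<close>.\<close>

lemma koszul_vanishes_ses:
  fixes ys :: "('v::finite, 'k::comm_ring_1) mpoly list"
  assumes gr: "graded_ideal J" and b: "homogeneous 1 b" and ys: "linear_forms ys"
    and v1: "koszul_vanishes ys (ideal_plus J b) c"
    and v2: "koszul_vanishes ys {h. b * h \<in> J} (c - 1)"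
  shows "koszul_vanishes ys J c"
  unfolding koszul_vanishes_def
proof (intro allI impI)
  note J = graded_idealD(1)[OF gr]
  fix z d assume d: "c \<le> d" and z: "\<forall>bs. homogeneous d (z bs)" and cyc: "koszul_cycle ys J z"
  have "koszul_cycle ys (ideal_plus J b) z"
    using cyc ideal_subset_ideal_plus unfolding koszul_cycle_def by blast
  then have "koszul_boundary ys (ideal_plus J b) z" using koszul_vanishesD[OF v1 d] z by blast
  then obtain w where wh: "\<And>c. homogeneous (d - 1) (w c)"
    and w: "\<And>bs. length bs = length ys \<Longrightarrow> z bs - kd ys w bs \<in> ideal_plus J b"
    using koszul_boundary_homogeneous[OF _ graded_ideal_plus[OF gr b] ys] z by metis
  have "homogeneous d (z bs - kd ys w bs)" for bs
    using homogeneous_diff[OF z[rule_format] homogeneous_kd[OF ys wh]] .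
  then have "\<exists>h. homogeneous (d - 1) h \<and> (length bs = length ys \<longrightarrow> z bs - kd ys w bs - b * h \<in> J)" for bs
    using ideal_plus_homogeneous[OF w gr b] by (cases "length bs = length ys") (auto intro: exI[of _ 0])
  then obtain h where h: "\<And>bs. homogeneous (d - 1) (h bs)"
    "\<And>bs. length bs = length ys \<Longrightarrow> z bs - kd ys w bs - b * h bs \<in> J" by metis
  have "koszul_cycle ys {h. b * h \<in> J} h"
    unfolding koszul_cycle_def
  proof (intro allI impI CollectI)
    fix bs :: "bool list" assume bs: "length bs = length ys"
    have "kd ys (\<lambda>c. z c - kd ys w c - b * h c) bs \<in> J"
      by (rule kd_in_ideal[OF J h(2) bs])
    then have "kd ys z bs - b * kd ys h bs \<in> J" by (simp add: kd_diff kd_scale kd_kd)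
    moreover have "kd ys z bs \<in> J" using cyc bs by (simp add: koszul_cycle_def)
    ultimately have "kd ys z bs - (kd ys z bs - b * kd ys h bs) \<in> J" by (metis ideal_diff[OF J])
    then show "b * kd ys h bs \<in> J" by simp
  qed
  then have "koszul_boundary ys {h. b * h \<in> J} h" using koszul_vanishesD[OF v2, of "d - 1" h] d h(1) by simp
  then obtain w' where w': "\<And>bs. length bs = length ys \<Longrightarrow> b * (h bs - kd ys w' bs) \<in> J"
    unfolding koszul_boundary_def by blast
  have "z bs - kd ys (\<lambda>c. w c + b * w' c) bs \<in> J" if "length bs = length ys" for bs
    using ideal_add[OF J h(2)[OF that] w'[OF that]] by (simp add: kd_add kd_scale algebra_simps)
  then show "koszul_boundary ys J z" unfolding koszul_boundary_def by blast
qed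

text \<open>As \<open>y\<close> occurs in \<open>ys\<close>, it acts as zero on the homology of S/J,
  so the connecting map from the homology of S/(J + (y)) onto that of S/J is surjective. Explicitly,
  \<open>kw y ys z\<close> is a cycle modulo \<open>ideal_plus J y\<close> that is sent to the class
  of \<open>z\<close>.\<close>

lemma koszul_vanishes_nonzerodivisor:
  fixes ys :: "('v::finite, 'k::comm_ring_1) mpoly list"
  assumes J: "is_ideal J" and y: "y \<in> set ys"
    and v: "koszul_vanishes ys (ideal_plus J y) c"
    and nzd: "\<And>p. y * p \<in> J \<Longrightarrow> p \<in> J"
  shows "koszul_vanishes ys J c"
  unfolding koszul_vanishes_def
proof (intro allI impI)
  fix z d assume d: "c \<le> d" and z: "\<forall>bs. homogeneous d (z bs)" and cyc: "koszul_cycle ys J z"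
  define u where "u = kw y ys z"
  have kwJ: "kw y ys (kd ys z) bs \<in> J" if "length bs = length ys" for bs
    using cyc that by (intro kw_in_ideal[OF J]) (auto simp: koszul_cycle_def)
  have Du: "kd ys u bs = y * z bs - kw y ys (kd ys z) bs" if "length bs = length ys" for bs
    using kw_homotopy[OF y that, of z] by (simp add: u_def algebra_simps)
  have "koszul_cycle ys (ideal_plus J y) u"
    unfolding koszul_cycle_def
  proof (intro allI impI)
    fix bs :: "bool list" assume bs: "length bs = length ys"
    have "- kw y ys (kd ys z) bs + y * z bs \<in> ideal_plus J y"
      by (intro ideal_plusI ideal_minus[OF J] kwJ bs)
    then show "kd ys u bs \<in> ideal_plus J y" by (simp add: Du bs)
  qed
  then have "koszul_boundary ys (ideal_plus J y) u"
    using koszul_vanishesD[OF v d] z by (simp add: u_def homogeneous_kw)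
  then obtain w where "\<forall>bs. length bs = length ys \<longrightarrow> u bs - kd ys w bs \<in> ideal_plus J y"
    unfolding koszul_boundary_def by blast
  then have "\<forall>bs. \<exists>h. length bs = length ys \<longrightarrow> u bs - kd ys w bs - y * h \<in> J"
    by (metis ideal_plusE add_diff_cancel_right')
  then obtain h where h: "\<And>bs. length bs = length ys \<Longrightarrow> u bs - kd ys w bs - y * h bs \<in> J" by metis
  have "z bs - kd ys h bs \<in> J" if bs: "length bs = length ys" for bs
  proof (rule nzd)
    have "kd ys (\<lambda>c. u c - kd ys w c - y * h c) bs \<in> J"
      by (rule kd_in_ideal[OF J h bs])
    then have "y * z bs - kw y ys (kd ys z) bs - y * kd ys h bs \<in> J"
      by (simp add: kd_diff kd_scale kd_kd Du bs)
    then show "y * (z bs - kd ys h bs) \<in> J"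
      using ideal_add[OF J _ kwJ[OF bs]] by (force simp: algebra_simps)
  qed
  then show "koszul_boundary ys J z" unfolding koszul_boundary_def by blast
qed

text \<open>The homology of S/(J + (y)) is squeezed between that of S/J and that of S/J with
  homological and internal degree both shifted by one. The coefficient degree is the same on both
  sides, so one bound suffices.\<close>

lemma koszul_vanishes_ideal_plus:
  fixes ys :: "('v::finite, 'k::comm_ring_1) mpoly list"
  assumes gr: "graded_ideal J" and y: "homogeneous 1 y" and ys: "linear_forms ys"
    and v: "koszul_vanishes ys J c"
    and nzd: "\<And>p. y * p \<in> J \<Longrightarrow> p \<in> J"
  shows "koszul_vanishes ys (ideal_plus J y) c"
  unfolding koszul_vanishes_def
proof (intro allI impI)
  note J = graded_idealD(1)[OF gr]
  fix z d assume d: "c \<le> d" and z: "\<forall>bs. homogeneous d (z bs)"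
    and cyc: "koszul_cycle ys (ideal_plus J y) z"
  have Dz: "homogeneous (d + 1) (kd ys z bs)" for bs
    using z by (intro homogeneous_kd[OF ys]) simp
  have "\<exists>h. homogeneous d h \<and> (length bs = length ys \<longrightarrow> kd ys z bs - y * h \<in> J)" for bs
  proof (cases "length bs = length ys")
    case True
    then have "kd ys z bs \<in> ideal_plus J y" using cyc by (simp add: koszul_cycle_def)
    then show ?thesis using ideal_plus_homogeneous[OF _ gr y Dz] by fastforce
  qed (auto intro: exI[of _ 0])
  then obtain h where h: "\<And>bs. homogeneous d (h bs)"
    "\<And>bs. length bs = length ys \<Longrightarrow> kd ys z bs - y * h bs \<in> J" by metis
  have "koszul_cycle ys J h"
    unfolding koszul_cycle_def
  proof (intro allI impI)
    fix bs :: "bool list" assume bs: "length bs = length ys"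
    have "kd ys (\<lambda>c. kd ys z c - y * h c) bs \<in> J" by (rule kd_in_ideal[OF J h(2) bs])
    then have "- (y * kd ys h bs) \<in> J" by (simp add: kd_diff kd_scale kd_kd)
    from ideal_minus[OF J this] have "y * kd ys h bs \<in> J" by simp
    then show "kd ys h bs \<in> J" by (rule nzd)
  qed
  then have "koszul_boundary ys J h" using koszul_vanishesD[OF v d] h(1) by blast
  then obtain w where wh: "\<And>c. homogeneous (d - 1) (w c)"
    and w: "\<And>bs. length bs = length ys \<Longrightarrow> h bs - kd ys w bs \<in> J"
    using koszul_boundary_homogeneous[OF _ gr ys] h(1) by metis
  define z' where "z' = (\<lambda>c. z c - y * w c)"
  have "homogeneous d (z' bs)" for bs
    using homogeneous_mult[OF y wh, of bs] z by (auto simp: z'_def intro: homogeneous_diff)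
  moreover have "koszul_cycle ys J z'"
    unfolding koszul_cycle_def
  proof (intro allI impI)
    fix bs :: "bool list" assume bs: "length bs = length ys"
    have "(kd ys z bs - y * h bs) + y * (h bs - kd ys w bs) \<in> J"
      by (intro ideal_add[OF J] ideal_mult[OF J] h w bs)
    then show "kd ys z' bs \<in> J" by (simp add: z'_def kd_diff kd_scale algebra_simps)
  qed
  ultimately have "koszul_boundary ys J z'" using koszul_vanishesD[OF v d] by blast
  then obtain w' where w': "\<And>bs. length bs = length ys \<Longrightarrow> z' bs - kd ys w' bs \<in> J"
    unfolding koszul_boundary_def by blast
  have "z bs - kd ys w' bs \<in> ideal_plus J y" if "length bs = length ys" for bs
    using ideal_plusI[OF w'[OF that], of y "w bs"] by (simp add: z'_def)
  then show "koszul_boundary ys (ideal_plus J y) z" unfolding koszul_boundary_def by blast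
qed

text \<open>Again a mapping cone: once the \<open>True\<close> half \<open>z''\<close> of a cycle is
  known to bound, the corrected \<open>False\<close> half \<open>x\<close> is a cycle on
  \<open>ys\<close>. Both halves have the same coefficient degree, so the bound survives for an
  arbitrary linear form \<open>t\<close>.\<close>

lemma koszul_vanishes_snoc:
  fixes ys :: "('v::finite, 'k::comm_ring_1) mpoly list"
  assumes gr: "graded_ideal J" and t: "homogeneous 1 t" and ys: "linear_forms ys"
    and v: "koszul_vanishes ys J c"
  shows "koszul_vanishes (ys @ [t]) J c"
  unfolding koszul_vanishes_def
proof (intro allI impI)
  note J = graded_idealD(1)[OF gr]
  fix z d assume d: "c \<le> d" and z: "\<forall>bs. homogeneous d (z bs)" and cyc: "koszul_cycle (ys @ [t]) J z"
  define z' where "z' = (\<lambda>c. z (c @ [False]))"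
  define z'' where "z'' = (\<lambda>c. z (c @ [True]))"
  have c2: "kd ys z'' bs \<in> J" if "length bs = length ys" for bs
    using cyc[unfolded koszul_cycle_def, rule_format, of "bs @ [True]"] that
    by (simp add: kd_snoc z''_def)
  have c1: "kd ys z' bs + ksign bs * (t * z'' bs) \<in> J" if "length bs = length ys" for bs
    using cyc[unfolded koszul_cycle_def, rule_format, of "bs @ [False]"] that
    by (simp add: kd_snoc z'_def z''_def)
  have "koszul_boundary ys J z''"
    using koszul_vanishesD[OF v d] z c2 by (auto simp: z''_def koszul_cycle_def)
  then obtain u where uh: "\<And>c. homogeneous (d - 1) (u c)"
    and u: "\<And>bs. length bs = length ys \<Longrightarrow> z'' bs - kd ys u bs \<in> J"
    using koszul_boundary_homogeneous[OF _ gr ys, of z'' d] z by (auto simp: z''_def)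
  define x where "x = (\<lambda>c. z' c - ksign c * (t * u c))"
  have "homogeneous d (x bs)" for bs
    using homogeneous_ksign[OF homogeneous_mult[OF t uh]] z
    by (auto simp: x_def z'_def intro!: homogeneous_diff)
  moreover have "koszul_cycle ys J x"
    unfolding koszul_cycle_def
  proof (intro allI impI)
    fix bs :: "bool list" assume bs: "length bs = length ys"
    have "(kd ys z' bs + ksign bs * (t * z'' bs)) - (ksign bs * t) * (z'' bs - kd ys u bs) \<in> J"
      by (intro ideal_diff[OF J] ideal_mult[OF J] c1 u bs)
    then show "kd ys x bs \<in> J" by (simp add: x_def kd_diff kd_scale kd_ksign algebra_simps)
  qed
  ultimately have "koszul_boundary ys J x" using koszul_vanishesD[OF v d] by blast
  then obtain w where w: "\<And>bs. length bs = length ys \<Longrightarrow> x bs - kd ys w bs \<in> J"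
    unfolding koszul_boundary_def by blast
  define W where "W = (\<lambda>bs. if last bs then u (butlast bs) else w (butlast bs))"
  have "z bs - kd (ys @ [t]) W bs \<in> J" if "length bs = length (ys @ [t])" for bs
  proof -
    from that obtain c b where bs: "bs = c @ [b]" "length c = length ys"
      by (cases bs rule: rev_cases) auto
    show ?thesis
      using u[OF bs(2)] w[OF bs(2)] bs
      by (cases b) (auto simp: kd_snoc W_def z''_def z'_def x_def diff_diff_eq add_ac)
  qed
  then show "koszul_boundary (ys @ [t]) J z" unfolding koszul_boundary_def by blast
qed

lemma koszul_vanishes_append:
  fixes ys :: "('v::finite, 'k::comm_ring_1) mpoly list"
  assumes "graded_ideal J" "linear_forms ts" "linear_forms ys" "koszul_vanishes ys J c"
  shows "koszul_vanishes (ys @ ts) J c"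
  using assms(2-)
proof (induct ts arbitrary: ys)
  case (Cons t ts)
  have "koszul_vanishes ((ys @ [t]) @ ts) J c"
    using Cons.prems by (intro Cons.hyps koszul_vanishes_snoc assms(1)) auto
  then show ?case by simp
qed simp

section \<open>Elements that annihilate Koszul homology\<close>

definition koszul_annihilator where
  "koszul_annihilator ys J = {f. \<forall>z. koszul_cycle ys J z \<longrightarrow> koszul_boundary ys J (\<lambda>bs. f * z bs)}"

lemma is_ideal_koszul_annihilator:
  assumes J: "is_ideal J" shows "is_ideal (koszul_annihilator ys J)"
  unfolding is_ideal_def
proof (intro conjI ballI allI)
  show "0 \<in> koszul_annihilator ys J"
    by (auto simp: koszul_annihilator_def koszul_boundary_def ideal_zero[OF J] intro!: exI[of _ "\<lambda>_. 0"])
next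
  fix a b assume ab: "a \<in> koszul_annihilator ys J" "b \<in> koszul_annihilator ys J"
  show "a + b \<in> koszul_annihilator ys J" unfolding koszul_annihilator_def
  proof (intro CollectI allI impI)
    fix z assume "koszul_cycle ys J z"
    then obtain w w' where "\<And>bs. length bs = length ys \<Longrightarrow> a * z bs - kd ys w bs \<in> J"
      "\<And>bs. length bs = length ys \<Longrightarrow> b * z bs - kd ys w' bs \<in> J"
      using ab unfolding koszul_annihilator_def koszul_boundary_def by blast
    then have "(a + b) * z bs - kd ys (\<lambda>c. w c + w' c) bs \<in> J" if "length bs = length ys" for bs
      using ideal_add[OF J, of "a * z bs - kd ys w bs" "b * z bs - kd ys w' bs"] that
      by (simp add: kd_add algebra_simps)
    then show "koszul_boundary ys J (\<lambda>bs. (a + b) * z bs)" unfolding koszul_boundary_def by blast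
  qed
next
  fix a r assume a: "a \<in> koszul_annihilator ys J"
  show "r * a \<in> koszul_annihilator ys J" unfolding koszul_annihilator_def
  proof (intro CollectI allI impI)
    fix z assume "koszul_cycle ys J z"
    then obtain w where "\<And>bs. length bs = length ys \<Longrightarrow> a * z bs - kd ys w bs \<in> J"
      using a unfolding koszul_annihilator_def koszul_boundary_def by blast
    then have "r * a * z bs - kd ys (\<lambda>c. r * w c) bs \<in> J" if "length bs = length ys" for bs
      using ideal_mult[OF J, of "a * z bs - kd ys w bs" r] that
      by (simp add: kd_scale algebra_simps)
    then show "koszul_boundary ys J (\<lambda>bs. r * a * z bs)" unfolding koszul_boundary_def by blast
  qed
qed

lemma subset_koszul_annihilator:
  assumes J: "is_ideal J" shows "J \<subseteq> koszul_annihilator ys J"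
  by (auto simp: koszul_annihilator_def koszul_boundary_def ideal_mult_right[OF J] intro!: exI[of _ "\<lambda>_. 0"])

lemma set_subset_koszul_annihilator:
  assumes J: "is_ideal J" shows "set ys \<subseteq> koszul_annihilator ys J"
proof
  fix y assume y: "y \<in> set ys"
  show "y \<in> koszul_annihilator ys J" unfolding koszul_annihilator_def
  proof (intro CollectI allI impI)
    fix z assume z: "koszul_cycle ys J z"
    have "y * z bs - kd ys (kw y ys z) bs \<in> J" if bs: "length bs = length ys" for bs
    proof -
      have "kw y ys (kd ys z) bs \<in> J"
        using z by (intro kw_in_ideal[OF J _ bs]) (auto simp: koszul_cycle_def)
      moreover have "y * z bs - kd ys (kw y ys z) bs = kw y ys (kd ys z) bs"
        using kw_homotopy[OF y bs, of z] by (metis add_diff_cancel_left')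
      ultimately show ?thesis by metis
    qed
    then show "koszul_boundary ys J (\<lambda>bs. y * z bs)" unfolding koszul_boundary_def by blast
  qed
qed

text \<open>Vanishing on \<open>a # ys\<close> makes multiplication by \<open>a\<close> injective on
  the homology on \<open>ys\<close> in the degrees concerned. An injective map some power of which
  is zero lives on the zero space.\<close>

lemma koszul_vanishes_peel:
  fixes ys :: "('v::finite, 'k::comm_ring_1) mpoly list"
  assumes gr: "graded_ideal J" and a: "homogeneous 1 a" and ys: "linear_forms ys"
    and v: "koszul_vanishes (a # ys) J c"
    and nil: "a ^ n \<in> koszul_annihilator ys J"
  shows "koszul_vanishes ys J c"
  unfolding koszul_vanishes_def
proof (intro allI impI)
  note J = graded_idealD(1)[OF gr]
  \<comment> \<open>A chain \<open>u\<close> bounding \<open>a * z\<close> combines with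
    \<open>z\<close> to a cycle on \<open>a # ys\<close>; up to sign, the \<open>True\<close> half
    of a chain that bounds this cycle bounds \<open>z\<close>.\<close>
  have step: "koszul_boundary ys J z"
    if d: "c \<le> d" and z: "\<And>bs. homogeneous d (z bs)" and cyc: "koszul_cycle ys J z"
      and az: "koszul_boundary ys J (\<lambda>bs. a * z bs)" for z d
  proof -
    have "homogeneous (d + 1) (a * z bs)" for bs
      using homogeneous_mult[OF a z, of bs] by (simp add: add.commute)
    then obtain u where uh: "\<And>c. homogeneous d (u c)"
      and u: "\<And>bs. length bs = length ys \<Longrightarrow> a * z bs - kd ys u bs \<in> J"
      using koszul_boundary_homogeneous[OF az gr ys, of "d + 1"] by auto
    define Z where "Z = kjoin (\<lambda>c. - u c) z"
    have "homogeneous d (Z bs)" for bs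
      unfolding Z_def by (cases bs) (auto intro: z homogeneous_minus uh)
    moreover have "koszul_cycle (a # ys) J Z"
      unfolding koszul_cycle_def
    proof (intro allI impI)
      fix bs :: "bool list" assume "length bs = length (a # ys)"
      then obtain b e where bs: "bs = b # e" "length e = length ys" by (cases bs) auto
      have "kd ys z e \<in> J" using cyc bs by (simp add: koszul_cycle_def)
      then show "kd (a # ys) Z bs \<in> J"
        using u[OF bs(2)] bs(1) by (auto simp: Z_def kd_minus intro: ideal_minus[OF J])
    qed
    ultimately have "koszul_boundary (a # ys) J Z" using koszul_vanishesD[OF v d] by blast
    then obtain W where W: "\<And>bs. length bs = length (a # ys) \<Longrightarrow> Z bs - kd (a # ys) W bs \<in> J"
      unfolding koszul_boundary_def by blast
    have "z bs - kd ys (\<lambda>c. - W (True # c)) bs \<in> J" if "length bs = length ys" for bs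
      using W[of "True # bs"] that by (simp add: Z_def kd_minus)
    then show ?thesis unfolding koszul_boundary_def by blast
  qed
  fix z d assume d: "c \<le> d" and z: "\<forall>bs. homogeneous d (z bs)" and cyc: "koszul_cycle ys J z"
  have cyc': "koszul_cycle ys J (\<lambda>bs. a ^ m * z bs)" for m
    using cyc ideal_mult[OF J] by (simp add: koszul_cycle_def kd_scale)
  have hom': "homogeneous (d + int m) (a ^ m * z bs)" for m bs
  proof (induct m)
    case (Suc m)
    from homogeneous_mult[OF a this] show ?case by (simp add: algebra_simps)
  qed (simp add: z)
  have "koszul_boundary ys J (\<lambda>bs. a ^ m * z bs) \<Longrightarrow> koszul_boundary ys J z" for m
  proof (induct m)
    case (Suc m)
    have "koszul_boundary ys J (\<lambda>bs. a ^ m * z bs)"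
      using Suc.prems d by (intro step[OF _ hom' cyc']) (auto simp: mult.assoc)
    then show ?case by (rule Suc.hyps)
  qed simp
  moreover have "koszul_boundary ys J (\<lambda>bs. a ^ n * z bs)"
    using nil cyc by (simp add: koszul_annihilator_def)
  ultimately show "koszul_boundary ys J z" by blast
qed

section \<open>Koszul homology modulo variables\<close>

lemma koszul_vanishes_zero_ideal:
  assumes "distinct vs" "set vs = (UNIV :: 'v::finite set)"
  shows "koszul_vanishes (map var vs :: ('v, 'k::comm_ring_1) mpoly list) {0} 1"
  unfolding koszul_vanishes_def
proof (intro allI impI)
  let ?ys = "map var vs :: ('v, 'k) mpoly list"
  fix z d assume d: "1 \<le> d" and z: "\<forall>bs. homogeneous d (z bs)" and cyc: "koszul_cycle ?ys {0} z"
  have "const_coeff (z (kzero ?ys)) = 0"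
    by (rule const_coeff_homogeneous[of d]) (use z d in auto)
  then have "z (kzero ?ys) \<in> koszul_gen ?ys"
    by (simp add: koszul_gen_vars vars_ideal_UNIV assms(2))
  moreover have "\<forall>bs. length bs = length ?ys \<longrightarrow> kd ?ys z bs = 0"
    using cyc by (simp add: koszul_cycle_def)
  moreover have "koszul_exact ?ys" by (rule koszul_exact_vars[OF assms(1)])
  ultimately obtain w where "\<forall>bs. length bs = length ?ys \<longrightarrow> z bs = kd ?ys w bs"
    unfolding koszul_exact_def by blast
  then show "koszul_boundary ?ys {0} z" unfolding koszul_boundary_def by (intro exI[of _ w]) simp
qed

lemma koszul_vanishes_vars_ideal:
  assumes "distinct vs" "set vs = (UNIV :: 'v::finite set)"
  shows "koszul_vanishes (map var vs :: ('v, 'k::comm_ring_1) mpoly list) (vars_ideal U) 1"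
proof -
  have "finite U" by simp
  then show ?thesis
  proof (induct U)
    case empty then show ?case
      using koszul_vanishes_zero_ideal[OF assms] by (simp add: vars_ideal_empty)
  next
    case (insert u U)
    show ?case unfolding vars_ideal_insert
      using insert vars_ideal_prime[of u _ U]
      by (intro koszul_vanishes_ideal_plus graded_ideal_vars_ideal homogeneous_var) (auto simp: homogeneous_var)
  qed
qed

lemma koszul_vanishes_mono: "koszul_vanishes ys J c \<Longrightarrow> c \<le> c' \<Longrightarrow> koszul_vanishes ys J c'"
  unfolding koszul_vanishes_def by (meson order_trans)

section \<open>Join irreducible elements and rank\<close>

definition below :: "'l::{finite,distrib_lattice} \<Rightarrow> 'l set" where
  "below a = {p\<in>join_irreducibles. p \<le> a}"

lemma Inf_fin_UNIV_le: "Inf_fin UNIV \<le> (a :: 'l::{finite,lattice})"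
  by (rule Inf_fin.coboundedI) auto

lemma join_irreducible_not_bot:
  "p \<in> join_irreducibles \<Longrightarrow> \<not> p \<le> (Inf_fin UNIV :: 'l::{finite,distrib_lattice})"
  using Inf_fin_UNIV_le[of p] by (auto simp: join_irreducibles_def join_irreducible_def)

lemma join_irreducible_le_sup_iff:
  fixes p :: "'l::{finite,distrib_lattice}"
  assumes "p \<in> join_irreducibles"
  shows "p \<le> sup b c \<longleftrightarrow> p \<le> b \<or> p \<le> c"
proof
  assume "p \<le> sup b c"
  then have "p = sup (inf p b) (inf p c)" by (simp add: inf_sup_distrib1[symmetric] inf.absorb1)
  then have "p = inf p b \<or> p = inf p c"
    using assms unfolding join_irreducibles_def join_irreducible_def by blast
  then show "p \<le> b \<or> p \<le> c" by (metis inf.cobounded2)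
qed (auto intro: le_supI1 le_supI2)

text \<open>A minimal element among those below \<open>x\<close> but not below \<open>y\<close> is
  join irreducible: if it is a join, one of the joinands again fails to lie below
  \<open>y\<close>.\<close>

lemma join_irreducible_separates:
  fixes x y :: "'l::{finite,distrib_lattice}"
  assumes "\<not> x \<le> y"
  obtains p where "p \<in> join_irreducibles" "p \<le> x" "\<not> p \<le> y"
proof -
  obtain m where m: "m \<le> x" "\<not> m \<le> y" and min: "\<And>z. z \<le> x \<Longrightarrow> \<not> z \<le> y \<Longrightarrow> z \<le> m \<Longrightarrow> z = m"
    using finite_has_minimal[of "{z. z \<le> x \<and> \<not> z \<le> y}"] assms by (auto 4 4)
  have "m = b \<or> m = c" if "m = sup b c" for b c
  proof -
    have "b \<le> m" "c \<le> m" using that by auto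
    moreover have "\<not> b \<le> y \<or> \<not> c \<le> y" using m(2) that by auto
    ultimately show ?thesis using min m(1) by (metis order_trans)
  qed
  moreover have "m \<noteq> Inf_fin UNIV" using m(2) Inf_fin_UNIV_le by auto
  ultimately have "m \<in> join_irreducibles" by (auto simp: join_irreducibles_def join_irreducible_def)
  then show ?thesis using that m by blast
qed

lemma le_iff_below: "x \<le> y \<longleftrightarrow> below x \<subseteq> below y"
proof
  show "x \<le> y \<Longrightarrow> below x \<subseteq> below y" by (auto simp: below_def)
  show "below x \<subseteq> below y \<Longrightarrow> x \<le> y"
    by (metis (no_types, lifting) below_def join_irreducible_separates mem_Collect_eq subsetD)
qed

lemma below_inj: "below x = below y \<longleftrightarrow> x = y"
  using le_iff_below by (metis order_antisym order_refl)

lemma below_inf: "below (inf x y) = below x \<inter> below y"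
  by (auto simp: below_def)

lemma below_sup: "below (sup x y) = below x \<union> below y"
  by (auto simp: below_def join_irreducible_le_sup_iff)

text \<open>The surjective half of Birkhoff's theorem. The join of \<open>D\<close> has the required
  ideal, because a join irreducible element below a finite join lies below one of the
  joinands.\<close>

lemma ex_below_eq:
  fixes D :: "'l::{finite,distrib_lattice} set"
  assumes "D \<subseteq> join_irreducibles" "\<And>p d. p \<in> join_irreducibles \<Longrightarrow> d \<in> D \<Longrightarrow> p \<le> d \<Longrightarrow> p \<in> D"
  obtains x where "below x = D"
proof -
  have "finite E \<Longrightarrow> \<exists>x. \<forall>p\<in>join_irreducibles. p \<le> x \<longleftrightarrow> (\<exists>d\<in>E. p \<le> d)" for E :: "'l set"
  proof (induct E rule: finite_induct)
    case empty then show ?case using join_irreducible_not_bot by blast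
  next
    case (insert d E)
    then obtain x where "\<forall>p\<in>join_irreducibles. p \<le> x \<longleftrightarrow> (\<exists>d\<in>E. p \<le> d)" by blast
    then show ?case by (intro exI[of _ "sup d x"]) (auto simp: join_irreducible_le_sup_iff)
  qed
  then obtain x where "\<forall>p\<in>join_irreducibles. p \<le> x \<longleftrightarrow> (\<exists>d\<in>D. p \<le> d)" using finite[of D] by blast
  then have "below x = D" using assms by (auto simp: below_def)
  then show ?thesis by (rule that)
qed

definition rank :: "'l::{finite,distrib_lattice} \<Rightarrow> nat" where
  "rank x = card (below x)"

lemma rank_strict_mono: "x < y \<Longrightarrow> rank x < rank y"
  unfolding rank_def by (rule psubset_card_mono) (auto simp: le_iff_below[symmetric] less_le_not_le)

lemma rank_mono: "x \<le> y \<Longrightarrow> rank x \<le> rank y"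
  using rank_strict_mono[of x y] by (auto simp: le_less)

lemma rank_inf_sup: "rank (inf x y) + rank (sup x y) = rank x + rank y"
  unfolding rank_def below_inf below_sup by (metis add.commute card_Un_Int finite)

section \<open>A system of parameters for the join-meet ring\<close>

lemma is_ideal_radical:
  fixes J :: "'r::comm_ring_1 set"
  assumes J: "is_ideal J" shows "is_ideal {f. \<exists>n. f ^ n \<in> J}"
  unfolding is_ideal_def
proof (intro conjI ballI allI)
  show "0 \<in> {f. \<exists>n. f ^ n \<in> J}" by (auto intro!: exI[of _ 1] simp: ideal_zero[OF J])
next
  fix a b assume "a \<in> {f. \<exists>n. f ^ n \<in> J}" "b \<in> {f. \<exists>n. f ^ n \<in> J}"
  then obtain m n where mn: "a ^ m \<in> J" "b ^ n \<in> J" by auto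
  have "of_nat (m + n choose k) * a ^ k * b ^ (m + n - k) \<in> J" if "k \<le> m + n" for k
  proof (cases "m \<le> k")
    case True
    then have "a ^ k = a ^ (k - m) * a ^ m" by (simp flip: power_add)
    then have "of_nat (m + n choose k) * a ^ k * b ^ (m + n - k) =
      (of_nat (m + n choose k) * a ^ (k - m) * b ^ (m + n - k)) * a ^ m"
      by (simp add: ac_simps)
    then show ?thesis using ideal_mult[OF J mn(1)] by metis
  next
    case False
    then have "m + n - k = n + (m - k)" by simp
    then have "of_nat (m + n choose k) * a ^ k * b ^ (m + n - k) =
      (of_nat (m + n choose k) * a ^ k * b ^ (m - k)) * b ^ n"
      by (simp add: power_add ac_simps)
    then show ?thesis using ideal_mult[OF J mn(2)] by metis
  qed
  then have "(a + b) ^ (m + n) \<in> J" unfolding binomial_ring by (intro ideal_sum[OF J]) auto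
  then show "a + b \<in> {f. \<exists>n. f ^ n \<in> J}" by blast
next
  fix r a assume "a \<in> {f. \<exists>n. f ^ n \<in> J}"
  then show "r * a \<in> {f. \<exists>n. f ^ n \<in> J}"
    by (auto simp: power_mult_distrib intro: ideal_mult[OF J])
qed

lemma graded_ideal_join_meet: "graded_ideal (join_meet_ideal :: ('l::{finite,distrib_lattice}, 'k::field) mpoly set)"
  unfolding join_meet_ideal_def
  by (rule graded_ideal_span[of _ 2])
    (auto intro!: homogeneous_diff homogeneous_mult[of 1 _ 1, simplified] homogeneous_var)

lemma join_meet_generator:
  "\<not> a \<le> b \<Longrightarrow> \<not> b \<le> a \<Longrightarrow> var a * var b - var (inf a b) * var (sup a b) \<in> join_meet_ideal"
  unfolding join_meet_ideal_def by (intro module.span_base[OF module_mult]) auto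

definition rank_sum :: "nat \<Rightarrow> ('l::{finite,distrib_lattice}, 'k::field) mpoly" where
  "rank_sum r = (\<Sum>a | rank a = r. var a)"

text \<open>Induction on the rank inside the radical of \<open>J\<close>: the meet of two distinct
  elements of equal rank has smaller rank, so the mixed products are in the radical.
  \<open>J\<close> is left arbitrary because it will be the annihilator of Koszul homology on a list
  containing the rank sums.\<close>

lemma var_nilpotent:
  fixes J :: "('l::{finite,distrib_lattice}, 'k::field) mpoly set"
  assumes J: "is_ideal J" and I: "join_meet_ideal \<subseteq> J" and th: "\<And>r. rank_sum r \<in> J"
  shows "\<exists>n. var a ^ n \<in> J"
proof (induct "rank a" arbitrary: a rule: less_induct)
  case less
  let ?R = "{f. \<exists>n. f ^ n \<in> J}"
  note R = is_ideal_radical[OF J]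
  have JR: "f \<in> ?R" if "f \<in> J" for f using that by (auto intro: exI[of _ 1])
  have "var a * var b \<in> ?R" if "rank b = rank a" "b \<noteq> a" for b
  proof -
    have inc: "\<not> a \<le> b" "\<not> b \<le> a" using that rank_strict_mono[of a b] rank_strict_mono[of b a] by (auto simp: le_less)
    then have "inf a b < a" by (metis inf.cobounded1 inf.absorb_iff1 less_le)
    then have "var (inf a b) \<in> ?R" using less rank_strict_mono by blast
    then have "var (inf a b) * var (sup a b) \<in> ?R" by (rule ideal_mult_right[OF R])
    moreover have "var a * var b - var (inf a b) * var (sup a b) \<in> ?R"
      using join_meet_generator[OF inc] I by (intro JR) auto
    ultimately have "(var a * var b - var (inf a b) * var (sup a b)) + var (inf a b) * var (sup a b) \<in> ?R"
      by (intro ideal_add[OF R])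
    then show ?thesis by simp
  qed
  then have s: "(\<Sum>b\<in>{b. rank b = rank a} - {a}. var a * var b) \<in> ?R"
    by (intro ideal_sum[OF R]) auto
  have e: "var a * rank_sum (rank a) = var a * var a + (\<Sum>b\<in>{b. rank b = rank a} - {a}. var a * var b)"
    unfolding rank_sum_def sum_distrib_left by (rule sum.remove) auto
  have "var a * rank_sum (rank a) \<in> ?R" using ideal_mult[OF J th] by (intro JR)
  from ideal_diff[OF R this[unfolded e] s] have "var a * var a \<in> ?R"
    unfolding add_diff_cancel_right' .
  then obtain n where "(var a * var a) ^ n \<in> J" by blast
  then have "var a ^ (2 * n) \<in> J" by (simp add: power_mult power2_eq_square)
  then show ?case by blast
qed

lemma homogeneous_rank_sum: "homogeneous 1 (rank_sum r)"
  unfolding rank_sum_def by (intro homogeneous_sum homogeneous_var)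

text \<open>While variables are removed, the rank sums stay in the list; the annihilator of the
  homology contains them and \<open>join_meet_ideal\<close>, so the variable to be removed acts
  nilpotently. The upper end of the list only has to exceed every rank, as further rank sums are
  0.\<close>

lemma koszul_vanishes_rank_sums:
  fixes vs :: "'l::{finite,distrib_lattice} list"
  assumes v: "koszul_vanishes (map var vs) (join_meet_ideal :: ('l, 'k::field) mpoly set) c"
  shows "koszul_vanishes (map rank_sum [0..<Suc (card (UNIV :: 'l set))]) (join_meet_ideal :: ('l, 'k) mpoly set) c"
    (is "koszul_vanishes ?ts ?I c")
proof -
  note gr = graded_ideal_join_meet
  note J = graded_idealD(1)[OF gr]
  have "koszul_vanishes ?ts ?I c" if "koszul_vanishes (map var us @ ?ts) ?I c" for us :: "'l list"
    using that
  proof (induct us)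
    case (Cons u us)
    let ?ys = "map var us @ ?ts"
    have lin: "linear_forms ?ys" by (auto simp: homogeneous_var homogeneous_rank_sum)
    have "rank_sum r \<in> koszul_annihilator ?ys ?I" for r
    proof (cases "r \<le> card (UNIV :: 'l set)")
      case True
      then have "r \<in> {0..<Suc (card (UNIV :: 'l set))}" by simp
      then have "rank_sum r \<in> set ?ys" unfolding set_append set_map set_upt by blast
      then show ?thesis using set_subset_koszul_annihilator[OF J] by blast
    next
      case False
      have "rank a \<le> card (UNIV :: 'l set)" for a :: 'l unfolding rank_def by (rule card_mono) auto
      then have "{a::'l. rank a = r} = {}" using False by auto
      then show ?thesis
        by (simp add: rank_sum_def ideal_zero[OF is_ideal_koszul_annihilator[OF J]])
    qed
    then obtain n where "var u ^ n \<in> koszul_annihilator ?ys ?I"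
      using var_nilpotent[OF is_ideal_koszul_annihilator[OF J] subset_koszul_annihilator[OF J]] by blast
    then have "koszul_vanishes ?ys ?I c"
      using Cons.prems by (intro koszul_vanishes_peel[OF gr homogeneous_var lin]) auto
    then show ?case by (rule Cons.hyps)
  qed simp
  moreover have "koszul_vanishes (map var vs @ ?ts) ?I c"
    by (rule koszul_vanishes_append[OF gr _ _ v]) (auto simp: homogeneous_var homogeneous_rank_sum)
  ultimately show ?thesis .
qed

lemma homogeneous_in_koszul_gen:
  fixes p :: "('v::finite, 'k::comm_ring_1) mpoly"
  assumes v: "koszul_vanishes ys J c" and p: "homogeneous d p" "c \<le> d" and J: "is_ideal J"
  shows "\<exists>q\<in>koszul_gen ys. p - q \<in> J"
proof -
  define z where "z = (\<lambda>c. if c = kzero ys then p else 0)"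
  have "koszul_boundary ys J z"
    using p by (intro koszul_vanishesD[OF v p(2)])
      (auto simp: z_def koszul_cycle_def kd_unit_chain ideal_zero[OF J])
  then obtain w where "\<forall>bs. length bs = length ys \<longrightarrow> z bs - kd ys w bs \<in> J"
    unfolding koszul_boundary_def by blast
  then have "z (kzero ys) - kd ys w (kzero ys) \<in> J" by simp
  then show ?thesis using koszul_genI[of ys w] by (auto simp: z_def)
qed

section \<open>Functionals on quadrics\<close>

definition linear_ext :: "('v monom \<Rightarrow> 'k::comm_ring_1) \<Rightarrow> ('v, 'k) mpoly \<Rightarrow> 'k" where
  "linear_ext h p = (\<Sum>m\<in>ks p. lkp p m * h m)"

lemma linear_ext_superset:
  "finite A \<Longrightarrow> ks p \<subseteq> A \<Longrightarrow> linear_ext h p = (\<Sum>m\<in>A. lkp p m * h m)"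
  unfolding linear_ext_def by (rule sum.mono_neutral_left) (auto simp: in_keys_iff)

lemma linear_ext_add: "linear_ext h (p + q) = linear_ext h p + linear_ext h q"
proof -
  have "linear_ext h (p + q) = (\<Sum>m\<in>ks p \<union> ks q. lkp (p + q) m * h m)"
    by (rule linear_ext_superset) (auto simp: keys_add)
  also have "\<dots> = linear_ext h p + linear_ext h q"
    using linear_ext_superset[of "ks p \<union> ks q" p h] linear_ext_superset[of "ks p \<union> ks q" q h]
    by (simp add: lookup_add distrib_right sum.distrib)
  finally show ?thesis .
qed

lemma linear_ext_zero [simp]: "linear_ext h 0 = 0"
  by (simp add: linear_ext_def)

lemma linear_ext_minus: "linear_ext h (- p) = - linear_ext h p"
  using linear_ext_add[of h p "- p"] by (simp add: add_eq_0_iff)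

lemma linear_ext_diff: "linear_ext h (p - q) = linear_ext h p - linear_ext h q"
  using linear_ext_add[of h p "- q"] by (simp add: linear_ext_minus)

lemma linear_ext_sum: "linear_ext h (sum f A) = (\<Sum>i\<in>A. linear_ext h (f i))"
  by (induct A rule: infinite_finite_induct) (auto simp: linear_ext_add)

lemma linear_ext_single [simp]: "linear_ext h (sgl m c) = c * h m"
  by (simp add: linear_ext_def)

lemma linear_ext_mult_eq_0:
  assumes "\<And>m c. linear_ext h (sgl m c * q) = 0" shows "linear_ext h (p * q) = 0"
proof -
  have "linear_ext h ((\<Sum>m\<in>ks p. sgl m (lkp p m)) * q) = 0"
    by (simp add: sum_distrib_right linear_ext_sum assms)
  then show ?thesis using poly_eq_sum_monomials[of p] by metis
qed

lemma single_add_single_eq: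
  assumes "sgl a (1::nat) + sgl b 1 = sgl c 1 + sgl d 1"
  shows "(a = c \<and> b = d) \<or> (a = d \<and> b = c)"
proof -
  have *: "lkp (sgl a (1::nat) + sgl b 1) x = lkp (sgl c 1 + sgl d 1) x" for x using assms by simp
  show ?thesis using *[of a] *[of b] *[of c] *[of d]
    by (auto simp: lookup_add lookup_single when_def split: if_splits)
qed

lemma monom_degree_eq_1:
  assumes "monom_degree (m :: 'v::finite monom) = 1" obtains a where "m = sgl a 1"
proof -
  have "m \<noteq> 0" using assms by auto
  then obtain a where "a \<in> ks m" by (metis in_keys_iff lookup_zero poly_mapping_eqI)
  then obtain m' where m': "m = sgl a 1 + m'" by (rule monom_split)
  then have "m' = 0" using assms by (simp add: monom_degree_eq_0_iff)
  then show ?thesis using m' that by simp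
qed

text \<open>A function of unordered pairs, read as a function on monomials of degree 2 and extended
  by 0. The description by \<open>THE\<close> is meaningful for symmetric \<open>g\<close>.\<close>

definition quadric_value :: "('v \<Rightarrow> 'v \<Rightarrow> 'k) \<Rightarrow> 'v monom \<Rightarrow> 'k::comm_ring_1" where
  "quadric_value g m = (if \<exists>a b. m = sgl a 1 + sgl b 1
     then (THE c. \<exists>a b. m = sgl a 1 + sgl b 1 \<and> c = g a b) else 0)"

lemma quadric_value_eq:
  assumes "\<And>a b. g a b = g b a"
  shows "quadric_value g (sgl a 1 + sgl b 1) = g a b"
proof -
  have "(THE c. \<exists>a' b'. sgl a (1::nat) + sgl b 1 = sgl a' 1 + sgl b' 1 \<and> c = g a' b') = g a b"
  proof (rule the_equality)
    show "\<exists>a' b'. sgl a (1::nat) + sgl b 1 = sgl a' 1 + sgl b' 1 \<and> g a b = g a' b'" by blast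
  next
    fix c assume "\<exists>a' b'. sgl a (1::nat) + sgl b 1 = sgl a' 1 + sgl b' 1 \<and> c = g a' b'"
    then obtain a' b' where "sgl a (1::nat) + sgl b 1 = sgl a' 1 + sgl b' 1" and c: "c = g a' b'" by blast
    from single_add_single_eq[OF this(1)] show "c = g a b" using c assms by auto
  qed
  then show ?thesis unfolding quadric_value_def by auto
qed

lemma quadric_value_eq_0: "monom_degree (m :: 'v::finite monom) \<noteq> 2 \<Longrightarrow> quadric_value g m = 0"
  unfolding quadric_value_def by auto

lemma var_mult_var: "var a * var b = sgl (sgl a 1 + sgl b 1) 1"
  by (simp add: var_def mult_single)

text \<open>
  If $S/I$ had regularity at most 1, the quadrics would lie in $I + (\theta_r)$; a functional
  killing $I_2$ and all products $x_b \theta_r$ would therefore vanish.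
\<close>

lemma functional_eq_0:
  fixes g :: "'l::{finite,distrib_lattice} \<Rightarrow> 'l \<Rightarrow> 'k::field"
  assumes v: "koszul_vanishes (map var vs) (join_meet_ideal :: ('l, 'k) mpoly set) 2"
    and sym: "\<And>a b. g a b = g b a"
    and rel: "\<And>a b. \<not> a \<le> b \<Longrightarrow> \<not> b \<le> a \<Longrightarrow> g a b = g (inf a b) (sup a b)"
    and par: "\<And>r b. (\<Sum>a | rank a = r. g a b) = 0"
  shows "g a b = 0"
proof -
  let ?I = "join_meet_ideal :: ('l, 'k) mpoly set"
  let ?phi = "linear_ext (quadric_value g)"
  have Q: "quadric_value g (sgl a 1 + sgl b 1) = g a b" for a b
    by (rule quadric_value_eq) (rule sym)
  have I0: "?phi (p * (var a * var b - var (inf a b) * var (sup a b))) = 0"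
    if "\<not> a \<le> b" "\<not> b \<le> a" for a b p
  proof (rule linear_ext_mult_eq_0)
    fix m c
    show "?phi (sgl m c * (var a * var b - var (inf a b) * var (sup a b))) = 0"
    \<comment> \<open>A multiplier of positive degree moves the relation out of degree 2, where
      \<open>quadric_value\<close> is 0.\<close>
    proof (cases "m = 0")
      case True then show ?thesis
        using rel[OF that] by (simp add: right_diff_distrib var_mult_var mult_single linear_ext_diff Q[simplified])
    next
      case False
      then have "monom_degree m \<noteq> 0" by (simp add: monom_degree_eq_0_iff)
      then show ?thesis
        by (simp add: right_diff_distrib var_mult_var mult_single linear_ext_diff quadric_value_eq_0)
    qed
  qed
  have I: "?phi p = 0" if "p \<in> ?I" for p
    using that unfolding join_meet_ideal_def
    by (induct rule: module.span_induct_alt[OF module_mult, consumes 1, case_names base step])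
      (auto simp: linear_ext_add I0)
  have T0: "?phi (p * rank_sum r) = 0" for p r
  proof (rule linear_ext_mult_eq_0)
    fix m c
    have e: "?phi (sgl m c * rank_sum r) = (\<Sum>a | rank a = r. c * quadric_value g (m + sgl a 1))"
      by (simp add: rank_sum_def sum_distrib_left linear_ext_sum var_def mult_single)
    show "?phi (sgl m c * rank_sum r) = 0"
    proof (cases "monom_degree m = 1")
      case True
      then obtain b where m: "m = sgl b 1" by (rule monom_degree_eq_1)
      have "quadric_value g (m + sgl a 1) = g a b" for a
        using Q[of a b] by (simp add: m add.commute)
      then show ?thesis unfolding e by (simp add: sum_distrib_left[symmetric] par)
    next
      case False
      then show ?thesis unfolding e by (simp add: quadric_value_eq_0)
    qed
  qed
  have T: "?phi q = 0" if "q \<in> koszul_gen (map rank_sum rs)" for q rs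
    using that
  proof (induct rs arbitrary: q)
    case (Cons r rs)
    then obtain g' h where "g' \<in> koszul_gen (map rank_sum rs)" "q = g' + rank_sum r * h"
      by (auto simp: koszul_gen_Cons elim!: ideal_plusE)
    then show ?case using Cons.hyps T0[of h r] by (simp add: linear_ext_add mult.commute)
  qed (simp add: koszul_gen_Nil)
  have "homogeneous 2 (var a * var b)"
    using homogeneous_mult[OF homogeneous_var homogeneous_var, of a b] by simp
  then obtain q where "q \<in> koszul_gen (map rank_sum [0..<Suc (card (UNIV :: 'l set))])" "var a * var b - q \<in> ?I"
    using homogeneous_in_koszul_gen[OF koszul_vanishes_rank_sums[OF v] _ _ graded_idealD(1)[OF graded_ideal_join_meet]]
    by blast
  then have "?phi (var a * var b) = 0" using I T by (metis linear_ext_diff diff_0_right)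
  then show ?thesis using Q[of a b] by (simp add: var_mult_var)
qed

text \<open>
  A cycle in the comparability graph between two ranks at distance 1 or 2 yields such a functional:
  the value on $x_a x_b$ is read off from $x_{a \wedge b} x_{a \vee b}$, and the values on squares
  are then forced.
\<close>

lemma no_rank_cycle:
  fixes f :: "'l::{finite,distrib_lattice} \<Rightarrow> 'l \<Rightarrow> 'k::field"
  assumes v: "koszul_vanishes (map var vs) (join_meet_ideal :: ('l, 'k) mpoly set) 2"
    and st: "s < t" "t \<le> s + 2"
    and supp: "\<And>x y. f x y \<noteq> 0 \<Longrightarrow> x < y \<and> rank x = s \<and> rank y = t"
    and col: "\<And>y. (\<Sum>x\<in>UNIV. f x y) = 0" and row: "\<And>x. (\<Sum>y\<in>UNIV. f x y) = 0"
  shows "f x y = 0"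
proof (rule ccontr)
  assume fxy: "f x y \<noteq> 0"
  \<comment> \<open>Off the diagonal the value depends only on meet and join, so symmetry and the
    relations of the ideal are automatic. A diagonal value enters only one of the sums over a rank
    and is chosen to make that sum vanish.\<close>
  define g where "g = (\<lambda>a b. if a = b then - (\<Sum>c\<in>{c. rank c = rank a} - {a}. f (inf c a) (sup c a))
    else f (inf a b) (sup a b))"
  have sym: "g a b = g b a" for a b by (simp add: g_def inf.commute sup.commute)
  have rel: "g a b = g (inf a b) (sup a b)" if "\<not> a \<le> b" "\<not> b \<le> a" for a b
  proof -
    have "inf a b \<noteq> sup a b" using that by (metis inf.cobounded1 inf.cobounded2 sup.cobounded1 order_trans)
    moreover have "inf a b \<le> sup a b" by (meson inf.cobounded1 sup.cobounded1 order_trans)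
    ultimately show ?thesis using that by (auto simp: g_def inf.absorb1 sup.absorb2)
  qed
  have par: "(\<Sum>a | rank a = r. g a b) = 0" for r b
  proof (cases "r = rank b")
    case True
    have "(\<Sum>a | rank a = r. g a b) = g b b + (\<Sum>a\<in>{a. rank a = r} - {b}. g a b)"
      using True by (intro sum.remove) auto
    also have "(\<Sum>a\<in>{a. rank a = r} - {b}. g a b) = (\<Sum>a\<in>{a. rank a = r} - {b}. f (inf a b) (sup a b))"
      by (rule sum.cong) (auto simp: g_def)
    finally show ?thesis using True by (simp add: g_def)
  next
    case False
    then have e: "(\<Sum>a | rank a = r. g a b) = (\<Sum>a | rank a = r. f (inf a b) (sup a b))"
      by (intro sum.cong) (auto simp: g_def)
    consider "r = s" "rank b = t" | "r = t" "rank b = s" | "\<not> (r = s \<and> rank b = t)" "\<not> (r = t \<and> rank b = s)"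
      by blast
    then show ?thesis
    proof cases
      case 1
      have "f (inf a b) (sup a b) = f a b" if "rank a = r" for a
      proof (cases "a \<le> b")
        case True then show ?thesis by (simp add: inf.absorb1 sup.absorb2)
      next
        case False
        then have "inf a b < a" by (metis inf.cobounded1 inf.absorb_iff1 less_le)
        then have "rank (inf a b) \<noteq> s" using rank_strict_mono that 1 by force
        then show ?thesis using supp False by (metis less_imp_le)
      qed
      then have "(\<Sum>a | rank a = r. f (inf a b) (sup a b)) = (\<Sum>a | rank a = r. f a b)"
        by (intro sum.cong) auto
      also have "\<dots> = (\<Sum>a\<in>UNIV. f a b)" using supp 1 by (intro sum.mono_neutral_left) auto
      finally show ?thesis using e col by simp
    next
      case 2
      have "f (inf a b) (sup a b) = f b a" if "rank a = r" for a
      proof (cases "b \<le> a")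
        case True then show ?thesis by (simp add: inf.absorb2 sup.absorb1)
      next
        case False
        then have "a < sup a b" by (metis sup.cobounded1 sup.absorb_iff1 less_le)
        then have "rank (sup a b) \<noteq> t" using rank_strict_mono that 2 by force
        then show ?thesis using supp False by (metis less_imp_le)
      qed
      then have "(\<Sum>a | rank a = r. f (inf a b) (sup a b)) = (\<Sum>a | rank a = r. f b a)"
        by (intro sum.cong) auto
      also have "\<dots> = (\<Sum>a\<in>UNIV. f b a)" using supp 2 by (intro sum.mono_neutral_left) auto
      finally show ?thesis using e row by simp
    next
      case 3
      have "f (inf a b) (sup a b) = 0" if a: "rank a = r" for a
      proof (rule ccontr)
        assume "f (inf a b) (sup a b) \<noteq> 0"
        then have st': "rank (inf a b) = s" "rank (sup a b) = t" using supp by auto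
        \<comment> \<open>Both ranks lie between \<open>s\<close> and \<open>t\<close>, add up to
          \<open>s + t\<close> and are different. For \<open>t\<close> at most \<open>s + 2\<close>
          this forces them to be \<open>s\<close> and \<open>t\<close>; at distance 3 the pair
          \<open>s + 1\<close>, \<open>s + 2\<close> would remain.\<close>
        have "rank a + rank b = s + t" using rank_inf_sup[of a b] st' by simp
        moreover have "s \<le> rank b" "rank b \<le> t" "s \<le> rank a" "rank a \<le> t"
          using rank_mono[of "inf a b" b] rank_mono[of b "sup a b"] rank_mono[of "inf a b" a]
            rank_mono[of a "sup a b"] st' by auto
        ultimately show False using 3 False a st by linarith
      qed
      then show ?thesis using e by simp
    qed
  qed
  have "x < y" using supp fxy by blast
  then have "g x y = f x y" by (auto simp: g_def inf.absorb1 sup.absorb2)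
  then show False using functional_eq_0[of vs g, OF v sym rel par] fxy by simp
qed

section \<open>Posets that are not the sum of a chain and an isolated element\<close>

definition downset :: "'a::order set \<Rightarrow> 'a set \<Rightarrow> bool" where
  "downset P D \<longleftrightarrow> D \<subseteq> P \<and> (\<forall>p\<in>P. \<forall>d\<in>D. p \<le> d \<longrightarrow> p \<in> D)"

definition minimal_in :: "'a::order set \<Rightarrow> 'a \<Rightarrow> bool" where
  "minimal_in X x \<longleftrightarrow> x \<in> X \<and> (\<forall>y\<in>X. y \<le> x \<longrightarrow> y = x)"

lemma downset_insert: "downset P D \<Longrightarrow> minimal_in (P - D) x \<Longrightarrow> downset P (insert x D)"
  unfolding downset_def minimal_in_def by blast

lemma ex_minimal_in:
  fixes x :: "'a::order"
  assumes "finite X" "x \<in> X" obtains m where "minimal_in X m" "m \<le> x"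
  using finite_has_minimal2[OF assms] unfolding minimal_in_def by blast

lemma finite_chain_has_greatest:
  fixes C :: "'a::order set"
  assumes "finite C" "C \<noteq> {}" "Complete_Partial_Order.chain (\<le>) C"
  obtains m where "m \<in> C" "\<And>c. c \<in> C \<Longrightarrow> c \<le> m"
proof -
  obtain m where m: "m \<in> C" "\<forall>b\<in>C. m \<le> b \<longrightarrow> m = b" using finite_has_maximal[OF assms(1,2)] by blast
  have "c \<le> m" if "c \<in> C" for c using chainD[OF assms(3) that m(1)] m(2) that by auto
  then show ?thesis using that m(1) by blast
qed

text \<open>An extremal argument over pairs of a nonempty down-closed chain \<open>C\<close> and a
  minimal element \<open>q\<close> incomparable with all of \<open>C\<close>. If \<open>C\<close> is
  as large as possible, an element outside \<open>insert q C\<close> leads to a larger pair or to an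
  excluded configuration: \<open>width\<close> forbids antichains of three elements,
  \<open>diag\<close> two consecutive ambiguous pairs when elements are added to an ideal.\<close>

lemma chain_plus_isolatedI:
  fixes P :: "'a::order set"
  assumes fin: "finite P" and ne: "P \<noteq> {}"
    and simple: "\<And>p. p \<in> P \<Longrightarrow> \<exists>q\<in>P. \<not> q \<le> p \<and> \<not> p \<le> q"
    and width: "\<And>p q r. p \<in> P \<Longrightarrow> q \<in> P \<Longrightarrow> r \<in> P \<Longrightarrow> \<not> p \<le> q \<Longrightarrow> \<not> q \<le> p \<Longrightarrow>
      \<not> p \<le> r \<Longrightarrow> \<not> r \<le> p \<Longrightarrow> \<not> q \<le> r \<Longrightarrow> \<not> r \<le> q \<Longrightarrow> False"
    and diag: "\<And>D p q r s. downset P D \<Longrightarrow> minimal_in (P - D) p \<Longrightarrow> minimal_in (P - D) q \<Longrightarrow> p \<noteq> q \<Longrightarrow>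
      minimal_in (P - D - {p, q}) r \<Longrightarrow> minimal_in (P - D - {p, q}) s \<Longrightarrow> r \<noteq> s \<Longrightarrow> False"
  shows "chain_plus_isolated P"
proof -
  define St where "St = (\<lambda>(C, q). C \<noteq> {} \<and> Complete_Partial_Order.chain (\<le>) C \<and> downset P C \<and>
    q \<in> P \<and> (\<forall>c\<in>C. \<not> c \<le> q \<and> \<not> q \<le> c) \<and> downset P (insert q C))"
  obtain p where p: "minimal_in P p" using ne ex_minimal_in[OF fin] by blast
  then obtain q0 where "q0 \<in> {q\<in>P. \<not> q \<le> p \<and> \<not> p \<le> q}" using simple unfolding minimal_in_def by blast
  then obtain q where q: "minimal_in {q\<in>P. \<not> q \<le> p \<and> \<not> p \<le> q} q"
    using ex_minimal_in[of "{q\<in>P. \<not> q \<le> p \<and> \<not> p \<le> q}"] fin by auto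
  \<comment> \<open>Since \<open>p\<close> is minimal, anything below \<open>q\<close> is also
    incomparable with \<open>p\<close>; hence \<open>q\<close> is minimal in all of
    \<open>P\<close>.\<close>
  have "x = q" if "x \<in> P" "x \<le> q" for x
  proof -
    have "\<not> p \<le> x" using q that unfolding minimal_in_def by (auto dest: order_trans)
    moreover have "\<not> x \<le> p" using calculation p that unfolding minimal_in_def by auto
    ultimately show ?thesis using q that unfolding minimal_in_def by blast
  qed
  then have "St ({p}, q)" using p q unfolding St_def minimal_in_def downset_def
    by (auto simp: chain_def)
  moreover have "\<forall>y. St y \<longrightarrow> card (fst y) < Suc (card P)"
    using card_mono[OF fin] by (auto simp: St_def downset_def less_Suc_eq_le)
  ultimately obtain y where "St y" and ymax: "\<And>y'. St y' \<Longrightarrow> card (fst y') \<le> card (fst y)"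
    using ex_has_greatest_nat[of St "({p}, q)" "\<lambda>y. card (fst y)"] by blast
  then obtain C q where St: "St (C, q)" and max: "\<And>C' q'. St (C', q') \<Longrightarrow> card C' \<le> card C"
    by (cases y) fastforce
  have C: "C \<noteq> {}" "Complete_Partial_Order.chain (\<le>) C" "C \<subseteq> P"
    "\<And>x c. x \<in> P \<Longrightarrow> c \<in> C \<Longrightarrow> x \<le> c \<Longrightarrow> x \<in> C"
    and qP: "q \<in> P" and qC: "\<And>c. c \<in> C \<Longrightarrow> \<not> c \<le> q \<and> \<not> q \<le> c"
    and dq: "\<And>x. x \<in> P \<Longrightarrow> x \<le> q \<Longrightarrow> x = q"
    using St unfolding St_def downset_def by auto
  have finC: "finite C" using fin C(3) finite_subset by blast
  show ?thesis
  proof (cases "P = insert q C")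
    case True
    then show ?thesis unfolding chain_plus_isolated_def using qC C(2) by (intro exI[of _ C] exI[of _ q]) auto
  next
    case False
    obtain m where m: "m \<in> C" "\<And>c. c \<in> C \<Longrightarrow> c \<le> m" using finite_chain_has_greatest[OF finC C(1,2)] by blast
    have d1: "downset P (C - {m})" using C(3,4) m unfolding downset_def by (metis Diff_iff Diff_subset empty_iff insert_iff order_antisym order_trans subset_iff)
    have m1: "minimal_in (P - (C - {m})) m" using C(3,4) m(1) unfolding minimal_in_def by blast
    have q1: "minimal_in (P - (C - {m})) q" using qP qC dq unfolding minimal_in_def by auto
    have mq: "m \<noteq> q" using qC m(1) by blast
    let ?R = "P - (C - {m}) - {m, q}"
    have R: "?R = P - insert q C" using m(1) by blast
    obtain x where "x \<in> ?R" using False R C(3) qP by blast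
    then obtain r where r: "minimal_in ?R r" using ex_minimal_in[of ?R x] fin by blast
    \<comment> \<open>After the ideal \<open>C - {m}\<close> both \<open>m\<close> and
      \<open>q\<close> may be added. By \<open>diag\<close> the element to follow them is unique, so
      \<open>r\<close> is the least element outside \<open>insert q C\<close>.\<close>
    have rle: "r \<le> x" if x: "x \<in> P" "x \<notin> insert q C" for x
    proof -
      obtain s where "minimal_in ?R s" "s \<le> x" using ex_minimal_in[of ?R x] fin x R by blast
      then show ?thesis using diag[OF d1 m1 q1 mq r] by blast
    qed
    have rP: "r \<in> P" "r \<notin> C" "r \<noteq> q" using r R unfolding minimal_in_def by auto
    have below_r: "x = r \<or> x \<in> insert q C" if "x \<in> P" "x \<le> r" for x
      using rle[OF that(1)] that(2) by auto
    obtain x where x: "x \<in> P" "\<not> x \<le> r" "\<not> r \<le> x" using simple[OF rP(1)] by blast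
    then have xC: "x \<in> insert q C" using rle by blast
    have nrm: "\<not> r \<le> m" using C(4)[OF rP(1) m(1)] rP(2) by blast
    have nrq: "\<not> r \<le> q" using dq[OF rP(1)] rP(3) by blast
    show ?thesis
    proof (cases "q \<le> r")
      case False
      \<comment> \<open>Otherwise \<open>q\<close>, \<open>m\<close> and \<open>r\<close> would form
        an antichain. The whole chain now lies below \<open>r\<close> and can be extended by
        it.\<close>
      have mr: "m \<le> r" using width[OF qP _ rP(1), of m] qC[OF m(1)] m(1) C(3) False nrm nrq by blast
      have "St (insert r C, q)" unfolding St_def prod.case
      proof (intro conjI)
        show "Complete_Partial_Order.chain (\<le>) (insert r C)"
          using C(2) m mr order_trans[OF m(2) mr] unfolding chain_def by auto
        show "downset P (insert r C)" "downset P (insert q (insert r C))"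
          using C(3,4) rP(1) below_r False qP dq unfolding downset_def by blast+
        show "\<forall>c\<in>insert r C. \<not> c \<le> q \<and> \<not> q \<le> c" using qC False nrq by blast
      qed (use qP in auto)
      then show ?thesis using max[of "insert r C" q] rP(2) finC by simp
    next
      case True
      then have "x \<in> C" using xC x(2) by blast
      then have nmr: "\<not> m \<le> r" using m(2) x(2) order_trans by blast
      show ?thesis
      proof (cases "C = {m}")
        case Cm: True
        \<comment> \<open>For a chain with a single element the roles are exchanged:
          \<open>q\<close> and \<open>r\<close> form a longer chain and \<open>m\<close> becomes the
          isolated element.\<close>
        have "St ({q, r}, m)" unfolding St_def prod.case
        proof (intro conjI)
          show "Complete_Partial_Order.chain (\<le>) {q, r}" using True unfolding chain_def by auto
          show "downset P {q, r}" "downset P (insert m {q, r})"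
            using C(3,4) Cm rP(1) below_r qP dq nmr unfolding downset_def by blast+
          show "\<forall>c\<in>{q, r}. \<not> c \<le> m \<and> \<not> m \<le> c" using qC[OF m(1)] nmr nrm by blast
        qed (use m(1) C(3) in auto)
        then show ?thesis using max[of "{q, r}" m] rP(3) Cm by simp
      next
        case False
        have "C - {m} \<noteq> {}" using False m(1) by blast
        moreover have "Complete_Partial_Order.chain (\<le>) (C - {m})" using C(2) unfolding chain_def by blast
        ultimately obtain l where l: "l \<in> C - {m}" "\<And>c. c \<in> C - {m} \<Longrightarrow> c \<le> l"
          using finite_chain_has_greatest[of "C - {m}"] finC by blast
        have lm: "l \<le> m" "l \<noteq> m" "l \<in> C" using l(1) m(2) by auto
        then have ml: "\<not> m \<le> l" by auto
        \<comment> \<open>One step further down the chain: after \<open>?D\<close> the pair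
          \<open>l\<close>, \<open>q\<close> is available and then the pair \<open>m\<close>,
          \<open>r\<close>, which \<open>diag\<close> forbids.\<close>
        let ?D = "C - {m} - {l}"
        have D: "x \<in> ?D" if "x \<in> P" "d \<in> ?D" "x \<le> d" for x d
        proof -
          have "x \<in> C" using C(4) that by blast
          moreover have "d \<le> l" "d \<noteq> l" using l(2) that(2) by auto
          ultimately show ?thesis using that(3) ml order_trans by (metis Diff_iff empty_iff insert_iff order_antisym)
        qed
        have d2: "downset P ?D" using D C(3) unfolding downset_def by blast
        have l2: "minimal_in (P - ?D) l"
          using lm ml C(3) C(4)[OF _ lm(3)] unfolding minimal_in_def by blast
        have q2: "minimal_in (P - ?D) q" using qP qC dq unfolding minimal_in_def by auto
        have m2: "minimal_in (P - ?D - {l, q}) m"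
          using mq lm m(1) C(3) C(4)[OF _ m(1)] unfolding minimal_in_def by blast
        have r2: "minimal_in (P - ?D - {l, q}) r"
          using rP lm(3) below_r nmr unfolding minimal_in_def by blast
        have "l \<noteq> q" "m \<noteq> r" using qC[OF lm(3)] nmr by auto
        then show ?thesis using diag[OF d2 l2 q2 _ m2 r2] by blast
      qed
    qed
  qed
qed

lemma linear_imp_chain_plus_isolated:
  assumes v: "koszul_vanishes (map var vs) (join_meet_ideal :: ('l::{finite,distrib_lattice}, 'k::field) mpoly set) 2"
    and simple: "simple_lattice TYPE('l)" and ne: "(join_irreducibles :: 'l set) \<noteq> {}"
  shows "chain_plus_isolated (join_irreducibles :: 'l set)"
proof (rule chain_plus_isolatedI)
  let ?P = "join_irreducibles :: 'l set"
  show "finite ?P" "?P \<noteq> {}" using ne by auto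
  show "\<exists>q\<in>?P. \<not> q \<le> p \<and> \<not> p \<le> q" if "p \<in> ?P" for p
    using simple that unfolding simple_lattice_def by blast
  have el: "\<exists>x. below x = D" if "downset ?P D" for D
    using ex_below_eq[of D] that unfolding downset_def by metis
  show False
    if P: "p \<in> ?P" "q \<in> ?P" "r \<in> ?P"
      and inc: "\<not> p \<le> q" "\<not> q \<le> p" "\<not> p \<le> r" "\<not> r \<le> p" "\<not> q \<le> r" "\<not> r \<le> q" for p q r
  proof -
    \<comment> \<open>The elements strictly below one of the three; any subset of
      \<open>{p, q, r}\<close> can be added to this ideal.\<close>
    define D where "D = {x\<in>?P. x < p \<or> x < q \<or> x < r}"
    have ds: "downset ?P (insert e D)" if "e \<in> {p, q, r}" for e
      unfolding downset_def D_def using that P by (auto simp: order.order_iff_strict dest: le_less_trans less_trans)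
    have nD: "p \<notin> D" "q \<notin> D" "r \<notin> D" using inc unfolding D_def by (auto simp: order.order_iff_strict)
    have dist: "p \<noteq> q" "q \<noteq> r" "r \<noteq> p" using inc by auto
    obtain a b c where B: "below a = insert p D" "below b = insert q D" "below c = insert r D"
      using el[OF ds] by (metis insert_iff)
    \<comment> \<open>Values 1 and -1 alternate around the hexagon \<open>a\<close>,
      \<open>sup a b\<close>, \<open>b\<close>, \<open>sup b c\<close>, \<open>c\<close>,
      \<open>sup c a\<close>, so that all row and column sums cancel.\<close>
    define f :: "'l \<Rightarrow> 'l \<Rightarrow> 'k" where "f = (\<lambda>x y.
      (if x = a then (if y = sup a b then 1 else 0) - (if y = sup c a then 1 else 0) else 0) +
      (if x = b then (if y = sup b c then 1 else 0) - (if y = sup a b then 1 else 0) else 0) +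
      (if x = c then (if y = sup c a then 1 else 0) - (if y = sup b c then 1 else 0) else 0))"
    have BS: "below (sup a b) = insert p (insert q D)" "below (sup b c) = insert q (insert r D)"
      "below (sup c a) = insert r (insert p D)"
      by (auto simp: below_sup B)
    have abc: "a \<noteq> b" "b \<noteq> c" "c \<noteq> a" "sup a b \<noteq> sup b c" "sup b c \<noteq> sup c a" "sup c a \<noteq> sup a b"
    proof -
      have "below a \<noteq> below b" "below b \<noteq> below c" "below c \<noteq> below a"
        "below (sup a b) \<noteq> below (sup b c)" "below (sup b c) \<noteq> below (sup c a)"
        "below (sup c a) \<noteq> below (sup a b)"
        unfolding B BS using dist nD by blast+
      then show "a \<noteq> b" "b \<noteq> c" "c \<noteq> a" "sup a b \<noteq> sup b c" "sup b c \<noteq> sup c a" "sup c a \<noteq> sup a b"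
        by metis+
    qed
    have rk: "rank a = Suc (card D)" "rank b = Suc (card D)" "rank c = Suc (card D)"
      "rank (sup a b) = Suc (Suc (card D))" "rank (sup b c) = Suc (Suc (card D))" "rank (sup c a) = Suc (Suc (card D))"
      using B BS dist nD by (auto simp: rank_def)
    have lt: "a < sup a b" "b < sup a b" "b < sup b c" "c < sup b c" "c < sup c a" "a < sup c a"
      using rk by (auto simp: less_le)
    have "f a (sup a b) = 0"
    proof (rule no_rank_cycle[OF v, of "Suc (card D)" "Suc (Suc (card D))"])
      fix x y assume "f x y \<noteq> 0"
      then have "(x, y) \<in> {(a, sup a b), (a, sup c a), (b, sup b c), (b, sup a b), (c, sup c a), (c, sup b c)}"
        by (auto simp: f_def split: if_splits)
      then show "x < y \<and> rank x = Suc (card D) \<and> rank y = Suc (Suc (card D))" using rk lt by auto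
    next
      fix y show "(\<Sum>x\<in>UNIV. f x y) = 0" unfolding f_def by (simp add: sum.distrib)
    next
      fix x show "(\<Sum>y\<in>UNIV. f x y) = 0" unfolding f_def
        by (cases "x = a"; cases "x = b"; cases "x = c") (simp_all add: sum.distrib sum_subtractf)
    qed auto
    then show False using abc by (simp add: f_def)
  qed
  show False
    if D: "downset ?P D" and m: "minimal_in (?P - D) p" "minimal_in (?P - D) q" "p \<noteq> q"
      and n: "minimal_in (?P - D - {p, q}) r" "minimal_in (?P - D - {p, q}) s" "r \<noteq> s" for D p q r s
  proof -
    have ds: "downset ?P (insert p D)" "downset ?P (insert q D)" using downset_insert[OF D] m by auto
    have "minimal_in (?P - insert p D) q" using m unfolding minimal_in_def by blast
    then have d2: "downset ?P (insert q (insert p D))" by (rule downset_insert[OF ds(1)])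
    have "?P - D - {p, q} = ?P - insert q (insert p D)" by blast
    then have ds': "downset ?P (insert r (insert q (insert p D)))" "downset ?P (insert s (insert q (insert p D)))"
      using downset_insert[OF d2] n by auto
    have nD: "p \<notin> D" "q \<notin> D" "r \<notin> insert q (insert p D)" "s \<notin> insert q (insert p D)"
      using m n unfolding minimal_in_def by auto
    obtain a b c d where B: "below a = insert p D" "below b = insert q D"
      "below c = insert r (insert q (insert p D))" "below d = insert s (insert q (insert p D))"
      using el ds ds' by metis
    \<comment> \<open>Values 1 and -1 alternate around the square \<open>a\<close>,
      \<open>c\<close>, \<open>b\<close>, \<open>d\<close>. The ideal obtained from \<open>D\<close>
      by adding \<open>p\<close> and \<open>q\<close> lies above \<open>a\<close>, \<open>b\<close>
      and below \<open>c\<close>, \<open>d\<close>, so the two ranks are at distance 2.\<close>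
    define f :: "'l \<Rightarrow> 'l \<Rightarrow> 'k" where "f = (\<lambda>x y.
      (if x = a then (if y = c then 1 else 0) - (if y = d then 1 else 0) else 0) -
      (if x = b then (if y = c then 1 else 0) - (if y = d then 1 else 0) else 0))"
    have "below a \<noteq> below b" "below c \<noteq> below d" unfolding B using m(3) n(3) nD by blast+
    then have ab: "a \<noteq> b" "c \<noteq> d" by auto
    have rk: "rank a = Suc (card D)" "rank b = Suc (card D)" "rank c = Suc (Suc (Suc (card D)))" "rank d = Suc (Suc (Suc (card D)))"
      using B nD m(3) n(3) by (auto simp: rank_def)
    have "a \<le> c" "a \<le> d" "b \<le> c" "b \<le> d" 
      unfolding le_iff_below[of a c] le_iff_below[of a d] le_iff_below[of b c] le_iff_below[of b d] B
      by blast+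
    then have lt: "a < c" "a < d" "b < c" "b < d" using rk by (auto simp: less_le)
    have "f a c = 0"
    proof (rule no_rank_cycle[OF v, of "Suc (card D)" "Suc (Suc (Suc (card D)))"])
      fix x y assume "f x y \<noteq> 0"
      then have "(x, y) \<in> {(a, c), (a, d), (b, c), (b, d)}" by (auto simp: f_def split: if_splits)
      then show "x < y \<and> rank x = Suc (card D) \<and> rank y = Suc (Suc (Suc (card D)))" using rk lt by auto
    next
      fix y show "(\<Sum>x\<in>UNIV. f x y) = 0" unfolding f_def by (simp add: sum_subtractf)
    next
      fix x show "(\<Sum>y\<in>UNIV. f x y) = 0" unfolding f_def
        by (cases "x = a"; cases "x = b") (simp_all add: sum_subtractf)
    qed auto
    then show False using ab by (simp add: f_def)
  qed
qed

section \<open>The join-meet ideal as a toric ideal\<close>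

text \<open>Hibi's map sends x_a to the product of t and all t_p with p below a. This is the
  exponent of t_p in the image of \<open>m\<close>, while the exponent of t is the degree;
  \<open>toric_equiv\<close> therefore says that two monomials have the same image.\<close>

definition exponent_below :: "'l::{finite,distrib_lattice} monom \<Rightarrow> 'l \<Rightarrow> nat" where
  "exponent_below m p = (\<Sum>a | p \<le> a. lkp m a)"

definition toric_equiv :: "'l::{finite,distrib_lattice} monom \<Rightarrow> 'l monom \<Rightarrow> bool" where
  "toric_equiv m n \<longleftrightarrow> monom_degree m = monom_degree n \<and>
     (\<forall>p\<in>join_irreducibles. exponent_below m p = exponent_below n p)"

lemma exponent_below_add: "exponent_below (m + n) p = exponent_below m p + exponent_below n p"
  by (simp add: exponent_below_def lookup_add sum.distrib)

lemma exponent_below_single: "exponent_below (sgl a 1) p = (if p \<le> a then 1 else 0)"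
  by (simp add: exponent_below_def lookup_single when_def)

lemma toric_equiv_refl: "toric_equiv m m"
  and toric_equiv_sym: "toric_equiv m n \<Longrightarrow> toric_equiv n m"
  and toric_equiv_trans: "toric_equiv m n \<Longrightarrow> toric_equiv n k \<Longrightarrow> toric_equiv m k"
  by (auto simp: toric_equiv_def)

lemma toric_equiv_add_cancel: "toric_equiv (k + m) (k + n) \<longleftrightarrow> toric_equiv m n"
  by (auto simp: toric_equiv_def exponent_below_add)

lemma toric_equiv_meet_join:
  "toric_equiv (sgl a 1 + sgl b 1) (sgl (inf a b) 1 + sgl (sup a b) 1)"
  unfolding toric_equiv_def exponent_below_add exponent_below_single
  by (auto simp: join_irreducible_le_sup_iff)

lemma meet_join_congruent:
  "sgl (sgl a 1 + sgl b 1) 1 - sgl (sgl (inf a b) 1 + sgl (sup a b) 1) 1 \<in>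
     (join_meet_ideal :: ('l::{finite,distrib_lattice}, 'k::field) mpoly set)"
proof (cases "a \<le> b \<or> b \<le> a")
  case True
  then show ?thesis
    using ideal_zero[OF graded_idealD(1)[OF graded_ideal_join_meet]]
    by (auto simp: inf.absorb1 inf.absorb2 sup.absorb1 sup.absorb2 add.commute)
next
  case False
  then show ?thesis using join_meet_generator[of a b] by (simp add: var_mult_var)
qed

lemma monomial_congruent_mult:
  assumes "sgl m 1 - sgl n 1 \<in> J" "is_ideal (J :: ('v, 'k::comm_ring_1) mpoly set)"
  shows "sgl (k + m) 1 - sgl (k + n) 1 \<in> J"
  using ideal_mult[OF assms(2,1), of "sgl k 1"] by (simp add: right_diff_distrib mult_single)

lemma congruent_trans:
  assumes "a - b \<in> J" "b - c \<in> J" "is_ideal (J :: 'r::comm_ring_1 set)"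
  shows "a - c \<in> J"
  using ideal_add[OF assms(3,1,2)] by simp

text \<open>Replacing x_a x_t by x_{a \<and> t} x_{a \<or> t} repeatedly collects the join of all
  variables of \<open>m\<close> in one factor. Its ideal can be read off from the exponents.\<close>

lemma ex_top_congruent:
  fixes m :: "'l::{finite,distrib_lattice} monom"
  assumes "m \<noteq> 0"
  shows "\<exists>t n. sgl m 1 - sgl (sgl t 1 + n) 1 \<in> (join_meet_ideal :: ('l, 'k::field) mpoly set) \<and>
    toric_equiv m (sgl t 1 + n) \<and> below t = {p\<in>join_irreducibles. 0 < exponent_below m p}"
  using assms
proof (induct "monom_degree m" arbitrary: m)
  case 0 then show ?case by (simp add: monom_degree_eq_0_iff)
next
  case (Suc d)
  note I = graded_idealD(1)[OF graded_ideal_join_meet]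
  obtain a where "a \<in> ks m" using Suc.prems by (metis in_keys_iff lookup_zero poly_mapping_eqI)
  then obtain m' where m: "m = sgl a 1 + m'" by (rule monom_split)
  show ?case
  proof (cases "m' = 0")
    case True
    then show ?thesis
      by (intro exI[of _ a] exI[of _ 0])
        (auto simp: m ideal_zero[OF I] toric_equiv_refl below_def exponent_below_single[simplified])
  next
    case False
    have "d = monom_degree m'" using Suc.hyps(2) m by simp
    then obtain t n where t: "sgl m' 1 - sgl (sgl t 1 + n) 1 \<in> (join_meet_ideal :: ('l, 'k) mpoly set)"
      "toric_equiv m' (sgl t 1 + n)" "below t = {p\<in>join_irreducibles. 0 < exponent_below m' p}"
      using Suc.hyps(1) False by blast
    have e: "sgl a 1 + (sgl t 1 + n) = n + (sgl a 1 + sgl t 1)"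
      "n + (sgl (inf a t) 1 + sgl (sup a t) 1) = sgl (sup a t) 1 + (sgl (inf a t) 1 + n)"
      by (simp_all add: ac_simps)
    have "sgl m 1 - sgl (sgl a 1 + (sgl t 1 + n)) 1 \<in> (join_meet_ideal :: ('l, 'k) mpoly set)"
      unfolding m by (rule monomial_congruent_mult[OF t(1) I])
    moreover have "sgl (sgl a 1 + (sgl t 1 + n)) 1 - sgl (sgl (sup a t) 1 + (sgl (inf a t) 1 + n)) 1
        \<in> (join_meet_ideal :: ('l, 'k) mpoly set)"
      unfolding e(1) e(2)[symmetric] by (rule monomial_congruent_mult[OF meet_join_congruent I])
    ultimately have "sgl m 1 - sgl (sgl (sup a t) 1 + (sgl (inf a t) 1 + n)) 1
        \<in> (join_meet_ideal :: ('l, 'k) mpoly set)"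
      by (rule congruent_trans[OF _ _ I])
    moreover have "toric_equiv m (sgl a 1 + (sgl t 1 + n))"
      unfolding m toric_equiv_add_cancel by (rule t(2))
    then have "toric_equiv m (sgl (sup a t) 1 + (sgl (inf a t) 1 + n))"
      using toric_equiv_meet_join[of a t] unfolding e(1) e(2)[symmetric]
      by (metis toric_equiv_add_cancel toric_equiv_trans)
    moreover have "below (sup a t) = {p\<in>join_irreducibles. 0 < exponent_below m p}"
      unfolding below_sup t(3) m exponent_below_add exponent_below_single by (auto simp: below_def)
    ultimately show ?thesis by blast
  qed
qed

text \<open>Straightening: equivalent monomials acquire the same top variable, which is cancelled,
  and the rest follows by induction on the degree.\<close>

lemma toric_equiv_congruent:
  fixes m n :: "'l::{finite,distrib_lattice} monom"
  assumes "toric_equiv m n"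
  shows "sgl m 1 - sgl n 1 \<in> (join_meet_ideal :: ('l, 'k::field) mpoly set)"
  using assms
proof (induct "monom_degree m" arbitrary: m n)
  case 0
  then have "m = 0" "n = 0" by (auto simp: toric_equiv_def monom_degree_eq_0_iff)
  then show ?case by (simp add: ideal_zero[OF graded_idealD(1)[OF graded_ideal_join_meet]])
next
  case (Suc d)
  let ?I = "join_meet_ideal :: ('l, 'k) mpoly set"
  note I = graded_idealD(1)[OF graded_ideal_join_meet]
  have "m \<noteq> 0" "n \<noteq> 0" using Suc.hyps(2) Suc.prems by (auto simp: toric_equiv_def)
  then obtain t m' where t: "sgl m 1 - sgl (sgl t 1 + m') 1 \<in> ?I" "toric_equiv m (sgl t 1 + m')"
      "below t = {p\<in>join_irreducibles. 0 < exponent_below m p}"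
    using ex_top_congruent[of m] by blast
  obtain s n' where s: "sgl n 1 - sgl (sgl s 1 + n') 1 \<in> ?I" "toric_equiv n (sgl s 1 + n')"
      "below s = {p\<in>join_irreducibles. 0 < exponent_below n p}"
    using ex_top_congruent[OF \<open>n \<noteq> 0\<close>] by blast
  have "below s = below t" unfolding s(3) t(3) using Suc.prems by (auto simp: toric_equiv_def)
  then have st: "s = t" by (simp add: below_inj)
  have "toric_equiv (sgl t 1 + m') (sgl t 1 + n')"
    using s(2) t(2) Suc.prems unfolding st by (meson toric_equiv_sym toric_equiv_trans)
  then have "toric_equiv m' n'" by (simp only: toric_equiv_add_cancel)
  moreover have "d = monom_degree m'" using t(2) Suc.hyps(2) by (simp add: toric_equiv_def)
  ultimately have "sgl m' 1 - sgl n' 1 \<in> ?I" using Suc.hyps(1) by blast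
  then have "sgl (sgl t 1 + m') 1 - sgl (sgl t 1 + n') 1 \<in> ?I" by (rule monomial_congruent_mult[OF _ I])
  then have "sgl m 1 - sgl (sgl t 1 + n') 1 \<in> ?I" by (rule congruent_trans[OF t(1) _ I])
  moreover have "sgl (sgl t 1 + n') 1 - sgl n 1 \<in> ?I" using ideal_minus[OF I s(1)] st by simp
  ultimately show ?case by (rule congruent_trans[OF _ _ I])
qed

section \<open>The join-meet ideal together with variables\<close>

definition join_meet_plus_vars :: "'l set \<Rightarrow> ('l::{finite,distrib_lattice}, 'k::field) mpoly set" where
  "join_meet_plus_vars U = {g + h | g h. g \<in> join_meet_ideal \<and> h \<in> vars_ideal U}"

lemma join_meet_plus_vars_insert:
  "ideal_plus (join_meet_plus_vars U) (var v) = join_meet_plus_vars (insert v U)"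
proof (intro equalityI subsetI)
  fix p assume "p \<in> ideal_plus (join_meet_plus_vars U) (var v)"
  then obtain g h k where p: "g \<in> join_meet_ideal" "h \<in> vars_ideal U" "p = (g + h) + var v * k"
    unfolding join_meet_plus_vars_def by (auto elim!: ideal_plusE)
  then have "p = g + (h + var v * k)" "h + var v * k \<in> vars_ideal (insert v U)"
    unfolding vars_ideal_insert by (auto intro: ideal_plusI simp: add.assoc)
  then show "p \<in> join_meet_plus_vars (insert v U)" unfolding join_meet_plus_vars_def using p(1) by blast
next
  fix p assume "p \<in> join_meet_plus_vars (insert v U)"
  then obtain g h k where p: "g \<in> join_meet_ideal" "h \<in> vars_ideal U" "p = g + (h + var v * k)"
    unfolding join_meet_plus_vars_def vars_ideal_insert by (auto elim!: ideal_plusE)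
  then have "p = (g + h) + var v * k" "g + h \<in> join_meet_plus_vars U"
    unfolding join_meet_plus_vars_def by (auto simp: add.assoc)
  then show "p \<in> ideal_plus (join_meet_plus_vars U) (var v)" by (metis ideal_plusI)
qed

lemma graded_ideal_join_meet_plus_vars: "graded_ideal (join_meet_plus_vars U)"
proof -
  have "finite U" by simp
  then show ?thesis
  proof (induct U rule: finite_induct)
    case empty
    then show ?case using graded_ideal_join_meet by (simp add: join_meet_plus_vars_def vars_ideal_empty)
  next
    case (insert v U)
    show ?case unfolding join_meet_plus_vars_insert[symmetric]
      by (rule graded_ideal_plus[OF insert(3) homogeneous_var])
  qed
qed

lemma join_meet_plus_vars_empty: "join_meet_plus_vars {} = join_meet_ideal"
  by (simp add: join_meet_plus_vars_def vars_ideal_empty)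

lemma join_meet_subset_plus_vars: "join_meet_ideal \<subseteq> join_meet_plus_vars U"
  unfolding join_meet_plus_vars_def using ideal_zero[OF is_ideal_vars_ideal] by force

lemma vars_subset_join_meet_plus_vars: "vars_ideal U \<subseteq> join_meet_plus_vars U"
  unfolding join_meet_plus_vars_def using ideal_zero[OF graded_idealD(1)[OF graded_ideal_join_meet]] by force

lemma linear_ext_single_mult: "linear_ext h (sgl s c * p) = c * linear_ext (\<lambda>m. h (s + m)) p"
proof -
  have "linear_ext h (sgl s c * (\<Sum>m\<in>ks p. sgl m (lkp p m))) = (\<Sum>m\<in>ks p. c * lkp p m * h (s + m))"
    by (simp add: sum_distrib_left linear_ext_sum mult_single)
  also have "\<dots> = c * linear_ext (\<lambda>m. h (s + m)) p"
    by (simp add: linear_ext_def sum_distrib_left mult.assoc)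
  finally show ?thesis using poly_eq_sum_monomials[of p] by metis
qed

definition class_indicator :: "'l::{finite,distrib_lattice} \<Rightarrow> 'l monom \<Rightarrow> 'l monom \<Rightarrow> 'k::field" where
  "class_indicator u n m = (if (\<forall>a\<in>ks m. u \<le> a) \<and> toric_equiv m n then 1 else 0)"

text \<open>
  The ideal generated by $I$ and the variables outside the filter of \<open>u\<close> is the kernel of a map to
  a monoid ring: the coefficient sums over all fibres vanish.
\<close>

lemma in_join_meet_plus_vars_iff:
  fixes p :: "('l::{finite,distrib_lattice}, 'k::field) mpoly"
  shows "p \<in> join_meet_plus_vars {a. \<not> u \<le> a} \<longleftrightarrow> (\<forall>n. linear_ext (class_indicator u n) p = 0)"
proof
  assume "p \<in> join_meet_plus_vars {a. \<not> u \<le> a}"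
  then obtain g h where p: "p = g + h" "g \<in> join_meet_ideal" "h \<in> vars_ideal {a. \<not> u \<le> a}"
    unfolding join_meet_plus_vars_def by blast
  show "\<forall>n. linear_ext (class_indicator u n) p = 0"
  proof
    fix n
    let ?phi = "linear_ext (class_indicator u n) :: ('l, 'k) mpoly \<Rightarrow> 'k"
    have "?phi h = 0" unfolding linear_ext_def
    proof (intro sum.neutral ballI)
      fix m assume "m \<in> ks h"
      then have "\<not> (\<forall>a\<in>ks m. u \<le> a)" using p(3) unfolding vars_ideal_def by auto
      then have "class_indicator u n m = (0 :: 'k)" unfolding class_indicator_def by (simp only: simp_thms if_False)
      then show "lkp h m * class_indicator u n m = 0" by simp
    qed
    moreover have I0: "?phi (q * (var a * var b - var (inf a b) * var (sup a b))) = 0" for a b q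
    proof (rule linear_ext_mult_eq_0)
      fix m c
      have "toric_equiv (m + (sgl a 1 + sgl b 1)) (m + (sgl (inf a b) 1 + sgl (sup a b) 1))"
        by (simp only: toric_equiv_add_cancel toric_equiv_meet_join)
      then have "toric_equiv (m + (sgl a 1 + sgl b 1)) n \<longleftrightarrow> toric_equiv (m + (sgl (inf a b) 1 + sgl (sup a b) 1)) n"
        using toric_equiv_sym toric_equiv_trans by blast
      moreover have "(\<forall>x\<in>ks (m + (sgl a 1 + sgl b 1)). u \<le> x) \<longleftrightarrow>
          (\<forall>x\<in>ks (m + (sgl (inf a b) 1 + sgl (sup a b) 1)). u \<le> x)"
        by (auto simp: keys_monom_add intro: le_supI1)
      ultimately show "?phi (sgl m c * (var a * var b - var (inf a b) * var (sup a b))) = 0"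
        unfolding var_mult_var right_diff_distrib mult_single linear_ext_diff linear_ext_single class_indicator_def
        by simp
    qed
    moreover have "?phi g = 0"
      using p(2) unfolding join_meet_ideal_def
      by (induct rule: module.span_induct_alt[OF module_mult, consumes 1, case_names base step])
        (auto simp: linear_ext_add I0)
    ultimately show "?phi p = 0" by (simp add: p(1) linear_ext_add)
  qed
next
  let ?J = "join_meet_plus_vars {a. \<not> u \<le> a} :: ('l, 'k) mpoly set"
  note J = graded_idealD(1)[OF graded_ideal_join_meet_plus_vars]
  assume z: "\<forall>n. linear_ext (class_indicator u n) p = 0"
  define G where "G = {m\<in>ks p. \<forall>a\<in>ks m. u \<le> a}"
  \<comment> \<open>One representative for each fibre. The terms supported in the filter are moved
    to their representatives, where the coefficients add up to the fibre sums, which vanish by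
    assumption.\<close>
  define rep where "rep = (\<lambda>m :: 'l monom. SOME n. toric_equiv n m)"
  have rep: "toric_equiv (rep m) m" for m unfolding rep_def by (rule someI) (rule toric_equiv_refl)
  have rep_eq: "rep m = rep n \<longleftrightarrow> toric_equiv m n" for m n
  proof
    assume "rep m = rep n" then show "toric_equiv m n"
      using rep[of m] rep[of n] by (metis toric_equiv_sym toric_equiv_trans)
  next
    assume "toric_equiv m n"
    then have "toric_equiv k m \<longleftrightarrow> toric_equiv k n" for k using toric_equiv_sym toric_equiv_trans by blast
    then show "rep m = rep n" unfolding rep_def by simp
  qed
  have A: "(\<Sum>m\<in>ks p - G. sgl m (lkp p m)) \<in> ?J"
  proof (rule ideal_sum[OF J])
    fix m assume "m \<in> ks p - G"
    then have "sgl m (lkp p m) \<in> vars_ideal {a. \<not> u \<le> a}" unfolding G_def vars_ideal_def by auto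
    then show "sgl m (lkp p m) \<in> ?J" using vars_subset_join_meet_plus_vars by blast
  qed
  have B: "(\<Sum>m\<in>G. sgl m (lkp p m) - sgl (rep m) (lkp p m)) \<in> ?J"
  proof (rule ideal_sum[OF J])
    fix m
    have "sgl m 1 - sgl (rep m) 1 \<in> ?J"
      using toric_equiv_congruent[OF toric_equiv_sym[OF rep]] join_meet_subset_plus_vars by blast
    from ideal_mult[OF J this, of "sgl 0 (lkp p m)"]
    show "sgl m (lkp p m) - sgl (rep m) (lkp p m) \<in> ?J" by (simp add: right_diff_distrib mult_single)
  qed
  have C: "(\<Sum>m\<in>G. sgl (rep m) (lkp p m)) = 0"
  proof -
    have fin: "finite G" unfolding G_def by simp
    have "(\<Sum>m | m \<in> G \<and> rep m = r. sgl (rep m) (lkp p m)) = 0" if "r \<in> rep ` G" for r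
    proof -
      from that obtain n where n: "n \<in> G" "r = rep n" by blast
      have "linear_ext (class_indicator u n) p = (\<Sum>m\<in>ks p. if m \<in> G \<and> rep m = r then lkp p m else 0)"
        unfolding linear_ext_def by (rule sum.cong) (auto simp: class_indicator_def G_def n rep_eq)
      also have "\<dots> = (\<Sum>m | m \<in> G \<and> rep m = r. lkp p m)"
        unfolding sum.inter_filter[OF finite_keys, symmetric] by (rule sum.cong) (auto simp: G_def)
      finally have "(\<Sum>m | m \<in> G \<and> rep m = r. lkp p m) = 0" using z by simp
      moreover have "(\<Sum>m | m \<in> G \<and> rep m = r. sgl (rep m) (lkp p m)) =
          sgl r (\<Sum>m | m \<in> G \<and> rep m = r. lkp p m)"
        by (rule poly_mapping_eqI) (auto simp: lookup_sum lookup_single when_def)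
      ultimately show ?thesis by simp
    qed
    then show ?thesis using sum.image_gen[OF fin, of "\<lambda>m. sgl (rep m) (lkp p m)" rep] by simp
  qed
  have E: "p = (\<Sum>m\<in>ks p - G. sgl m (lkp p m)) + (\<Sum>m\<in>G. sgl m (lkp p m) - sgl (rep m) (lkp p m))
      + (\<Sum>m\<in>G. sgl (rep m) (lkp p m))"
  proof -
    have "p = (\<Sum>m\<in>ks p - G. sgl m (lkp p m)) + (\<Sum>m\<in>G. sgl m (lkp p m))"
      using poly_eq_sum_monomials[of p] sum.subset_diff[of G "ks p" "\<lambda>m. sgl m (lkp p m)"]
      unfolding G_def by auto
    then show ?thesis by (simp add: sum_subtractf)
  qed
  show "p \<in> ?J"
    by (rule ssubst[OF E, of "\<lambda>x. x \<in> ?J"]) (unfold C add_0_right, rule ideal_add[OF J A B])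
qed

text \<open>Adding \<open>u\<close> to monomials preserves and reflects equivalence as well as being
  supported in the filter of \<open>u\<close>. The coefficient sum of \<open>p\<close> over the
  fibre of \<open>n\<close> is thus that of \<open>var u * p\<close> over the shifted fibre.\<close>

lemma join_meet_plus_vars_nonzerodivisor:
  fixes p :: "('l::{finite,distrib_lattice}, 'k::field) mpoly"
  assumes "var u * p \<in> join_meet_plus_vars {a. \<not> u \<le> a}"
  shows "p \<in> join_meet_plus_vars {a. \<not> u \<le> a}"
  unfolding in_join_meet_plus_vars_iff
proof
  fix n
  have "(\<lambda>m. class_indicator u (sgl u 1 + n) (sgl u 1 + m)) = (class_indicator u n :: _ \<Rightarrow> 'k)"
    by (rule ext) (simp only: class_indicator_def toric_equiv_add_cancel keys_monom_add, simp)
  then show "linear_ext (class_indicator u n) p = 0"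
    using assms[unfolded in_join_meet_plus_vars_iff, rule_format, of "sgl u 1 + n"]
    unfolding var_def linear_ext_single_mult by simp
qed

lemma join_meet_ideal_subset:
  fixes A :: "('l::{finite,distrib_lattice}, 'k::field) mpoly set"
  assumes "is_ideal A"
    and "\<And>a b. \<not> a \<le> b \<Longrightarrow> \<not> b \<le> a \<Longrightarrow> var a * var b - var (inf a b) * var (sup a b) \<in> A"
  shows "join_meet_ideal \<subseteq> A"
proof
  fix p :: "('l, 'k) mpoly" assume "p \<in> join_meet_ideal"
  then show "p \<in> A" unfolding join_meet_ideal_def
    by (induct rule: module.span_induct_alt[OF module_mult, consumes 1, case_names base step])
      (auto intro: ideal_zero[OF assms(1)] intro!: ideal_add[OF assms(1)] ideal_mult[OF assms(1)] assms(2))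
qed

section \<open>The lattice of a chain and an isolated element\<close>

lemma vars_ideal_subset:
  assumes "is_ideal (A :: ('v::finite, 'k::comm_ring_1) mpoly set)" "\<And>v. v \<in> U \<Longrightarrow> var v \<in> A"
  shows "vars_ideal U \<subseteq> A"
proof -
  have "finite U" by simp
  then show ?thesis using assms(2)
  proof (induct U)
    case empty then show ?case by (simp add: vars_ideal_empty ideal_zero[OF assms(1)])
  next
    case (insert v U)
    then show ?case unfolding vars_ideal_insert
      by (auto elim!: ideal_plusE intro!: ideal_add[OF assms(1)] ideal_mult_right[OF assms(1)])
  qed
qed

text \<open>The ideals of \<open>a\<close> and \<open>b\<close> differ at most in their parts inside
  \<open>C\<close>, and ideals of a chain are nested.\<close>

lemma chain_plus_isolated_comparable:
  fixes q :: "'l::{finite,distrib_lattice}"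
  assumes "join_irreducibles = insert q C" and C: "Complete_Partial_Order.chain (\<le>) C"
    and ab: "q \<le> a \<longleftrightarrow> q \<le> b"
  shows "a \<le> b \<or> b \<le> a"
proof (rule ccontr)
  assume "\<not> (a \<le> b \<or> b \<le> a)"
  then obtain p p' where p: "p \<in> join_irreducibles" "p \<le> a" "\<not> p \<le> b"
    and p': "p' \<in> join_irreducibles" "p' \<le> b" "\<not> p' \<le> a"
    using join_irreducible_separates by metis
  then have "p \<in> C" "p' \<in> C" using assms(1) ab by auto
  then have "p \<le> p' \<or> p' \<le> p" using C unfolding chain_def by blast
  then show False using p p' by (meson order_trans)
qed

text \<open>The lattice is a ladder of two chains, the elements above \<open>q\<close> and the
  others. Each round of the induction strips the lowest rung, consisting of \<open>u\<close> and
  \<open>sup u q\<close>.\<close>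

lemma koszul_vanishes_chain_plus_isolated:
  fixes vs :: "'l::{finite,distrib_lattice} list"
  assumes vs: "distinct vs" "set vs = UNIV"
    and cpi: "chain_plus_isolated (join_irreducibles :: 'l set)"
  shows "koszul_vanishes (map var vs) (join_meet_ideal :: ('l, 'k::field) mpoly set) 2"
proof -
  let ?P = "join_irreducibles :: 'l set"
  let ?xs = "map var vs :: ('l, 'k) mpoly list"
  obtain C q where P: "?P = insert q C" and C: "Complete_Partial_Order.chain (\<le>) C"
    and Cq: "\<And>c. c \<in> C \<Longrightarrow> \<not> c \<le> q \<and> \<not> q \<le> c"
    using cpi unfolding chain_plus_isolated_def by auto
  note cmp = chain_plus_isolated_comparable[OF P C]
  have qP: "q \<in> ?P" using P by blast
  have isolated: "p = q" if "p \<in> ?P" "p \<le> q \<or> q \<le> p" for p using that P Cq by auto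
  have lin: "linear_forms ?xs" by (auto simp: homogeneous_var)
  have "koszul_vanishes ?xs (join_meet_plus_vars {a. \<not> u \<le> a}) 2" if "\<not> q \<le> u" for u :: 'l
    using that
  proof (induct "card {a. u \<le> a}" arbitrary: u rule: less_induct)
    case less
    let ?J = "join_meet_plus_vars {a. \<not> u \<le> a} :: ('l, 'k) mpoly set"
    let ?w = "sup u q"
    let ?J1 = "ideal_plus ?J (var u)"
    have J1: "?J1 = join_meet_plus_vars (insert u {a. \<not> u \<le> a})" by (rule join_meet_plus_vars_insert)
    have gr: "graded_ideal ?J1" unfolding J1 by (rule graded_ideal_join_meet_plus_vars)
    note I1 = graded_idealD(1)[OF gr]
    \<comment> \<open>From \<open>u\<close> to \<open>?w\<close> only one join irreducible element
      is gained, namely \<open>q\<close>.\<close>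
    have new_q: "\<not> p \<le> ?w" if "p \<in> ?P" "\<not> p \<le> u" "p \<noteq> q" for p
      using that isolated by (auto simp: join_irreducible_le_sup_iff)
    define N where "N = {a. \<not> ?w \<le> a}"
    have colon: "{h. var ?w * h \<in> ?J1} = vars_ideal N"
    proof
      \<comment> \<open>Two incomparable elements cannot both lie above \<open>q\<close>, so one of
        them, and with it the meet, is outside the filter of \<open>?w\<close>. Both terms of each
        generator are therefore in \<open>vars_ideal N\<close>.\<close>
      have V: "?J1 \<subseteq> vars_ideal N"
      proof -
        note V = is_ideal_vars_ideal[of "N"]
        have "join_meet_ideal \<subseteq> (vars_ideal N :: ('l, 'k) mpoly set)"
        proof (rule join_meet_ideal_subset[OF V])
          fix a c :: 'l assume ac: "\<not> a \<le> c" "\<not> c \<le> a"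
          have "\<not> (q \<le> a \<and> q \<le> c)" using cmp[of a c] ac by auto
          then have na: "a \<in> N \<or> c \<in> N" by (auto simp: N_def)
          then have "inf a c \<in> N" by (auto simp: N_def)
          then have "var (inf a c) * var (sup a c) \<in> vars_ideal N"
            by (intro ideal_mult_right[OF V] var_in_vars_ideal)
          moreover have "var a * var c \<in> vars_ideal N"
            using na by (auto intro: ideal_mult_right[OF V] ideal_mult[OF V] var_in_vars_ideal)
          ultimately show "var a * var c - var (inf a c) * var (sup a c) \<in> vars_ideal N"
            by (intro ideal_diff[OF V])
        qed
        moreover have "vars_ideal (insert u {a. \<not> u \<le> a}) \<subseteq> (vars_ideal N :: ('l, 'k) mpoly set)"
          using less.prems by (intro vars_ideal_subset V var_in_vars_ideal) (auto simp: N_def)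
        ultimately show ?thesis
          unfolding J1 unfolding join_meet_plus_vars_def by (auto intro!: ideal_add[OF V])
      qed
      show "{h. var ?w * h \<in> ?J1} \<subseteq> vars_ideal N"
        using V vars_ideal_prime[of ?w _ N] by (auto simp: N_def)
      have "is_ideal {h. var ?w * h \<in> ?J1}"
        unfolding is_ideal_def using ideal_add[OF I1] ideal_zero[OF I1] ideal_mult[OF I1]
        by (auto simp: distrib_left mult.left_commute[of "var ?w"])
      then show "vars_ideal N \<subseteq> {h. var ?w * h \<in> ?J1}"
      proof (rule vars_ideal_subset)
        fix a assume a: "a \<in> N"
        have vJ1: "var x \<in> ?J1" if "x = u \<or> \<not> u \<le> x" for x
          using that vars_subset_join_meet_plus_vars var_in_vars_ideal[of x "insert u {a. \<not> u \<le> a}"]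
          unfolding J1 by blast
        show "var a \<in> {h. var ?w * h \<in> ?J1}"
        proof (cases "a = u \<or> \<not> u \<le> a")
          case True then show ?thesis using vJ1 ideal_mult[OF I1] by blast
        next
          case False
          then have qa: "\<not> q \<le> a" using a by (auto simp: N_def)
          have "\<not> a \<le> u" using False by auto
          then obtain p where p: "p \<in> ?P" "p \<le> a" "\<not> p \<le> u" by (rule join_irreducible_separates)
          have "p \<noteq> q" using p(2) qa by blast
          then have "\<not> p \<le> ?w" using new_q p by blast
          then have "\<not> a \<le> ?w" using p(2) order_trans by blast
          then have "var a * var ?w - var (inf a ?w) * var (sup a ?w) \<in> ?J1"
            using join_meet_generator[of a ?w] a join_meet_subset_plus_vars unfolding J1 N_def by blast
          \<comment> \<open>An element properly above \<open>u\<close> and not above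
            \<open>q\<close> meets \<open>?w\<close> exactly in \<open>u\<close>, whose variable is
            already in the ideal; the binomial for \<open>a\<close> and \<open>?w\<close> then puts
            their product there.\<close>
          moreover have "inf a ?w \<le> u"
          proof (rule ccontr)
            assume "\<not> inf a ?w \<le> u"
            then obtain p where "p \<in> ?P" "p \<le> inf a ?w" "\<not> p \<le> u" by (rule join_irreducible_separates)
            then show False using new_q[of p] qa by auto
          qed
          then have "inf a ?w = u" using False by (simp add: order_antisym)
          then have "var (inf a ?w) * var (sup a ?w) \<in> ?J1" using vJ1 ideal_mult_right[OF I1] by metis
          ultimately have "var a * var ?w \<in> ?J1" using ideal_add[OF I1] by fastforce
          then show ?thesis by (simp add: mult.commute)
        qed
      qed
    qed
    define W where "W = {a. u \<le> a \<and> a \<noteq> u \<and> a \<noteq> ?w}"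
    \<comment> \<open>Every element of \<open>W\<close> above \<open>q\<close> dominates one that is
      not. A least element of the latter kind is therefore least in \<open>W\<close> and can replace
      \<open>u\<close> in the induction.\<close>
    have up: "\<exists>p. sup u p \<in> W \<and> \<not> q \<le> sup u p \<and> sup u p \<le> a" if a: "a \<in> W" "q \<le> a" for a
    proof -
      have "\<not> a \<le> ?w" using a unfolding W_def by (auto intro: order_antisym)
      then obtain p where p: "p \<in> ?P" "p \<le> a" "\<not> p \<le> ?w" by (rule join_irreducible_separates)
      then have "\<not> q \<le> p" using isolated[of p] by (metis sup.cobounded2)
      then have nq: "\<not> q \<le> sup u p" using less.prems by (simp add: join_irreducible_le_sup_iff[OF qP])
      have "sup u p \<noteq> u" using p(3) by (metis le_supI1 sup.cobounded2)
      moreover have "sup u p \<noteq> ?w" using nq by (metis sup.cobounded2)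
      ultimately show ?thesis using nq p(2) a unfolding W_def by (intro exI[of _ p]) auto
    qed
    have "koszul_vanishes ?xs (join_meet_plus_vars (- W)) 2"
    proof (cases "W = {}")
      case True
      have "vars_ideal UNIV \<subseteq> (join_meet_plus_vars UNIV :: ('l, 'k) mpoly set)"
        by (rule vars_subset_join_meet_plus_vars)
      moreover have "join_meet_ideal \<subseteq> (vars_ideal UNIV :: ('l, 'k) mpoly set)"
        by (rule join_meet_ideal_subset[OF is_ideal_vars_ideal])
          (simp add: vars_ideal_UNIV const_coeff_diff const_coeff_mult)
      then have "join_meet_plus_vars UNIV \<subseteq> (vars_ideal UNIV :: ('l, 'k) mpoly set)"
        by (auto simp: join_meet_plus_vars_def intro: ideal_add[OF is_ideal_vars_ideal])
      ultimately have "join_meet_plus_vars UNIV = (vars_ideal UNIV :: ('l, 'k) mpoly set)" by blast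
      moreover have "koszul_vanishes ?xs (vars_ideal UNIV) 2"
        by (rule koszul_vanishes_mono[OF koszul_vanishes_vars_ideal[OF vs]]) simp
      ultimately show ?thesis using True by simp
    next
      case False
      then have "{a\<in>W. \<not> q \<le> a} \<noteq> {}" using up by blast
      then obtain v where v: "v \<in> W" "\<not> q \<le> v" and vmin: "\<And>a. a \<in> W \<Longrightarrow> \<not> q \<le> a \<Longrightarrow> a \<le> v \<Longrightarrow> a = v"
        using finite_has_minimal[of "{a\<in>W. \<not> q \<le> a}"] by (metis (mono_tags, lifting) finite mem_Collect_eq)
      have vle: "v \<le> a" if "a \<in> W" "\<not> q \<le> a" for a using cmp[of v a] vmin that v by blast
      have W: "W = {a. v \<le> a}"
      proof
        show "W \<subseteq> {a. v \<le> a}" using vle up by (metis mem_Collect_eq order_trans subsetI)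
        have uv: "u \<le> v" "u \<noteq> v" using v(1) unfolding W_def by auto
        then have "\<not> v \<le> u" by auto
        then obtain p where p: "p \<in> ?P" "p \<le> v" "\<not> p \<le> u" by (rule join_irreducible_separates)
        have "p \<noteq> q" using p(2) v(2) by blast
        then have "\<not> p \<le> ?w" using new_q p by blast
        then have "\<not> v \<le> ?w" using p(2) order_trans by blast
        then show "{a. v \<le> a} \<subseteq> W" using uv unfolding W_def by (auto intro: order_trans order_antisym)
      qed
      have "W \<subset> {a. u \<le> a}" unfolding W_def by auto
      then have "card {a. v \<le> a} < card {a. u \<le> a}" unfolding W by (intro psubset_card_mono) auto
      then have "koszul_vanishes ?xs (join_meet_plus_vars {a. \<not> v \<le> a}) 2" using less.hyps v(2) by blast
      moreover have "- W = {a. \<not> v \<le> a}" using W by auto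
      ultimately show ?thesis by simp
    qed
    moreover have "- W = insert ?w (insert u {a. \<not> u \<le> a})" unfolding W_def by auto
    ultimately have v1: "koszul_vanishes ?xs (ideal_plus ?J1 (var ?w)) 2"
      unfolding J1 join_meet_plus_vars_insert by simp
    have v2: "koszul_vanishes ?xs {h. var ?w * h \<in> ?J1} (2 - 1)"
      unfolding colon using koszul_vanishes_vars_ideal[OF vs] by simp
    have "koszul_vanishes ?xs ?J1 2"
      by (rule koszul_vanishes_ses[OF gr homogeneous_var lin v1 v2])
    then show ?case
      by (rule koszul_vanishes_nonzerodivisor[OF graded_idealD(1)[OF graded_ideal_join_meet_plus_vars] _ _
          join_meet_plus_vars_nonzerodivisor, rotated]) (simp_all add: vs(2))
  qed
  \<comment> \<open>At the bottom of the lattice the filter is everything and no variables are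
    adjoined.\<close>
  from this[OF join_irreducible_not_bot[OF qP]]
  have "koszul_vanishes ?xs (join_meet_plus_vars {}) 2" by (simp add: Inf_fin_UNIV_le)
  then show ?thesis by (simp add: join_meet_plus_vars_empty)
qed

section \<open>Koszul homology and free resolutions\<close>

text \<open>The component in homological degree \<open>p\<close>. It is needed here because Tor has
  a single homological index, whereas chains mix all of them.\<close>

definition kpart :: "nat \<Rightarrow> (bool list \<Rightarrow> 'r) \<Rightarrow> bool list \<Rightarrow> 'r::comm_ring_1" where
  "kpart p z bs = (if count_list bs True = p then z bs else 0)"

lemma kd_kpart:
  "kd ys (kpart (Suc p) z) bs = kpart p (kd ys z) bs" "kd ys (kpart 0 z) bs = 0"
proof (induct ys arbitrary: p z bs)
  case Nil
  { case 1 then show ?case by (simp add: kpart_def) }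
  { case 2 then show ?case by simp }
next
  case (Cons y ys)
  have T: "(\<lambda>c. kpart (Suc p) z (True # c)) = kpart p (\<lambda>c. z (True # c))" for p z
    by (auto simp: kpart_def)
  have T0: "(\<lambda>c. kpart 0 z (True # c)) = (\<lambda>_. 0)" for z
    by (auto simp: kpart_def)
  have F: "(\<lambda>c. kpart p z (False # c)) = kpart p (\<lambda>c. z (False # c))" for p z
    by (auto simp: kpart_def)
  { case 1
    show ?case
    proof (cases bs)
      case (Cons b c)
      show ?thesis
      proof (cases b)
        case True
        show ?thesis
        proof (cases p)
          case 0 then show ?thesis using True Cons by (simp add: T Cons.hyps(2), simp add: kpart_def)
        next
          case (Suc p') then show ?thesis using True Cons by (simp add: T Cons.hyps(1), simp add: kpart_def)
        qed
      next
        case False then show ?thesis using Cons by (simp add: F Cons.hyps(1), simp add: kpart_def)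
      qed
    qed (simp add: kpart_def) }
  { case 2
    then show ?case by (cases bs) (auto simp: T0 F Cons.hyps(2), simp add: kpart_def) }
qed

lemma count_list_kzero [simp]: "count_list (replicate n False) True = 0"
  by (induct n) auto

lemma count_list_eq_0: "length bs = n \<Longrightarrow> count_list bs True = 0 \<Longrightarrow> bs = replicate n False"
  by (induct bs arbitrary: n) (auto split: if_splits)

lemma kpart_kzero [simp]: "kpart (Suc p) z (replicate n False) = 0"
  by (simp add: kpart_def)

lemma mat_map_kd:
  "mat_map m n A (\<lambda>c. kd ys (\<lambda>b. U b c) bs) k = kd ys (\<lambda>b. mat_map m n A (U b) k) bs"
  by (simp add: mat_map_def kd_sum kd_scale)

lemma mat_map_diff: "mat_map m n A (\<lambda>c. u c - v c) = (\<lambda>k. mat_map m n A u k - mat_map m n A v k)"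
  by (rule ext) (simp add: mat_map_def right_diff_distrib sum_subtractf)

lemma mat_map_zero [simp]: "mat_map m n A (\<lambda>_. 0) = (\<lambda>_. 0)"
  by (rule ext) (simp add: mat_map_def)

lemma mat_map_free_mod: "mat_map m n A v \<in> free_mod m"
  by (simp add: mat_map_def free_mod_def)

lemma const_coeff_mat_map:
  "const_coeff (mat_map m n A v k) = mat_map m n (\<lambda>r c. const_coeff (A r c)) (\<lambda>c. const_coeff (v c)) k"
  by (simp add: mat_map_def const_coeff_sum const_coeff_mult)

text \<open>
  The module $I$ is the image of the map with index 0, and the map with index $i + 1$ is the
  differential with index $i$ of a resolution of $I$.
\<close>

locale graded_exact =
  fixes r :: "nat \<Rightarrow> nat" and g :: "nat \<Rightarrow> nat \<Rightarrow> int"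
    and A :: "nat \<Rightarrow> nat \<Rightarrow> nat \<Rightarrow> ('v::finite, 'k::field) mpoly"
  assumes hom: "k < r q \<Longrightarrow> c < r (Suc q) \<Longrightarrow> homogeneous (g (Suc q) c - g q k) (A q k c)"
    and exact: "{v \<in> free_mod (r (Suc q)). mat_map (r q) (r (Suc q)) (A q) v = (\<lambda>_. 0)} =
      mat_map (r (Suc q)) (r (Suc (Suc q))) (A (Suc q)) ` free_mod (r (Suc (Suc q)))"
begin

abbreviation dl where "dl q \<equiv> mat_map (r q) (r (Suc q)) (A q)"
abbreviation im where "im q \<equiv> dl q ` free_mod (r (Suc q))"
abbreviation tens where "tens q \<equiv> mat_map (r q) (r (Suc q)) (\<lambda>k c. const_coeff (A q k c))"
abbreviation strand where "strand q j \<equiv> {w \<in> free_mod (r q). \<forall>k. w k \<noteq> (0 :: 'k) \<longrightarrow> g q k = j}"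

text \<open>The modules are shifted by one, so Tor_i of the image of \<open>dl 0\<close> sits at
  index \<open>Suc i\<close>. For \<open>i = 0\<close> only those \<open>w\<close> are considered
  that \<open>tens 0\<close> kills; these are the ones that come from elements without constant
  coefficients.\<close>

definition tor_zero where
  "tor_zero i j \<longleftrightarrow> (\<forall>w\<in>strand (Suc i) j. tens i w = (\<lambda>_. 0) \<longrightarrow>
     (\<exists>w'\<in>strand (Suc (Suc i)) j. w = tens (Suc i) w'))"

lemma im_kernel: "v \<in> im (Suc q) \<longleftrightarrow> v \<in> free_mod (r (Suc q)) \<and> dl q v = (\<lambda>_. 0)"
  using exact[of q] by blast

lemma homogeneous_lift:
  assumes v: "v \<in> im q" and hv: "\<And>k. homogeneous (t - g q k) (v k)"
  shows "\<exists>u\<in>free_mod (r (Suc q)). dl q u = v \<and> (\<forall>c. homogeneous (t - g (Suc q) c) (u c))"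
proof -
  obtain u where u: "u \<in> free_mod (r (Suc q))" "dl q u = v" using v by blast
  define u' where "u' = (\<lambda>c. hcomp (t - g (Suc q) c) (u c))"
  have "dl q u' k = v k" for k
  proof (cases "k < r q")
    case True
    have "hcomp (t - g q k) (A q k c * u c) = A q k c * u' c" if "c < r (Suc q)" for c
      using hcomp_mult[OF hom[OF True that], of "t - g q k" "u c"] by (simp add: u'_def)
    then have "hcomp (t - g q k) (dl q u k) = dl q u' k"
      using True by (simp add: mat_map_def hcomp_sum)
    then show ?thesis using hcomp_homogeneous[OF hv] by (simp add: u(2))
  qed (simp add: u(2)[symmetric] mat_map_def)
  moreover have "u' \<in> free_mod (r (Suc q))" using u(1) by (simp add: free_mod_def u'_def)
  ultimately show ?thesis using homogeneous_hcomp by (intro bexI[of _ u']) (auto simp: u'_def)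
qed

text \<open>The constant parts of any homogeneous lift form a cycle for Tor. If this cycle bounds, a
  constant vector \<open>u'\<close> provides a correction from the next module that removes the
  constant parts without changing the image.\<close>

lemma lift_const_coeff_0:
  assumes T: "tor_zero i j" and v: "v \<in> im i" and hv: "\<And>k. homogeneous (j - g i k) (v k)"
    and cv: "\<And>k. const_coeff (v k) = 0"
  shows "\<exists>x\<in>free_mod (r (Suc i)). dl i x = v \<and>
    (\<forall>c. const_coeff (x c) = 0 \<and> homogeneous (j - g (Suc i) c) (x c))"
proof -
  obtain u where u: "u \<in> free_mod (r (Suc i))" "dl i u = v" "\<And>c. homogeneous (j - g (Suc i) c) (u c)"
    using homogeneous_lift[OF v hv] by blast
  define w where "w = (\<lambda>c. const_coeff (u c))"
  have "g (Suc i) c = j" if "w c \<noteq> 0" for c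
    using const_coeff_homogeneous[OF u(3), of c] that by (auto simp: w_def)
  then have "w \<in> strand (Suc i) j" using u(1) by (auto simp: free_mod_def w_def)
  moreover have "tens i w = (\<lambda>_. 0)"
    using const_coeff_mat_map[of "r i" "r (Suc i)" "A i" u] cv by (auto simp: u(2) w_def)
  ultimately obtain w' where w': "w' \<in> strand (Suc (Suc i)) j" "w = tens (Suc i) w'"
    using T unfolding tor_zero_def by blast
  define u' where "u' = (\<lambda>c. sgl 0 (w' c) :: ('v, 'k) mpoly)"
  have u': "u' \<in> free_mod (r (Suc (Suc i)))" using w'(1) by (simp add: free_mod_def u'_def)
  define x where "x = (\<lambda>c. u c - dl (Suc i) u' c)"
  have "const_coeff (x c) = 0" for c
    using fun_cong[OF w'(2), of c] by (simp add: x_def const_coeff_diff const_coeff_mat_map w_def u'_def)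
  moreover have "homogeneous (j - g (Suc i) c) (x c)" for c
  proof -
    have "homogeneous (j - g (Suc i) c) (A (Suc i) c d * u' d)" if "c < r (Suc i)" "d < r (Suc (Suc i))" for d
    proof (cases "w' d = 0")
      case False
      then have "g (Suc (Suc i)) d = j" using w'(1) by blast
      then show ?thesis
        using homogeneous_mult[OF hom[OF that] homogeneous_const] by (simp add: u'_def)
    qed (simp add: u'_def)
    then have "homogeneous (j - g (Suc i) c) (dl (Suc i) u' c)"
      by (auto simp: mat_map_def intro: homogeneous_sum)
    then show ?thesis unfolding x_def by (intro homogeneous_diff u(3))
  qed
  moreover have "x \<in> free_mod (r (Suc i))"
    using u(1) mat_map_free_mod[of "r (Suc i)"] by (simp add: x_def free_mod_def)
  moreover have "dl i (dl (Suc i) u') = (\<lambda>_. 0)" using im_kernel u' by blast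
  then have "dl i x = v" by (simp add: x_def mat_map_diff u(2))
  ultimately show ?thesis by blast
qed

text \<open>Vanishing of H_p in internal degree \<open>j\<close> for the Koszul complex with
  coefficients in the syzygy module \<open>im q\<close>; a coefficient in homological degree
  \<open>p\<close> then has degree \<open>j - p\<close>. The form is made for dimension shifting,
  which trades \<open>q\<close> for \<open>p\<close>.\<close>

definition koszul_zero where
  "koszul_zero ys j q p \<longleftrightarrow> (\<forall>Z. (\<forall>bs. length bs = length ys \<longrightarrow> Z bs \<in> im q) \<longrightarrow>
     (\<forall>bs k. homogeneous (j - int p - g q k) (Z bs k)) \<longrightarrow>
     (\<forall>bs. count_list bs True \<noteq> p \<longrightarrow> Z bs = (\<lambda>_. 0)) \<longrightarrow>
     (\<forall>bs k. length bs = length ys \<longrightarrow> kd ys (\<lambda>b. Z b k) bs = 0) \<longrightarrow>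
     (p = 0 \<longrightarrow> (\<forall>k. const_coeff (Z (kzero ys) k) = 0)) \<longrightarrow>
     (\<exists>W. (\<forall>bs. length bs = length ys \<longrightarrow> W bs \<in> im q) \<and>
       (\<forall>bs k. length bs = length ys \<longrightarrow> count_list bs True = p \<longrightarrow> Z bs k = kd ys (\<lambda>b. W b k) bs)))"

text \<open>A lift without constant coefficients is a combination of the variables, so its image
  lies in the maximal ideal times \<open>im i\<close>.\<close>

lemma koszul_zero_base:
  assumes vs: "set vs = UNIV" and T: "tor_zero i j"
  shows "koszul_zero (map var vs) j i 0"
  unfolding koszul_zero_def
proof (intro allI impI)
  let ?ys = "map var vs :: ('v, 'k) mpoly list"
  fix Z
  assume Z: "\<forall>bs. length bs = length ?ys \<longrightarrow> Z bs \<in> im i"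
    and hZ: "\<forall>bs k. homogeneous (j - int 0 - g i k) (Z bs k)"
    and cZ: "0 = (0::nat) \<longrightarrow> (\<forall>k. const_coeff (Z (kzero ?ys) k) = 0)"
  have "Z (kzero ?ys) \<in> im i" using Z by simp
  then obtain x where x: "x \<in> free_mod (r (Suc i))" "dl i x = Z (kzero ?ys)" "\<And>c. const_coeff (x c) = 0"
    using lift_const_coeff_0[OF T, of "Z (kzero ?ys)"] hZ cZ by auto
  have "x c \<in> koszul_gen ?ys" for c using x(3) by (simp add: koszul_gen_vars vars_ideal_UNIV vs)
  then have "\<exists>y. x c = kd ?ys y (kzero ?ys)" for c unfolding koszul_gen_def by blast
  then obtain y where y: "\<And>c. x c = kd ?ys (y c) (kzero ?ys)" by metis
  define Y where "Y = (\<lambda>b c. if c < r (Suc i) then y c b else 0)"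
  have Y: "kd ?ys (\<lambda>b. Y b c) (kzero ?ys) = x c" for c
    using y x(1) by (cases "c < r (Suc i)") (auto simp: Y_def free_mod_def)
  have "Y b \<in> free_mod (r (Suc i))" for b by (simp add: Y_def free_mod_def)
  moreover have "Z bs k = kd ?ys (\<lambda>b. dl i (Y b) k) bs"
    if "length bs = length ?ys" "count_list bs True = 0" for bs k
  proof -
    have bs: "bs = kzero ?ys" using count_list_eq_0 that by blast
    show ?thesis unfolding bs mat_map_kd[symmetric] Y x(2) by simp
  qed
  ultimately show "\<exists>W. (\<forall>bs. length bs = length ?ys \<longrightarrow> W bs \<in> im i) \<and>
    (\<forall>bs k. length bs = length ?ys \<longrightarrow> count_list bs True = 0 \<longrightarrow> Z bs k = kd ?ys (\<lambda>b. W b k) bs)"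
    by (intro exI[of _ "\<lambda>b. dl i (Y b)"]) auto
qed

text \<open>The connecting map of 0 -> im (q + 1) -> F -> im q -> 0 from H_{p+1} to H_p is
  injective, since the free module F has no Koszul homology in positive degree.\<close>

lemma koszul_zero_step:
  assumes vs: "distinct vs" and V: "koszul_zero (map var vs) j (Suc q) p"
  shows "koszul_zero (map var vs) j q (Suc p)"
  unfolding koszul_zero_def
proof (intro allI impI)
  let ?ys = "map var vs :: ('v, 'k) mpoly list"
  fix Z
  assume Z: "\<forall>bs. length bs = length ?ys \<longrightarrow> Z bs \<in> im q"
    and hZ: "\<forall>bs k. homogeneous (j - int (Suc p) - g q k) (Z bs k)"
    and sZ: "\<forall>bs. count_list bs True \<noteq> Suc p \<longrightarrow> Z bs = (\<lambda>_. 0)"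
    and kZ: "\<forall>bs k. length bs = length ?ys \<longrightarrow> kd ?ys (\<lambda>b. Z b k) bs = 0"
  have lin: "linear_forms ?ys" by (auto simp: homogeneous_var)
  have "\<exists>u\<in>free_mod (r (Suc q)). (\<forall>c. homogeneous (j - int (Suc p) - g (Suc q) c) (u c)) \<and>
    (length bs = length ?ys \<longrightarrow> dl q u = Z bs) \<and> (count_list bs True \<noteq> Suc p \<longrightarrow> u = (\<lambda>_. 0))" for bs
  proof (cases "length bs = length ?ys \<and> count_list bs True = Suc p")
    case True
    then obtain u where "u\<in>free_mod (r (Suc q))" "dl q u = Z bs"
      "\<forall>c. homogeneous (j - int (Suc p) - g (Suc q) c) (u c)"
      using homogeneous_lift[of "Z bs" q "j - int (Suc p)"] Z hZ by blast
    then show ?thesis using True by blast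
  next
    case False
    then show ?thesis using sZ by (intro bexI[of _ "\<lambda>_. 0"]) (auto simp: free_mod_def)
  qed
  then obtain U where U: "\<And>bs. U bs \<in> free_mod (r (Suc q))"
    "\<And>bs c. homogeneous (j - int (Suc p) - g (Suc q) c) (U bs c)"
    "\<And>bs. length bs = length ?ys \<Longrightarrow> dl q (U bs) = Z bs"
    "\<And>bs. count_list bs True \<noteq> Suc p \<Longrightarrow> U bs = (\<lambda>_. 0)"
    by metis
  have Upart: "(\<lambda>b. U b c) = kpart (Suc p) (\<lambda>b. U b c)" for c
    using U(4) by (auto simp: kpart_def)
  define Z2 where "Z2 = (\<lambda>bs c. kd ?ys (\<lambda>b. U b c) bs)"
  have Z2im: "Z2 bs \<in> im (Suc q)" if bs: "length bs = length ?ys" for bs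
    unfolding im_kernel
  proof
    show "Z2 bs \<in> free_mod (r (Suc q))" using U(1) by (simp add: free_mod_def Z2_def)
    show "dl q (Z2 bs) = (\<lambda>_. 0)"
    proof
      fix k
      have "dl q (Z2 bs) k = kd ?ys (\<lambda>b. dl q (U b) k) bs" unfolding Z2_def mat_map_kd ..
      also have "\<dots> = kd ?ys (\<lambda>b. Z b k) bs" by (rule kd_cong[OF _ bs]) (simp add: U(3))
      finally show "dl q (Z2 bs) k = 0" using kZ bs by simp
    qed
  qed
  have "\<exists>W. (\<forall>bs. length bs = length ?ys \<longrightarrow> W bs \<in> im (Suc q)) \<and>
       (\<forall>bs k. length bs = length ?ys \<longrightarrow> count_list bs True = p \<longrightarrow> Z2 bs k = kd ?ys (\<lambda>b. W b k) bs)"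
  proof (rule V[unfolded koszul_zero_def, rule_format])
    show "Z2 bs \<in> im (Suc q)" if "length bs = length ?ys" for bs by (rule Z2im[OF that])
    show "homogeneous (j - int p - g (Suc q) k) (Z2 bs k)" for bs k
      unfolding Z2_def using U(2)[of k] by (intro homogeneous_kd[OF lin]) (simp add: algebra_simps)
    show "Z2 bs = (\<lambda>_. 0)" if "count_list bs True \<noteq> p" for bs
    proof
      fix c show "Z2 bs c = 0"
        unfolding Z2_def by (subst Upart) (use that in \<open>simp add: kd_kpart, simp add: kpart_def\<close>)
    qed
    show "kd ?ys (\<lambda>b. Z2 b k) bs = 0" for bs k unfolding Z2_def by (rule kd_kd)
    show "const_coeff (Z2 (kzero ?ys) k) = 0" for k
    proof -
      have "Z2 (kzero ?ys) k \<in> vars_ideal (set vs)"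
        unfolding Z2_def koszul_gen_vars[symmetric] by (rule koszul_genI)
      then have "0 \<notin> ks (Z2 (kzero ?ys) k)" unfolding vars_ideal_def by auto
      then show ?thesis by (simp add: const_coeff_def in_keys_iff)
    qed
  qed
  then obtain W where W: "\<And>bs. length bs = length ?ys \<Longrightarrow> W bs \<in> im (Suc q)"
    "\<And>bs k. length bs = length ?ys \<Longrightarrow> count_list bs True = p \<Longrightarrow> Z2 bs k = kd ?ys (\<lambda>b. W b k) bs"
    by blast
  \<comment> \<open>The equation for \<open>W\<close> holds only in homological degree
    \<open>p\<close>, so its component in degree \<open>Suc p\<close> is used. The difference to the
    lift \<open>U\<close> is a cycle with coefficients in the free module and hence bounds
    there.\<close>
  define X where "X = (\<lambda>c b. U b c - kpart (Suc p) (\<lambda>b. W b c) b)"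
  have "\<exists>Y. \<forall>bs. length bs = length ?ys \<longrightarrow> X c bs = kd ?ys Y bs" for c
  proof -
    have "kd ?ys (X c) bs = 0" if "length bs = length ?ys" for bs
    proof -
      have "kd ?ys (\<lambda>b. U b c) bs = kpart p (kd ?ys (\<lambda>b. U b c)) bs" by (subst Upart) (rule kd_kpart)
      then have "kd ?ys (X c) bs = kpart p (kd ?ys (\<lambda>b. U b c)) bs - kpart p (kd ?ys (\<lambda>b. W b c)) bs"
        unfolding X_def kd_diff kd_kpart by simp
      then show ?thesis
        using W(2)[OF that, of c] by (cases "count_list bs True = p") (simp_all add: kpart_def Z2_def)
    qed
    moreover have "X c (kzero ?ys) = 0" using U(4)[of "kzero ?ys"] by (simp add: X_def)
    ultimately show ?thesis
      using koszul_exact_vars[OF vs] ideal_zero[OF is_ideal_koszul_gen] unfolding koszul_exact_def by metis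
  qed
  then obtain Y0 where Y0: "\<And>c bs. length bs = length ?ys \<Longrightarrow> X c bs = kd ?ys (Y0 c) bs" by metis
  define Y where "Y = (\<lambda>b c. if c < r (Suc q) then Y0 c b else 0)"
  have Yfree: "Y b \<in> free_mod (r (Suc q))" for b by (simp add: Y_def free_mod_def)
  have "Z bs k = kd ?ys (\<lambda>b. dl q (Y b) k) bs" if bs: "length bs = length ?ys" for bs k
  proof -
    have WW: "W bs \<in> free_mod (r (Suc q))" "dl q (W bs) = (\<lambda>_. 0)" using W(1)[OF bs] im_kernel by auto
    have "(\<lambda>c. kd ?ys (\<lambda>b. Y b c) bs) = (\<lambda>c. X c bs)"
    proof
      fix c show "kd ?ys (\<lambda>b. Y b c) bs = X c bs"
      proof (cases "c < r (Suc q)")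
        case True then show ?thesis using Y0[OF bs, of c] by (simp add: Y_def)
      next
        case False then show ?thesis using WW(1) U(1)[of bs] by (simp add: Y_def X_def free_mod_def kpart_def)
      qed
    qed
    moreover have "dl q (\<lambda>c. kpart (Suc p) (\<lambda>b. W b c) bs) = (\<lambda>_. 0)"
      using WW(2) by (cases "count_list bs True = Suc p") (simp_all add: kpart_def)
    then have "dl q (\<lambda>c. X c bs) = Z bs" using U(3)[OF bs] by (simp add: X_def mat_map_diff)
    ultimately show ?thesis unfolding mat_map_kd[symmetric] by simp
  qed
  then show "\<exists>W. (\<forall>bs. length bs = length ?ys \<longrightarrow> W bs \<in> im q) \<and>
       (\<forall>bs k. length bs = length ?ys \<longrightarrow> count_list bs True = Suc p \<longrightarrow> Z bs k = kd ?ys (\<lambda>b. W b k) bs)"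
    using Yfree by (intro exI[of _ "\<lambda>b. dl q (Y b)"]) auto
qed

lemma tor_zero_imp_koszul_zero:
  assumes vs: "distinct vs" "set vs = UNIV" and T: "tor_zero i j"
  shows "koszul_zero (map var vs) j 0 i"
proof -
  have "p \<le> i \<Longrightarrow> koszul_zero (map var vs) j (i - p) p" for p
  proof (induct p)
    case 0 then show ?case using koszul_zero_base[OF vs(2) T] by simp
  next
    case (Suc p)
    then have "koszul_zero (map var vs) j (Suc (i - Suc p)) p" by (simp add: Suc_diff_Suc)
    then show ?case by (rule koszul_zero_step[OF vs(1)])
  qed
  from this[of i] show ?thesis by simp
qed

end

section \<open>The resolution of an ideal with the ring as module of index 0\<close>

definition aug_rank where "aug_rank F q = (case q of 0 \<Rightarrow> 1 | Suc i \<Rightarrow> frank F i)"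
definition aug_deg where "aug_deg F q = (case q of 0 \<Rightarrow> (\<lambda>_. 0) | Suc i \<Rightarrow> fdeg F i)"
definition aug_mat where "aug_mat F q = (case q of 0 \<Rightarrow> (\<lambda>_ c. faug F c) | Suc i \<Rightarrow> fdiff F i)"

lemma aug_simps [simp]:
  "aug_rank F 0 = 1" "aug_rank F (Suc i) = frank F i"
  "aug_deg F 0 = (\<lambda>_. 0)" "aug_deg F (Suc i) = fdeg F i"
  "aug_mat F 0 = (\<lambda>_ c. faug F c)" "aug_mat F (Suc i) = fdiff F i"
  by (simp_all add: aug_rank_def aug_deg_def aug_mat_def)

lemma mat_map_aug: "mat_map (Suc 0) (frank F 0) (\<lambda>_ c. faug F c) v = (\<lambda>k. if k = 0 then aug_map F v else 0)"
  by (rule ext) (simp add: mat_map_def aug_map_def)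

lemma graded_exact_resolution:
  fixes F :: "('v::finite, 'k::field) mpoly graded_free"
  assumes "graded_free_resolution F I"
  shows "graded_exact (aug_rank F) (aug_deg F) (aug_mat F)"
proof
  fix k q c assume "k < aug_rank F q" "c < aug_rank F (Suc q)"
  then show "homogeneous (aug_deg F (Suc q) c - aug_deg F q k) (aug_mat F q k c)"
    using assms unfolding graded_free_resolution_def by (cases q) auto
next
  fix q
  show "{v \<in> free_mod (aug_rank F (Suc q)). mat_map (aug_rank F q) (aug_rank F (Suc q)) (aug_mat F q) v = (\<lambda>_. 0)} =
    mat_map (aug_rank F (Suc q)) (aug_rank F (Suc (Suc q))) (aug_mat F (Suc q)) ` free_mod (aug_rank F (Suc (Suc q)))"
  proof (cases q)
    case 0
    have "mat_map (Suc 0) (frank F 0) (\<lambda>_ c. faug F c) v = (\<lambda>_. 0) \<longleftrightarrow> aug_map F v = 0" for v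
      unfolding mat_map_aug by (auto simp: fun_eq_iff)
    then show ?thesis using 0 assms unfolding graded_free_resolution_def diff_map_def by simp
  next
    case (Suc i)
    then show ?thesis using assms unfolding graded_free_resolution_def diff_map_def by simp
  qed
qed

lemma tor_zero_resolution:
  assumes "graded_free_resolution F I" "tor_cycles F i j = tor_boundaries F i j"
  shows "graded_exact.tor_zero (aug_rank F) (aug_deg F) (aug_mat F) i j"
  unfolding graded_exact.tor_zero_def[OF graded_exact_resolution[OF assms(1)]]
proof (intro ballI impI)
  fix w
  assume w: "w \<in> {w \<in> free_mod (aug_rank F (Suc i)). \<forall>k. w k \<noteq> 0 \<longrightarrow> aug_deg F (Suc i) k = j}"
    and z: "mat_map (aug_rank F i) (aug_rank F (Suc i)) (\<lambda>k c. const_coeff (aug_mat F i k c)) w = (\<lambda>_. 0)"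
  have "w \<in> tor_cycles F i j"
    using w z unfolding tor_cycles_def tensor_strand_def tensor_diff_def by auto
  then show "\<exists>w'\<in>{w \<in> free_mod (aug_rank F (Suc (Suc i))). \<forall>k. w k \<noteq> 0 \<longrightarrow> aug_deg F (Suc (Suc i)) k = j}.
      w = mat_map (aug_rank F (Suc i)) (aug_rank F (Suc (Suc i))) (\<lambda>k c. const_coeff (aug_mat F (Suc i) k c)) w'"
    unfolding assms(2) tor_boundaries_def tensor_strand_def tensor_diff_def by auto
qed

lemma resolution_image:
  assumes "graded_free_resolution F I"
  shows "mat_map (aug_rank F 0) (aug_rank F (Suc 0)) (aug_mat F 0) ` free_mod (aug_rank F (Suc 0)) =
    (\<lambda>p k. if k = 0 then p else 0) ` I"
proof -
  have I: "I = aug_map F ` free_mod (frank F 0)" using assms unfolding graded_free_resolution_def by simp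
  show ?thesis unfolding I aug_simps One_nat_def mat_map_aug image_image ..
qed

text \<open>Koszul homology of the module \<open>I\<close> itself: cycles vanish exactly and
  bounding chains have coefficients in \<open>I\<close>. This is the form in which Tor of
  \<open>I\<close> arrives.\<close>

definition ideal_koszul_exact where
  "ideal_koszul_exact ys I c \<longleftrightarrow> (\<forall>z d. c \<le> d \<longrightarrow> (\<forall>bs. homogeneous d (z bs)) \<longrightarrow>
     (\<forall>bs. length bs = length ys \<longrightarrow> z bs \<in> I) \<longrightarrow> (\<forall>bs. length bs = length ys \<longrightarrow> kd ys z bs = 0) \<longrightarrow>
     (\<exists>w. \<forall>bs. length bs = length ys \<longrightarrow> w bs \<in> I \<and> z bs = kd ys w bs))"

lemma tor_vanishes_part:
  fixes I :: "('v::finite, 'k::field) mpoly set"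
  assumes vs: "distinct vs" "set vs = UNIV" and T: "tor_vanishes I i (d + int i)" and d: "0 < d"
    and z: "\<And>bs. homogeneous d (z bs)" "\<And>bs. length bs = length vs \<Longrightarrow> z bs \<in> I"
    and zero: "0 \<in> I"
    and cyc: "\<And>bs. length bs = length vs \<Longrightarrow> kd (map var vs) z bs = 0"
  shows "\<exists>w. (\<forall>bs. length bs = length vs \<longrightarrow> w bs \<in> I) \<and>
    (\<forall>bs. length bs = length vs \<longrightarrow> count_list bs True = i \<longrightarrow> z bs = kd (map var vs) w bs)"
proof -
  obtain F where F: "graded_free_resolution F I" "tor_cycles F i (d + int i) = tor_boundaries F i (d + int i)"
    using T unfolding tor_vanishes_def by blast
  interpret graded_exact "aug_rank F" "aug_deg F" "aug_mat F" by (rule graded_exact_resolution[OF F(1)])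
  note im = resolution_image[OF F(1)]
  define Z where "Z = (\<lambda>bs (k::nat). if k = 0 then kpart i z bs else 0)"
  have cyc': "kd (map var vs) (kpart i z) bs = 0" if "length bs = length vs" for bs
    using cyc[OF that] by (cases i) (simp_all add: kd_kpart, simp add: kpart_def)
  have "\<exists>W. (\<forall>bs. length bs = length (map var vs :: ('v, 'k) mpoly list) \<longrightarrow> W bs \<in> im 0) \<and>
    (\<forall>bs k. length bs = length (map var vs :: ('v, 'k) mpoly list) \<longrightarrow> count_list bs True = i \<longrightarrow>
      Z bs k = kd (map var vs) (\<lambda>b. W b k) bs)"
  proof (rule tor_zero_imp_koszul_zero[OF vs tor_zero_resolution[OF F], unfolded koszul_zero_def, rule_format])
    show "Z bs \<in> im 0" if "length bs = length (map var vs :: ('v, 'k) mpoly list)" for bs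
      unfolding im Z_def using z(2)[of bs] that zero by (auto simp: kpart_def)
    show "homogeneous (d + int i - int i - aug_deg F 0 k) (Z bs k)" for bs k
      using z(1) by (simp add: Z_def kpart_def)
    show "Z bs = (\<lambda>_. 0)" if "count_list bs True \<noteq> i" for bs
      using that by (auto simp: Z_def kpart_def)
    show "kd (map var vs) (\<lambda>b. Z b k) bs = 0" if "length bs = length (map var vs :: ('v, 'k) mpoly list)" for bs k
      using cyc' that by (cases "k = 0") (auto simp: Z_def)
    show "const_coeff (Z (kzero (map var vs :: ('v, 'k) mpoly list)) k) = 0" for k
      using const_coeff_homogeneous[OF z(1)] d by (simp add: Z_def kpart_def)
  qed
  then obtain W where W: "\<And>bs. length bs = length vs \<Longrightarrow> W bs \<in> (\<lambda>p k. if k = 0 then p else 0) ` I"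
    "\<And>bs k. length bs = length vs \<Longrightarrow> count_list bs True = i \<Longrightarrow> Z bs k = kd (map var vs) (\<lambda>b. W b k) bs"
    unfolding im by auto
  have "z bs = kd (map var vs) (\<lambda>b. W b 0) bs" if "length bs = length vs" "count_list bs True = i" for bs
    using W(2)[OF that, of 0] that by (simp add: Z_def kpart_def)
  moreover have "W bs 0 \<in> I" if "length bs = length vs" for bs using W(1)[OF that] by auto
  ultimately show ?thesis by (intro exI[of _ "\<lambda>b. W b 0"]) blast
qed

lemma tor_vanishes_imp_ideal_koszul_exact:
  fixes I :: "('v::finite, 'k::field) mpoly set"
  assumes vs: "distinct vs" "set vs = UNIV" and c: "0 < c" and I: "is_ideal I"
    and T: "\<And>i d. c \<le> d \<Longrightarrow> tor_vanishes I i (d + int i)"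
  shows "ideal_koszul_exact (map var vs) I c"
  unfolding ideal_koszul_exact_def
proof (intro allI impI)
  let ?ys = "map var vs :: ('v, 'k) mpoly list"
  fix z d assume d: "c \<le> d" and z: "\<forall>bs. homogeneous d (z bs)"
    "\<forall>bs. length bs = length ?ys \<longrightarrow> z bs \<in> I" "\<forall>bs. length bs = length ?ys \<longrightarrow> kd ?ys z bs = 0"
  have "\<exists>w. (\<forall>bs. length bs = length vs \<longrightarrow> w bs \<in> I) \<and>
    (\<forall>bs. length bs = length vs \<longrightarrow> count_list bs True = i \<longrightarrow> z bs = kd ?ys w bs)" for i
    using tor_vanishes_part[OF vs T[OF d]] d c z ideal_zero[OF I] by simp
  then obtain w where w: "\<And>i bs. length bs = length vs \<Longrightarrow> w i bs \<in> I"
    "\<And>i bs. length bs = length vs \<Longrightarrow> count_list bs True = i \<Longrightarrow> z bs = kd ?ys (w i) bs" by metis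
  \<comment> \<open>The chains \<open>w i\<close> may stem from unrelated resolutions. Each settles
    homological degree \<open>i\<close> only, and to that degree only its component in degree
    \<open>Suc i\<close> contributes, so these components can be added.\<close>
  define W where "W = (\<lambda>b. \<Sum>i\<le>length vs. kpart (Suc i) (w i) b)"
  have "z bs = kd ?ys W bs" if bs: "length bs = length vs" for bs
  proof -
    have "count_list bs True \<le> length vs" using count_le_length[of bs True] bs by simp
    moreover have "kd ?ys W bs = (\<Sum>i\<le>length vs. if i = count_list bs True then kd ?ys (w i) bs else 0)"
      unfolding W_def kd_sum kd_kpart by (rule sum.cong) (auto simp: kpart_def)
    ultimately show ?thesis using w(2)[OF bs] by simp
  qed
  moreover have "W bs \<in> I" if "length bs = length vs" for bs
    unfolding W_def using w(1)[OF that] ideal_zero[OF I] by (intro ideal_sum[OF I]) (simp add: kpart_def)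
  ultimately show "\<exists>w. \<forall>bs. length bs = length ?ys \<longrightarrow> w bs \<in> I \<and> z bs = kd ?ys w bs"
    by (intro exI[of _ W]) simp
qed

lemma koszul_exactD:
  assumes "koszul_exact ys" "\<And>bs. length bs = length ys \<Longrightarrow> kd ys z bs = 0" "z (kzero ys) \<in> koszul_gen ys"
  shows "\<exists>w. \<forall>bs. length bs = length ys \<longrightarrow> z bs = kd ys w bs"
  using assms unfolding koszul_exact_def by blast

lemma homogeneous_in_koszul_gen_vars:
  fixes p :: "('v, 'k::comm_ring_1) mpoly"
  assumes "set vs = UNIV" "homogeneous d p" "0 < d" shows "p \<in> koszul_gen (map var vs)"
  using const_coeff_homogeneous[OF assms(2)] assms by (simp add: koszul_gen_vars vars_ideal_UNIV)

text \<open>The connecting map of 0 -> I -> S -> S/I -> 0 lowers the homological degree and raises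
  the coefficient degree by one. It loses nothing because the homology of S consists of constants,
  which \<open>c > 0\<close> keeps away.\<close>

lemma ideal_koszul_exact_iff:
  fixes I :: "('v::finite, 'k::field) mpoly set"
  assumes vs: "distinct vs" "set vs = UNIV" and c: "0 < c" and gr: "graded_ideal I"
  shows "ideal_koszul_exact (map var vs) I (c + 1) \<longleftrightarrow> koszul_vanishes (map var vs) I c"
proof
  let ?ys = "map var vs :: ('v, 'k) mpoly list"
  have lin: "linear_forms ?ys" by (auto simp: homogeneous_var)
  note I = graded_idealD(1)[OF gr]
  note ex = koszul_exactD[OF koszul_exact_vars[OF vs(1)]]
  {
    assume E: "ideal_koszul_exact ?ys I (c + 1)"
    show "koszul_vanishes ?ys I c"
      unfolding koszul_vanishes_def
    proof (intro allI impI)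
      fix z d assume d: "c \<le> d" and z: "\<forall>bs. homogeneous d (z bs)" and cyc: "koszul_cycle ?ys I z"
      have hk: "homogeneous (d + 1) (kd ?ys z bs)" for bs using z by (intro homogeneous_kd[OF lin]) simp
      have "\<exists>w. \<forall>bs. length bs = length ?ys \<longrightarrow> w bs \<in> I \<and> kd ?ys z bs = kd ?ys w bs"
        using cyc d hk by (intro E[unfolded ideal_koszul_exact_def, rule_format, of "d + 1" "kd ?ys z"])
          (auto simp: koszul_cycle_def kd_kd)
      then obtain w where w: "\<And>bs. length bs = length ?ys \<Longrightarrow> w bs \<in> I \<and> kd ?ys z bs = kd ?ys w bs"
        by blast
      define w' where "w' = (\<lambda>bs. hcomp d (w bs))"
      have w': "w' bs \<in> I" if "length bs = length ?ys" for bs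
        unfolding w'_def using graded_idealD(2)[OF gr] w[OF that] by blast
      have "kd ?ys (\<lambda>c. z c - w' c) bs = 0" if bs: "length bs = length ?ys" for bs
      proof -
        have "kd ?ys w' bs = hcomp (d + 1) (kd ?ys w bs)" by (simp add: hcomp_kd[OF lin] w'_def)
        also have "\<dots> = kd ?ys z bs"
          using w[OF bs] hcomp_homogeneous[OF hk[of bs]] by metis
        finally show ?thesis by (simp add: kd_diff)
      qed
      moreover have "homogeneous d (z bs - w' bs)" for bs
        using z homogeneous_hcomp by (auto simp: w'_def intro: homogeneous_diff)
      ultimately obtain u where "\<And>bs. length bs = length ?ys \<Longrightarrow> z bs - w' bs = kd ?ys u bs"
        using ex[of "\<lambda>c. z c - w' c"] homogeneous_in_koszul_gen_vars[OF vs(2)] d c by fastforce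
      then have "z bs - kd ?ys u bs \<in> I" if "length bs = length ?ys" for bs
        using w'[OF that] that by (metis diff_diff_eq2 add_diff_cancel_left')
      then show "koszul_boundary ?ys I z" unfolding koszul_boundary_def by blast
    qed
  next
    assume V: "koszul_vanishes ?ys I c"
    show "ideal_koszul_exact ?ys I (c + 1)"
      unfolding ideal_koszul_exact_def
    proof (intro allI impI)
      fix z d assume d: "c + 1 \<le> d" and z: "\<forall>bs. homogeneous d (z bs)"
        and zI: "\<forall>bs. length bs = length ?ys \<longrightarrow> z bs \<in> I"
        and cyc: "\<forall>bs. length bs = length ?ys \<longrightarrow> kd ?ys z bs = 0"
      obtain u where u: "\<And>bs. length bs = length ?ys \<Longrightarrow> z bs = kd ?ys u bs"
        using ex[of z] cyc homogeneous_in_koszul_gen_vars[OF vs(2) z[rule_format]] d c by force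
      define u' where "u' = (\<lambda>bs. hcomp (d - 1) (u bs))"
      have u': "z bs = kd ?ys u' bs" if "length bs = length ?ys" for bs
        using u[OF that] hcomp_kd[OF lin, of d u bs] hcomp_homogeneous[OF z[rule_format, of bs]]
        unfolding u'_def by metis
      have "koszul_boundary ?ys I u'"
        using d u' zI by (intro koszul_vanishesD[OF V, of "d - 1"])
          (auto simp: u'_def homogeneous_hcomp koszul_cycle_def)
      then obtain w where w: "\<And>bs. length bs = length ?ys \<Longrightarrow> u' bs - kd ?ys w bs \<in> I"
        unfolding koszul_boundary_def by blast
      show "\<exists>w. \<forall>bs. length bs = length ?ys \<longrightarrow> w bs \<in> I \<and> z bs = kd ?ys w bs"
        using w u' by (intro exI[of _ "\<lambda>c. u' c - kd ?ys w c"]) (simp add: kd_diff kd_kd)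
    qed
  }
qed

section \<open>Construction of linear resolutions\<close>

definition is_submodule :: "(nat \<Rightarrow> 'r::comm_ring_1) set \<Rightarrow> bool" where
  "is_submodule M \<longleftrightarrow> (\<lambda>_. 0) \<in> M \<and> (\<forall>u\<in>M. \<forall>v\<in>M. (\<lambda>k. u k + v k) \<in> M) \<and>
     (\<forall>p. \<forall>v\<in>M. (\<lambda>k. p * v k) \<in> M)"

lemma submodule_zero: "is_submodule M \<Longrightarrow> (\<lambda>_. 0) \<in> M"
  and submodule_add: "is_submodule M \<Longrightarrow> u \<in> M \<Longrightarrow> v \<in> M \<Longrightarrow> (\<lambda>k. u k + v k) \<in> M"
  and submodule_mult: "is_submodule M \<Longrightarrow> v \<in> M \<Longrightarrow> (\<lambda>k. p * v k) \<in> M"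
  by (auto simp: is_submodule_def)

lemma submodule_sum:
  assumes "is_submodule M" "\<And>i. i \<in> X \<Longrightarrow> f i \<in> M"
  shows "(\<lambda>k. \<Sum>i\<in>X. f i k) \<in> M"
  using assms(2)
proof (induct X rule: infinite_finite_induct)
  case (insert x X)
  then show ?case using submodule_add[OF assms(1), of "f x" "\<lambda>k. \<Sum>i\<in>X. f i k"] by simp
qed (simp_all add: submodule_zero[OF assms(1)])

lemma submodule_kd_kzero:
  assumes M: "is_submodule M" and W: "\<And>b. length b = length ys \<Longrightarrow> W b \<in> M"
  shows "(\<lambda>k. kd ys (\<lambda>b. W b k) (kzero ys)) \<in> M"
  using W
proof (induct ys arbitrary: W)
  case Nil then show ?case using submodule_zero[OF M] by simp
next
  case (Cons y ys)
  have "(\<lambda>k. kd ys (\<lambda>b. W (False # b) k) (kzero ys)) \<in> M"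
    by (rule Cons.hyps) (simp add: Cons.prems)
  moreover have "(\<lambda>k. y * W (True # kzero ys) k) \<in> M"
    by (rule submodule_mult[OF M]) (simp add: Cons.prems)
  ultimately show ?case using submodule_add[OF M] by simp
qed

text \<open>
  A graded submodule $Z$ of a free module on generators of degree 0 that lives in degrees at least
  \<open>e\<close> and whose Koszul homology $H_i$ vanishes in degrees greater than $i + e$.
\<close>

definition koszul_linear ::
  "'v list \<Rightarrow> nat \<Rightarrow> int \<Rightarrow> (nat \<Rightarrow> ('v, 'k::field) mpoly) set \<Rightarrow> bool" where
  "koszul_linear vs n e Z \<longleftrightarrow> Z \<subseteq> free_mod n \<and> is_submodule Z \<and>
     (\<forall>v\<in>Z. \<forall>d. (\<lambda>k. hcomp d (v k)) \<in> Z) \<and>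
     (\<forall>v\<in>Z. \<forall>k d. d < e \<longrightarrow> hcomp d (v k) = 0) \<and>
     (\<forall>C d. e < d \<longrightarrow> (\<forall>bs. length bs = length vs \<longrightarrow> C bs \<in> Z) \<longrightarrow>
       (\<forall>bs k. homogeneous d (C bs k)) \<longrightarrow>
       (\<forall>bs k. length bs = length vs \<longrightarrow> kd (map var vs) (\<lambda>b. C b k) bs = 0) \<longrightarrow>
       (\<exists>W. \<forall>bs. length bs = length vs \<longrightarrow>
          W bs \<in> Z \<and> (\<forall>k. C bs k = kd (map var vs) (\<lambda>b. W b k) bs)))"

text \<open>Vanishing of H_0 in degrees above \<open>e\<close> writes a homogeneous element of
  higher degree as a combination of variables with coefficients in \<open>Z\<close> of degree one
  less; induction descends to degree \<open>e\<close>.\<close>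

lemma koszul_linear_generated:
  fixes Z :: "(nat \<Rightarrow> ('v::finite, 'k::field) mpoly) set"
  assumes Z: "koszul_linear vs n e Z" and M: "is_submodule M"
    and low: "\<And>v. v \<in> Z \<Longrightarrow> (\<And>k. homogeneous e (v k)) \<Longrightarrow> v \<in> M"
  shows "Z \<subseteq> M"
proof -
  let ?ys = "map var vs :: ('v, 'k) mpoly list"
  have lin: "linear_forms ?ys" by (auto simp: homogeneous_var)
  note Zd = Z[unfolded koszul_linear_def]
  have "v \<in> M" if "v \<in> Z" "\<And>k. homogeneous (e + int t) (v k)" for v t
    using that
  proof (induct t arbitrary: v)
    case 0 then show ?case using low by simp
  next
    case (Suc t)
    define C where "C = (\<lambda>bs k. if bs = kzero ?ys then v k else 0)"
    have "\<exists>W. \<forall>bs. length bs = length vs \<longrightarrow> W bs \<in> Z \<and> (\<forall>k. C bs k = kd ?ys (\<lambda>b. W b k) bs)"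
    proof (rule Zd[THEN conjunct2, THEN conjunct2, THEN conjunct2, THEN conjunct2, rule_format])
      show "e < e + int (Suc t)" by simp
      show "C bs \<in> Z" for bs
        using Suc.prems(1) submodule_zero[of Z] Zd by (cases "bs = kzero ?ys") (auto simp: C_def)
      show "homogeneous (e + int (Suc t)) (C bs k)" for bs k
        using Suc.prems(2) by (simp add: C_def)
      show "kd ?ys (\<lambda>b. C b k) bs = 0" if "length bs = length vs" for bs k
        unfolding C_def by (rule kd_unit_chain) (simp add: that)
    qed
    then obtain W where W: "\<And>bs. length bs = length vs \<Longrightarrow> W bs \<in> Z"
      "\<And>bs k. length bs = length vs \<Longrightarrow> C bs k = kd ?ys (\<lambda>b. W b k) bs" by blast
    define W' where "W' = (\<lambda>b k. hcomp (e + int t) (W b k))"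
    have "W' b \<in> M" if "length b = length ?ys" for b
      unfolding W'_def using W(1)[of b] Zd homogeneous_hcomp that by (intro Suc.hyps) auto
    then have "(\<lambda>k. kd ?ys (\<lambda>b. W' b k) (kzero ?ys)) \<in> M" by (rule submodule_kd_kzero[OF M])
    moreover have "kd ?ys (\<lambda>b. W' b k) (kzero ?ys) = v k" for k
    proof -
      have "v k = kd ?ys (\<lambda>b. W b k) (kzero ?ys)" using W(2)[of "kzero ?ys" k] by (simp add: C_def)
      then have "v k = hcomp (e + int (Suc t)) (kd ?ys (\<lambda>b. W b k) (kzero ?ys))"
        using hcomp_homogeneous[OF Suc.prems(2), of k] by simp
      also have "\<dots> = kd ?ys (\<lambda>b. W' b k) (kzero ?ys)"
        unfolding hcomp_kd[OF lin] by (simp add: W'_def)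
      finally show ?thesis ..
    qed
    ultimately show ?case by simp
  qed
  then have hc: "(\<lambda>k. hcomp d (v k)) \<in> M" if v: "v \<in> Z" for v d
  proof (cases "e \<le> d")
    case True
    then have "d = e + int (nat (d - e))" by simp
    then show ?thesis using \<open>\<And>v t. \<lbrakk>v \<in> Z; \<And>k. homogeneous (e + int t) (v k)\<rbrakk> \<Longrightarrow> v \<in> M\<close> Zd v homogeneous_hcomp
      by metis
  next
    case False
    then have "(\<lambda>k. hcomp d (v k)) = (\<lambda>_. 0)" using Zd v by auto
    then show ?thesis using submodule_zero[OF M] by simp
  qed
  show ?thesis
  proof
    fix v assume v: "v \<in> Z"
    then have vn: "v k = 0" if "n \<le> k" for k using Zd that by (auto simp: free_mod_def)
    \<comment> \<open>The degrees occurring in any of the components, so that one finite sum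
      decomposes the whole vector.\<close>
    define D where "D = (\<Union>k<n. (\<lambda>m. int (monom_degree m)) ` ks (v k))"
    have "v k = (\<Sum>d\<in>D. hcomp d (v k))" for k
    proof (cases "k < n")
      case True
      have "(\<Sum>d\<in>(\<lambda>m. int (monom_degree m)) ` ks (v k). hcomp d (v k)) = (\<Sum>d\<in>D. hcomp d (v k))"
      proof (rule sum.mono_neutral_left)
        show "finite D" "(\<lambda>m. int (monom_degree m)) ` ks (v k) \<subseteq> D" using True by (auto simp: D_def)
        show "\<forall>d\<in>D - (\<lambda>m. int (monom_degree m)) ` ks (v k). hcomp d (v k) = 0"
          by (intro ballI hcomp_eq_0) blast
      qed
      then show ?thesis using sum_hcomp[of "v k"] by simp
    qed (simp add: vn)
    moreover have "(\<lambda>k. \<Sum>d\<in>D. hcomp d (v k)) \<in> M" by (rule submodule_sum[OF M]) (rule hc[OF v])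
    ultimately show "v \<in> M" by presburger
  qed
qed

text \<open>Restriction of scalars to the field, so that bases of graded pieces can be chosen by
  linear algebra.\<close>

definition vscale :: "'k \<Rightarrow> (nat \<Rightarrow> ('v, 'k::field) mpoly) \<Rightarrow> nat \<Rightarrow> ('v, 'k) mpoly" where
  "vscale c v = (\<lambda>k. sgl 0 c * v k)"

lemma vector_space_vscale: "vector_space (vscale :: 'k::field \<Rightarrow> (nat \<Rightarrow> ('v, 'k) mpoly) \<Rightarrow> _)"
  by unfold_locales (auto simp: vscale_def fun_eq_iff distrib_left distrib_right single_add
      mult.assoc[symmetric] mult_single)

lemma sum_fun_apply: "(\<Sum>i\<in>X. f i) k = (\<Sum>i\<in>X. f i k :: 'a::comm_monoid_add)"
  by (induct X rule: infinite_finite_induct) auto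

lemma finite_monoms_degree: "finite {m :: 'v::finite monom. monom_degree m = d}"
proof -
  have "lkp m x \<le> monom_degree m" for m :: "'v monom" and x
    unfolding monom_degree_eq_sum by (intro member_le_sum) auto
  then have "lkp ` {m :: 'v monom. monom_degree m = d} \<subseteq>
      {f. \<forall>x. (x \<in> UNIV \<longrightarrow> f x \<in> {..d}) \<and> (x \<notin> UNIV \<longrightarrow> f x = 0)}" by auto
  then have "finite (lkp ` {m :: 'v monom. monom_degree m = d})"
    by (rule finite_subset) (intro finite_set_of_finite_funs; simp)
  moreover have "inj_on lkp {m :: 'v monom. monom_degree m = d}"
    by (intro inj_onI poly_mapping_eqI) simp
  ultimately show ?thesis by (rule finite_imageD)
qed

lemma finite_dim_homogeneous:
  fixes V :: "(nat \<Rightarrow> ('v::finite, 'k::field) mpoly) set"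
  assumes V: "V \<subseteq> free_mod n" "\<forall>v\<in>V. \<forall>k. homogeneous e (v k)"
  shows "\<exists>T. finite T \<and> V \<subseteq> module.span vscale T"
proof -
  interpret vs: vector_space "vscale :: 'k \<Rightarrow> (nat \<Rightarrow> ('v, 'k) mpoly) \<Rightarrow> _" by (rule vector_space_vscale)
  define mons where "mons = {m :: 'v monom. monom_degree m = nat e}"
  define u :: "nat \<times> 'v monom \<Rightarrow> nat \<Rightarrow> ('v, 'k) mpoly"
    where "u = (\<lambda>(k, m) k'. if k' = k then sgl m 1 else 0)"
  define T where "T = u ` ({..<n} \<times> mons)"
  have fin: "finite mons" unfolding mons_def by (rule finite_monoms_degree)
  have "v \<in> vs.span T" if v: "v \<in> V" for v
  proof -
    have "v = (\<Sum>(k, m)\<in>{..<n} \<times> mons. vscale (lkp (v k) m) (u (k, m)))"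
    proof
      fix k'
      have "(\<Sum>(k, m)\<in>{..<n} \<times> mons. vscale (lkp (v k) m) (u (k, m))) k' =
        (\<Sum>k<n. \<Sum>m\<in>mons. if k' = k then sgl m (lkp (v k) m) else 0)"
        unfolding sum_fun_apply sum.cartesian_product
        by (rule sum.cong) (auto simp: u_def vscale_def mult_single)
      also have "\<dots> = (\<Sum>k<n. if k' = k then \<Sum>m\<in>mons. sgl m (lkp (v k) m) else 0)"
        by (rule sum.cong) auto
      also have "\<dots> = (if k' < n then \<Sum>m\<in>mons. sgl m (lkp (v k') m) else 0)"
        by (simp add: sum.delta)
      also have "\<dots> = v k'"
      proof (cases "k' < n")
        case True
        have "(\<Sum>m\<in>ks (v k'). sgl m (lkp (v k') m)) = (\<Sum>m\<in>mons. sgl m (lkp (v k') m))"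
          using V(2)[rule_format, OF v, of k'] fin
          by (intro sum.mono_neutral_left) (auto simp: mons_def homogeneous_def in_keys_iff)
        then show ?thesis using True poly_eq_sum_monomials[of "v k'"] by simp
      next
        case False then show ?thesis using V(1) v by (auto simp: free_mod_def)
      qed
      finally show "v k' = (\<Sum>(k, m)\<in>{..<n} \<times> mons. vscale (lkp (v k) m) (u (k, m))) k'" ..
    qed
    moreover have "(\<Sum>(k, m)\<in>{..<n} \<times> mons. vscale (lkp (v k) m) (u (k, m))) \<in> vs.span T"
    proof (rule vs.span_sum)
      fix x assume "x \<in> {..<n} \<times> mons"
      then have "u x \<in> T" unfolding T_def by (rule imageI)
      then have "vscale (lkp (v (fst x)) (snd x)) (u x) \<in> vs.span T" by (intro vs.span_scale vs.span_base)
      then show "(case x of (k, m) \<Rightarrow> vscale (lkp (v k) m) (u (k, m))) \<in> vs.span T" by (cases x) simp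
    qed
    ultimately show ?thesis by (rule ssubst[where P = "\<lambda>x. x \<in> vs.span T"])
  qed
  then show ?thesis using fin by (intro exI[of _ T]) (auto simp: T_def)
qed

text \<open>The columns of \<open>A\<close> are a basis of the degree \<open>e\<close> piece of
  \<open>Z\<close>, and their basis vectors are regraded to degree 0. Independence over the field
  forces syzygies into degree at least 1. A class of coefficient degree \<open>d\<close> on the
  kernel corresponds to one of degree \<open>e + d - 1\<close> on \<open>Z\<close>, one homological
  degree higher, so the bound becomes 1 after every step.\<close>

lemma koszul_linear_step:
  fixes Z :: "(nat \<Rightarrow> ('v::finite, 'k::field) mpoly) set"
  assumes vs: "distinct vs" "set vs = UNIV" and Z: "koszul_linear vs n e Z"
  shows "\<exists>b A. (\<forall>k<n. \<forall>c<b. homogeneous e (A k c)) \<and> mat_map n b A ` free_mod b = Z \<and>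
    koszul_linear vs b 1 {v \<in> free_mod b. mat_map n b A v = (\<lambda>_. 0)}"
proof -
  interpret vs: vector_space "vscale :: 'k \<Rightarrow> (nat \<Rightarrow> ('v, 'k) mpoly) \<Rightarrow> _" by (rule vector_space_vscale)
  let ?ys = "map var vs :: ('v, 'k) mpoly list"
  have lin: "linear_forms ?ys" by (auto simp: homogeneous_var)
  have Zfree: "Z \<subseteq> free_mod n" and Zsub: "is_submodule Z"
    and Zex: "\<And>C d. e < d \<Longrightarrow> (\<And>bs. length bs = length vs \<Longrightarrow> C bs \<in> Z) \<Longrightarrow>
       (\<And>bs k. homogeneous d (C bs k)) \<Longrightarrow>
       (\<And>bs k. length bs = length vs \<Longrightarrow> kd ?ys (\<lambda>b. C b k) bs = 0) \<Longrightarrow>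
       \<exists>W. \<forall>bs. length bs = length vs \<longrightarrow>
          W bs \<in> Z \<and> (\<forall>k. C bs k = kd ?ys (\<lambda>b. W b k) bs)"
    using Z unfolding koszul_linear_def by auto
  define V where "V = {v\<in>Z. \<forall>k. homogeneous e (v k)}"
  obtain B where B: "B \<subseteq> V" "vs.independent B" "V \<subseteq> vs.span B" 
    using vs.maximal_independent_subset[of V] .
  have "V \<subseteq> free_mod n" "\<forall>v\<in>V. \<forall>k. homogeneous e (v k)"
    using Zfree unfolding V_def by blast+
  from finite_dim_homogeneous[of V n e, OF this] obtain T where "finite T \<and> V \<subseteq> vs.span T" ..
  then have finB: "finite B" using vs.independent_span_bound[OF _ B(2), of T] subset_trans[OF B(1)] by simp
  define b where "b = card B"
  obtain f where f: "bij_betw f {..<b} B"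
    using ex_bij_betw_nat_finite[OF finB] unfolding b_def atLeast0LessThan by blast
  have fB: "f c \<in> B" if "c < b" for c using f that by (auto simp: bij_betw_def)
  then have fZ: "f c \<in> Z" "\<And>k. homogeneous e (f c k)" if "c < b" for c using B(1) that by (auto simp: V_def)
  have f0: "f c k = 0" if "c < b" "\<not> k < n" for c k
    using fZ(1)[OF that(1)] Zfree that(2) by (auto simp: free_mod_def)
  define A where "A = (\<lambda>k c. f c k)"
  have mm: "mat_map n b A v = (\<lambda>k. \<Sum>c<b. f c k * v c)" for v
    by (rule ext) (auto simp: mat_map_def A_def f0)
  let ?Z' = "{v \<in> free_mod b. mat_map n b A v = (\<lambda>_. 0)}"
  have im: "mat_map n b A ` free_mod b = Z"
  proof
    show "mat_map n b A ` free_mod b \<subseteq> Z"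
    proof (clarify)
      fix v :: "nat \<Rightarrow> ('v, 'k) mpoly"
      have "(\<lambda>k. \<Sum>c<b. v c * f c k) \<in> Z"
        using fZ(1) by (intro submodule_sum[OF Zsub] submodule_mult[OF Zsub]) auto
      then show "mat_map n b A v \<in> Z" by (simp add: mm mult.commute)
    qed
    have M: "is_submodule (mat_map n b A ` free_mod b)"
      unfolding is_submodule_def
    proof (intro conjI ballI allI)
      show "(\<lambda>_. 0) \<in> mat_map n b A ` free_mod b"
        by (rule image_eqI[of _ _ "\<lambda>_. 0"]) (auto simp: free_mod_def)
    next
      fix u v assume "u \<in> mat_map n b A ` free_mod b" "v \<in> mat_map n b A ` free_mod b"
      then obtain x y where "x \<in> free_mod b" "u = mat_map n b A x" "y \<in> free_mod b" "v = mat_map n b A y" by blast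
      then show "(\<lambda>k. u k + v k) \<in> mat_map n b A ` free_mod b"
        by (intro image_eqI[of _ _ "\<lambda>c. x c + y c"]) (auto simp: free_mod_def mm distrib_left sum.distrib)
    next
      fix p v assume "v \<in> mat_map n b A ` free_mod b"
      then obtain x where "x \<in> free_mod b" "v = mat_map n b A x" by blast
      then show "(\<lambda>k. p * v k) \<in> mat_map n b A ` free_mod b"
        by (intro image_eqI[of _ _ "\<lambda>c. p * x c"]) (auto simp: free_mod_def mm sum_distrib_left mult.left_commute)
    qed
    show "Z \<subseteq> mat_map n b A ` free_mod b"
    proof (rule koszul_linear_generated[OF Z M])
      have "B \<subseteq> mat_map n b A ` free_mod b"
      proof
        fix x assume "x \<in> B"
        then obtain c where c: "c < b" "x = f c" using f by (auto simp: bij_betw_def)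
        have "mat_map n b A (\<lambda>d. if d = c then 1 else 0) = f c"
          unfolding mm using c(1) by (auto simp: if_distrib cong: if_cong)
        then show "x \<in> mat_map n b A ` free_mod b"
          using c by (intro image_eqI[of _ _ "\<lambda>d. if d = c then 1 else 0"]) (auto simp: free_mod_def)
      qed
      moreover have "vs.subspace (mat_map n b A ` free_mod b)"
        using submodule_zero[OF M] submodule_add[OF M] submodule_mult[OF M]
        by (intro vs.subspaceI) (simp_all add: vscale_def zero_fun_def plus_fun_def)
      ultimately have "vs.span B \<subseteq> mat_map n b A ` free_mod b" by (rule vs.span_minimal)
      then show "v \<in> mat_map n b A ` free_mod b" if "v \<in> Z" "\<And>k. homogeneous e (v k)" for v
        using that B(3) by (auto simp: V_def)
    qed
  qed
  have hom: "homogeneous e (A k c)" if "c < b" for k c using fZ(2)[OF that] by (simp add: A_def)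
  have hc: "mat_map n b A (\<lambda>c. hcomp d (v c)) k = hcomp (d + e) (mat_map n b A v k)" for d v k
    using hcomp_mult[OF hom, of _ "d + e" k] by (simp add: mat_map_def hcomp_sum)
  have low: "const_coeff (v c) = 0" if v: "v \<in> ?Z'" for v c
  proof (cases "c < b")
    case True
    \<comment> \<open>The degree 0 part of a syzygy is a linear relation among the basis elements;
      \<open>w\<close> transports its coefficients from indices to elements of
      \<open>B\<close>.\<close>
    define w where "w = (\<lambda>x. const_coeff (v (the_inv_into {..<b} f x)))"
    have wf: "w (f c) = const_coeff (v c)" if "c < b" for c
      using that f by (simp add: w_def bij_betw_def the_inv_into_f_f)
    have "(\<Sum>x\<in>B. vscale (w x) x) = (\<Sum>c<b. vscale (w (f c)) (f c))"
      by (rule sum.reindex_bij_betw[OF f, symmetric])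
    also have "\<dots> = (\<Sum>c<b. vscale (const_coeff (v c)) (f c))"
      by (rule sum.cong) (auto simp: wf)
    also have "\<dots> = 0"
    proof
      fix k
      have "mat_map n b A (\<lambda>c. hcomp 0 (v c)) k = 0" using v by (simp add: hc)
      moreover have "hcomp 0 (v c) = sgl 0 (const_coeff (v c))" for c
        using homogeneous_0_eq_const[OF homogeneous_hcomp, of "v c"]
        by (simp add: const_coeff_def lookup_hcomp)
      ultimately have "(\<Sum>c<b. f c k * sgl 0 (const_coeff (v c))) = 0" by (simp add: mm)
      then show "(\<Sum>c<b. vscale (const_coeff (v c)) (f c)) k = 0 k"
        by (simp add: sum_fun_apply vscale_def mult.commute)
    qed
    finally have "\<not> (\<exists>x\<in>B. w x \<noteq> 0)" using B(2) vs.dependent_finite[OF finB] by blast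
    then show ?thesis using wf[OF True] fB[OF True] by auto
  next
    case False then show ?thesis using v by (auto simp: free_mod_def)
  qed
  have "koszul_linear vs b 1 ?Z'"
    unfolding koszul_linear_def
  proof (intro conjI ballI allI impI)
    show "?Z' \<subseteq> free_mod b" by blast
    show "is_submodule ?Z'"
      unfolding is_submodule_def
    proof (intro conjI ballI allI)
      show "(\<lambda>_. 0) \<in> ?Z'" by (simp add: free_mod_def)
    next
      fix u v assume "u \<in> ?Z'" "v \<in> ?Z'"
      then have u: "u \<in> free_mod b" "\<And>k. (\<Sum>c<b. f c k * u c) = 0"
        and v: "v \<in> free_mod b" "\<And>k. (\<Sum>c<b. f c k * v c) = 0" by (auto simp: mm fun_eq_iff)
      then show "(\<lambda>k. u k + v k) \<in> ?Z'" by (auto simp: mm free_mod_def distrib_left sum.distrib)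
    next
      fix p v assume "v \<in> ?Z'"
      then have v: "v \<in> free_mod b" "\<And>k. (\<Sum>c<b. f c k * v c) = 0" by (auto simp: mm fun_eq_iff)
      have "(\<Sum>c<b. f c k * (p * v c)) = p * (\<Sum>c<b. f c k * v c)" for k
        by (simp add: sum_distrib_left mult.left_commute)
      then show "(\<lambda>k. p * v k) \<in> ?Z'" using v by (auto simp: mm free_mod_def)
    qed
    show "(\<lambda>k. hcomp d (v k)) \<in> ?Z'" if "v \<in> ?Z'" for v d
      using that hc[of d v] by (auto simp: free_mod_def fun_eq_iff)
    show "hcomp d (v k) = 0" if v: "v \<in> ?Z'" and d: "d < 1" for v k d
    proof (cases "d = 0")
      case True
      show ?thesis
      proof (rule homogeneous_0_const_coeff_0)
        show "homogeneous 0 (hcomp d (v k))" unfolding True by (rule homogeneous_hcomp)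
        show "const_coeff (hcomp d (v k)) = 0"
          using low[OF v, of k] by (simp add: True const_coeff_def lookup_hcomp)
      qed
    next
      case False
      then have "d < 0" using d by simp
      then show ?thesis by (rule homogeneous_neg_degree[OF homogeneous_hcomp])
    qed
    fix C d
    assume d: "1 < d" and C: "\<forall>bs. length bs = length vs \<longrightarrow> C bs \<in> ?Z'"
      and hC: "\<forall>bs k. homogeneous d (C bs k)"
      and cyc: "\<forall>bs k. length bs = length vs \<longrightarrow> kd ?ys (\<lambda>b. C b k) bs = 0"
    have "\<exists>u. \<forall>bs. length bs = length vs \<longrightarrow> C bs k = kd ?ys u bs" for k
      using koszul_exactD[OF koszul_exact_vars[OF vs(1)], of "\<lambda>b. C b k"] cyc
        homogeneous_in_koszul_gen_vars[OF vs(2), of d "C (kzero ?ys) k"] hC d by auto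
    then obtain u where u: "\<And>bs k. length bs = length vs \<Longrightarrow> C bs k = kd ?ys (u k) bs" by metis
    \<comment> \<open>The cycle bounds in the free module; mapping a bounding chain by
      \<open>A\<close> gives the cycle \<open>P\<close> with coefficients in
      \<open>Z\<close>.\<close>
    define U where "U = (\<lambda>bs k. if k < b then hcomp (d - 1) (u k bs) else 0)"
    have Ufree: "U bs \<in> free_mod b" for bs by (simp add: U_def free_mod_def)
    have CU: "C bs k = kd ?ys (\<lambda>b. U b k) bs" if bs: "length bs = length vs" for bs k
    proof (cases "k < b")
      case True
      then show ?thesis
        using u[OF bs, of k] hcomp_kd[OF lin, of d "u k" bs] hcomp_homogeneous[OF hC[rule_format, of bs k]]
        by (simp add: U_def)
    next
      case False then show ?thesis using C bs by (auto simp: U_def free_mod_def)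
    qed
    define P where "P = (\<lambda>bs. mat_map n b A (U bs))"
    have "\<exists>W. \<forall>bs. length bs = length vs \<longrightarrow> W bs \<in> Z \<and> (\<forall>k. P bs k = kd ?ys (\<lambda>b. W b k) bs)"
    proof (rule Zex[of "e + (d - 1)"])
      show "e < e + (d - 1)" using d by simp
      show "P bs \<in> Z" for bs using im Ufree by (auto simp: P_def)
      show "homogeneous (e + (d - 1)) (P bs k)" for bs k
        unfolding P_def mat_map_def using hom homogeneous_hcomp
        by (auto simp: U_def intro!: homogeneous_sum homogeneous_mult)
      show "kd ?ys (\<lambda>b. P b k) bs = 0" if bs: "length bs = length vs" for bs k
      proof -
        have "kd ?ys (\<lambda>b. P b k) bs = mat_map n b A (\<lambda>c. kd ?ys (\<lambda>b. U b c) bs) k"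
          unfolding P_def mat_map_kd ..
        also have "(\<lambda>c. kd ?ys (\<lambda>b. U b c) bs) = C bs" using CU[OF bs] by auto
        finally show ?thesis using C bs by simp
      qed
    qed
    then obtain W where W: "\<And>bs. length bs = length vs \<Longrightarrow> W bs \<in> Z"
      "\<And>bs k. length bs = length vs \<Longrightarrow> P bs k = kd ?ys (\<lambda>b. W b k) bs" by blast
    have "\<exists>v\<in>free_mod b. length bs = length vs \<longrightarrow> W bs = mat_map n b A v" for bs
    proof (cases "length bs = length vs")
      case True then show ?thesis using W(1)[OF True] im by blast
    next
      case False then show ?thesis by (intro bexI[of _ "\<lambda>_. 0"]) (auto simp: free_mod_def)
    qed
    then obtain Y where Y: "\<And>bs. Y bs \<in> free_mod b" "\<And>bs. length bs = length vs \<Longrightarrow> W bs = mat_map n b A (Y bs)"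
      by metis
    \<comment> \<open>Subtracting a boundary leaves the differential of \<open>U\<close> unchanged,
      and this one moves \<open>U\<close> into the kernel of \<open>A\<close>.\<close>
    define X where "X = (\<lambda>bs k. U bs k - kd ?ys (\<lambda>b. Y b k) bs)"
    have "X bs \<in> ?Z'" if bs: "length bs = length vs" for bs
    proof
      have "kd ?ys (\<lambda>b. Y b k) bs = 0" if "\<not> k < b" for k
        using Y(1) that by (simp add: free_mod_def)
      then have "X bs \<in> free_mod b" using Ufree[of bs] by (auto simp: X_def free_mod_def)
      moreover have "mat_map n b A (X bs) = (\<lambda>_. 0)"
      proof
        fix k
        have "mat_map n b A (X bs) k = P bs k - kd ?ys (\<lambda>b'. mat_map n b A (Y b') k) bs"
          unfolding X_def mat_map_diff mat_map_kd P_def ..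
        also have "kd ?ys (\<lambda>b'. mat_map n b A (Y b') k) bs = kd ?ys (\<lambda>b. W b k) bs"
          by (rule kd_cong) (simp_all add: Y(2) bs)
        finally show "mat_map n b A (X bs) k = 0" using W(2)[OF bs] by simp
      qed
      ultimately show "X bs \<in> free_mod b \<and> mat_map n b A (X bs) = (\<lambda>_. 0)" ..
    qed
    moreover have "C bs k = kd ?ys (\<lambda>b. X b k) bs" if "length bs = length vs" for bs k
      using CU[OF that] by (simp add: X_def kd_diff kd_kd)
    ultimately show "\<exists>W. \<forall>bs. length bs = length vs \<longrightarrow> W bs \<in> ?Z' \<and> (\<forall>k. C bs k = kd ?ys (\<lambda>b. W b k) bs)"
      by (intro exI[of _ X]) blast
  qed
  moreover have "\<forall>k<n. \<forall>c<b. homogeneous e (A k c)" using hom by simp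
  ultimately show ?thesis using im by (intro exI[of _ b] exI[of _ A] conjI)
qed

lemma koszul_linear_ideal:
  fixes I :: "('v::finite, 'k::field) mpoly set"
  assumes gr: "graded_ideal I" and low: "\<And>p d. p \<in> I \<Longrightarrow> d < e \<Longrightarrow> hcomp d p = 0"
    and E: "ideal_koszul_exact (map var vs) I (e + 1)"
  shows "koszul_linear vs 1 e ((\<lambda>p k. if k = 0 then p else 0) ` I)"
    (is "koszul_linear vs 1 e ?Z")
proof -
  note I = graded_idealD(1)[OF gr]
  have memZ: "v \<in> ?Z \<longleftrightarrow> v 0 \<in> I \<and> (\<forall>k\<ge>1. v k = 0)" for v :: "nat \<Rightarrow> ('v, 'k) mpoly"
  proof
    assume "v 0 \<in> I \<and> (\<forall>k\<ge>1. v k = 0)"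
    then show "v \<in> ?Z" by (intro image_eqI[of _ _ "v 0"]) (auto simp: fun_eq_iff)
  qed auto
  show ?thesis
    unfolding koszul_linear_def
  proof (intro conjI ballI allI impI)
    show "?Z \<subseteq> free_mod 1" by (auto simp: free_mod_def)
    show "is_submodule ?Z"
      unfolding is_submodule_def memZ by (auto intro: ideal_zero[OF I] ideal_add[OF I] ideal_mult[OF I])
    show "(\<lambda>k. hcomp d (v k)) \<in> ?Z" if "v \<in> ?Z" for v d
      using that graded_idealD(2)[OF gr] unfolding memZ by auto
    show "hcomp d (v k) = 0" if "v \<in> ?Z" "d < e" for v k d
      using that low by auto
    fix C :: "bool list \<Rightarrow> nat \<Rightarrow> ('v, 'k) mpoly" and d
    assume d: "e < d" and C: "\<forall>bs. length bs = length vs \<longrightarrow> C bs \<in> ?Z"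
      and hC: "\<forall>bs k. homogeneous d (C bs k)"
      and cyc: "\<forall>bs k. length bs = length vs \<longrightarrow> kd (map var vs) (\<lambda>b. C b k) bs = 0"
    have "\<exists>w. \<forall>bs. length bs = length (map var vs :: ('v, 'k) mpoly list) \<longrightarrow>
        w bs \<in> I \<and> C bs 0 = kd (map var vs) w bs"
      using C hC cyc d unfolding memZ
      by (intro E[unfolded ideal_koszul_exact_def, rule_format, of d "\<lambda>b. C b 0"]) auto
    then obtain w where w: "\<And>bs. length bs = length vs \<Longrightarrow> w bs \<in> I \<and> C bs 0 = kd (map var vs) w bs" by auto
    show "\<exists>W. \<forall>bs. length bs = length vs \<longrightarrow> W bs \<in> ?Z \<and> (\<forall>k. C bs k = kd (map var vs) (\<lambda>b. W b k) bs)"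
    proof (intro exI[of _ "\<lambda>b k. if k = 0 then w b else 0"] allI impI conjI)
      fix bs :: "bool list" and k :: nat assume bs: "length bs = length vs"
      show "(\<lambda>k. if k = 0 then w bs else 0) \<in> ?Z" using w[OF bs] unfolding memZ by simp
      show "C bs k = kd (map var vs) (\<lambda>b. if k = 0 then w b else 0) bs"
        using w[OF bs] C bs unfolding memZ by (cases "k = 0") auto
    qed
  qed
qed

lemma linear_resolution_exists:
  fixes I :: "('v::finite, 'k::field) mpoly set"
  assumes vs: "distinct vs" "set vs = UNIV" and gr: "graded_ideal I"
    and low: "\<And>p d. p \<in> I \<Longrightarrow> d < e \<Longrightarrow> hcomp d p = 0"
    and E: "ideal_koszul_exact (map var vs) I (e + 1)"
  shows "\<exists>F. graded_free_resolution F I \<and> (\<forall>i k. fdeg F i k = int i + e)"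
proof -
  define Ker where "Ker = (\<lambda>(n, b, A). {v \<in> free_mod b. mat_map n b A v = (\<lambda>_. 0 :: ('v, 'k) mpoly)})"
  define Im where "Im = (\<lambda>(n, b, A). mat_map n b A ` (free_mod b :: (nat \<Rightarrow> ('v, 'k) mpoly) set))"
  define good where "good = (\<lambda>q (n, b, A). (\<forall>k<n. \<forall>c<b. homogeneous (if q = 0 then e else 1) (A k c)) \<and>
    koszul_linear vs b 1 (Ker (n, b, A)) \<and>
    (q = (0::nat) \<longrightarrow> n = 1 \<and> Im (n, b, A) = (\<lambda>p k. if k = 0 then p else 0) ` I))"
  have "\<exists>x. good 0 x"
    using koszul_linear_step[OF vs koszul_linear_ideal[OF gr low E]]
    unfolding good_def Ker_def Im_def by (auto 4 4)
  moreover have "\<exists>y. good (Suc q) y \<and> (fst y = fst (snd x) \<and> Im y = Ker x)" if "good q x" for q x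
  proof -
    obtain n b A where x: "x = (n, b, A)" by (cases x)
    have "koszul_linear vs b 1 (Ker x)" using that unfolding x good_def by simp
    then obtain b' A' where "\<forall>k<b. \<forall>c<b'. homogeneous 1 (A' k c)" "mat_map b b' A' ` free_mod b' = Ker x"
      "koszul_linear vs b' 1 {v \<in> free_mod b'. mat_map b b' A' v = (\<lambda>_. 0)}"
      using koszul_linear_step[OF vs] by blast
    then show ?thesis
      by (intro exI[of _ "(b, b', A')"]) (simp add: good_def Ker_def Im_def x)
  qed
  ultimately obtain x where x: "\<And>q. good q (x q)"
    "\<And>q. fst (x (Suc q)) = fst (snd (x q))" "\<And>q. Im (x (Suc q)) = Ker (x q)"
    using dependent_nat_choice[of good "\<lambda>q x y. fst y = fst (snd x) \<and> Im y = Ker x"] by metis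
  define rk where "rk = (\<lambda>q. fst (snd (x q)))"
  define M where "M = (\<lambda>q. snd (snd (x q)))"
  have xS: "x (Suc q) = (rk q, rk (Suc q), M (Suc q))" for q
    using x(2)[of q] by (simp add: rk_def M_def prod_eq_iff)
  have "fst (x 0) = 1" using x(1)[of 0] unfolding good_def by (auto split: prod.splits)
  then have x0: "x 0 = (1, rk 0, M 0)" by (simp add: rk_def M_def prod_eq_iff)
  \<comment> \<open>The first matrix has entries of degree \<open>e\<close> and all later ones of
    degree 1; adding these up undoes the regrading to degree 0.\<close>
  define F where "F = \<lparr>frank = rk, fdeg = (\<lambda>i k. int i + e), faug = M 0 0, fdiff = (\<lambda>i. M (Suc i))\<rparr>"
  have aug: "mat_map 1 (rk 0) (M 0) v = (\<lambda>k. if k = 0 then aug_map F v else 0)" for v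
    by (rule ext) (simp add: mat_map_def aug_map_def F_def)
  have im0: "(\<lambda>v k. if k = 0 then aug_map F v else 0) ` free_mod (rk 0) =
      ((\<lambda>p k. if k = (0::nat) then p else 0) ` I)"
    using x(1)[of 0] unfolding good_def x0 prod.case Im_def aug[abs_def] by simp
  have "graded_free_resolution F I"
    unfolding graded_free_resolution_def
  proof (intro conjI allI impI)
    show "homogeneous (fdeg F 0 c) (faug F c)" if "c < frank F 0" for c
      using x(1)[of 0] that unfolding good_def x0 by (simp add: F_def)
    show "homogeneous (fdeg F (Suc i) c - fdeg F i r) (fdiff F i r c)"
      if "r < frank F i" "c < frank F (Suc i)" for i r c
      using x(1)[of "Suc i"] that unfolding good_def xS by (simp add: F_def)
    show "aug_map F ` free_mod (frank F 0) = I"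
    proof -
      have "(\<lambda>w. w 0) ` (\<lambda>v k. if k = (0::nat) then aug_map F v else 0) ` free_mod (rk 0) =
        (\<lambda>w. w 0) ` (\<lambda>p k. if k = (0::nat) then p else 0) ` I" unfolding im0 ..
      then show ?thesis by (simp add: image_image F_def)
    qed
    show "{v \<in> free_mod (frank F 0). aug_map F v = 0} = diff_map F 0 ` free_mod (frank F 1)"
    proof -
      have "(\<lambda>k. if k = (0::nat) then aug_map F v else 0) = (\<lambda>_. 0) \<longleftrightarrow> aug_map F v = 0" for v
        by (auto simp: fun_eq_iff)
      then show ?thesis
        using x(3)[of 0] unfolding xS x0 Im_def Ker_def prod.case aug diff_map_def by (simp add: F_def)
    qed
    show "{v \<in> free_mod (frank F (Suc i)). diff_map F i v = (\<lambda>_. 0)} =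
        diff_map F (Suc i) ` free_mod (frank F (Suc (Suc i)))" for i
      using x(3)[of "Suc i"] unfolding xS Im_def Ker_def prod.case diff_map_def by (simp add: F_def)
  qed
  moreover have "fdeg F i k = int i + e" for i k by (simp add: F_def)
  ultimately show ?thesis by blast
qed

section \<open>Regularity of the join-meet ideal\<close>

lemma join_meet_ideal_low:
  fixes p :: "('l::{finite,distrib_lattice}, 'k::field) mpoly"
  assumes "p \<in> join_meet_ideal" "d < 2" shows "hcomp d p = 0"
  using assms(1) unfolding join_meet_ideal_def
proof (induct rule: module.span_induct_alt[OF module_mult, consumes 1, case_names base step])
  case base then show ?case by simp
next
  case (step c x y)
  then have "homogeneous 2 x"
    by (auto intro!: homogeneous_diff homogeneous_mult[of 1 _ 1, simplified] homogeneous_var)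
  then have "hcomp d (c * x) = x * hcomp (d - 2) c" using hcomp_mult[of 2 x d c] by (simp add: mult.commute)
  also have "hcomp (d - 2) c = 0" using assms(2) by (intro homogeneous_neg_degree[OF homogeneous_hcomp]) simp
  finally show ?case using step by (simp add: hcomp_add)
qed

text \<open>All entries between neighbouring modules have degree 1, so the tensored differentials
  vanish, and the strand of a degree other than \<open>i + e\<close> is zero from the start.\<close>

lemma tor_vanishes_of_linear_resolution:
  fixes I :: "('v::finite, 'k::field) mpoly set"
  assumes F: "graded_free_resolution F I" "\<And>i k. fdeg F i k = int i + e" and j: "j \<noteq> int i + e"
  shows "tor_vanishes I i j"
proof -
  have "const_coeff (fdiff F h r c) = 0" if "r < frank F h" "c < frank F (Suc h)" for h r c
  proof (rule const_coeff_homogeneous)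
    show "homogeneous (fdeg F (Suc h) c - fdeg F h r) (fdiff F h r c)"
      using F(1) that unfolding graded_free_resolution_def by blast
    show "fdeg F (Suc h) c - fdeg F h r \<noteq> 0" by (simp add: F(2))
  qed
  then have td: "tensor_diff F h w = (\<lambda>_. 0)" for h w
    unfolding tensor_diff_def mat_map_def by (auto intro!: sum.neutral)
  have "tensor_strand F i j = {\<lambda>_. 0}" using j by (auto simp: tensor_strand_def free_mod_def F(2))
  moreover have "(\<lambda>_. 0) \<in> tensor_strand F (Suc i) j" by (simp add: tensor_strand_def free_mod_def)
  ultimately have "tor_cycles F i j = tor_boundaries F i j"
    unfolding tor_cycles_def tor_boundaries_def by (auto simp: td image_iff)
  then show ?thesis unfolding tor_vanishes_def using F(1) by blast
qed

text \<open>Whatever the resolution, vanishing would write \<open>f\<close> as a combination of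
  generators with coefficients lacking constant terms. Generators of degree below \<open>e\<close>
  are 0 as elements of \<open>I\<close>, those of degree \<open>e\<close> get constant coefficients,
  which are then 0, and those of larger degree get coefficients of negative degree.\<close>

lemma not_tor_vanishes_initial_degree:
  fixes I :: "('v::finite, 'k::field) mpoly set"
  assumes low: "\<And>p d. p \<in> I \<Longrightarrow> d < e \<Longrightarrow> hcomp d p = 0" and e: "0 < e"
    and f: "f \<in> I" "homogeneous e f" "f \<noteq> 0"
  shows "\<not> tor_vanishes I 0 e"
proof
  assume "tor_vanishes I 0 e"
  then obtain F where F: "graded_free_resolution F I" "tor_cycles F 0 e = tor_boundaries F 0 e"
    unfolding tor_vanishes_def by blast
  interpret graded_exact "aug_rank F" "aug_deg F" "aug_mat F" by (rule graded_exact_resolution[OF F(1)])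
  let ?v = "\<lambda>k::nat. if k = 0 then f else 0"
  have "\<exists>x\<in>free_mod (aug_rank F (Suc 0)). dl 0 x = ?v \<and>
    (\<forall>c. const_coeff (x c) = 0 \<and> homogeneous (e - aug_deg F (Suc 0) c) (x c))"
  proof (rule lift_const_coeff_0[OF tor_zero_resolution[OF F]])
    show "?v \<in> im 0" unfolding resolution_image[OF F(1)] using f(1) by blast
    show "homogeneous (e - aug_deg F 0 k) (?v k)" for k using f(2) by simp
    show "const_coeff (?v k) = 0" for k using const_coeff_homogeneous[OF f(2)] e by simp
  qed
  then obtain x where x: "dl 0 x = ?v" "\<And>c. const_coeff (x c) = 0" "\<And>c. homogeneous (e - fdeg F 0 c) (x c)"
    by auto
  have "faug F c * x c = 0" if c: "c < frank F 0" for c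
  proof (cases "fdeg F 0 c" e rule: linorder_cases)
    case less
    have "(\<lambda>d. if d = c then 1 else 0) \<in> free_mod (frank F 0)" using c by (simp add: free_mod_def)
    then have "aug_map F (\<lambda>d. if d = c then 1 else 0) \<in> aug_map F ` free_mod (frank F 0)" by (rule imageI)
    moreover have "aug_map F (\<lambda>d. if d = c then 1 else 0) = faug F c"
      using c by (simp add: aug_map_def if_distrib cong: if_cong)
    moreover have "aug_map F ` free_mod (frank F 0) = I"
      using F(1) unfolding graded_free_resolution_def by simp
    ultimately have "faug F c \<in> I" by simp
    then have "hcomp (fdeg F 0 c) (faug F c) = 0" using low less by blast
    moreover have "homogeneous (fdeg F 0 c) (faug F c)"
      by (rule F(1)[unfolded graded_free_resolution_def, THEN conjunct1, rule_format, OF c])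
    ultimately show ?thesis using hcomp_homogeneous by fastforce
  next
    case equal
    then show ?thesis using x(2)[of c] x(3)[of c] homogeneous_0_const_coeff_0[of "x c"] by simp
  next
    case greater
    then show ?thesis using homogeneous_neg_degree[OF x(3)[of c]] by simp
  qed
  then have "aug_map F x = 0" unfolding aug_map_def by (intro sum.neutral) auto
  moreover have "aug_map F x = f"
    using fun_cong[OF x(1), of 0] mat_map_aug[of F x] by simp
  ultimately show False using f(3) by simp
qed

lemma linear_resolution_imp_tor_vanishes:
  assumes "has_linear_resolution I" "int i + 2 < j" shows "tor_vanishes I i j"
proof (rule ccontr)
  assume "\<not> tor_vanishes I i j"
  then have "ereal (real_of_int (j - int i)) \<le> regularity I"
    unfolding regularity_def by (intro Sup_upper) blast
  then have "real_of_int (j - int i) \<le> 2" using assms(1) unfolding has_linear_resolution_def by simp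
  then show False using assms(2) by linarith
qed

lemma has_linear_resolutionI:
  assumes "\<And>i j. j \<noteq> int i + 2 \<Longrightarrow> tor_vanishes I i j" "\<not> tor_vanishes I 0 2"
  shows "has_linear_resolution I"
proof -
  have "{ereal (real_of_int (j - int i)) | i j. \<not> tor_vanishes I i j} = {2}"
  proof (intro equalityI subsetI)
    fix x assume "x \<in> {ereal (real_of_int (j - int i)) | i j. \<not> tor_vanishes I i j}"
    then obtain i j where x: "x = ereal (real_of_int (j - int i))" "\<not> tor_vanishes I i j" by blast
    then have "j = int i + 2" using assms(1) by blast
    then show "x \<in> {2}" using x(1) by simp
  next
    fix x :: ereal assume "x \<in> {2}"
    then have "x = ereal (real_of_int (2 - int 0))" by simp
    then show "x \<in> {ereal (real_of_int (j - int i)) | i j. \<not> tor_vanishes I i j}" using assms(2) by blast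
  qed
  then show ?thesis by (simp add: has_linear_resolution_def regularity_def)
qed

lemma not_has_linear_resolution_zero:
  fixes vs :: "'v::finite list"
  assumes "distinct vs" "set vs = UNIV"
  shows "\<not> has_linear_resolution ({0} :: ('v, 'k::field) mpoly set)"
proof -
  have "tor_vanishes ({0} :: ('v, 'k) mpoly set) i j" for i j
  proof -
    have gr: "graded_ideal ({0} :: ('v, 'k) mpoly set)"
      by (simp add: graded_ideal_def ideal_singleton_zero)
    have "ideal_koszul_exact (map var vs) ({0} :: ('v, 'k) mpoly set) c" for c
      unfolding ideal_koszul_exact_def by (auto intro!: exI[of _ "\<lambda>_. 0"])
    then have "\<exists>F. graded_free_resolution F ({0} :: ('v, 'k) mpoly set) \<and>
        (\<forall>h k. fdeg F h k = int h + (j - int i + 1))"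
      by (intro linear_resolution_exists[OF assms gr]) auto
    then obtain F where F: "graded_free_resolution F ({0} :: ('v, 'k) mpoly set)"
      "\<forall>h k. fdeg F h k = int h + (j - int i + 1)" by blast
    show ?thesis
      by (rule tor_vanishes_of_linear_resolution[OF F(1), of "j - int i + 1"]) (use F(2) in blast, simp)
  qed
  then have "regularity ({0} :: ('v, 'k) mpoly set) = Sup {}" unfolding regularity_def by simp
  then show ?thesis by (simp add: has_linear_resolution_def bot_ereal_def)
qed

theorem corollary1p2:
  assumes "simple_lattice TYPE('l::{finite,distrib_lattice})"
  shows "has_linear_resolution (join_meet_ideal :: ('l, 'k::field) mpoly set) \<longleftrightarrow>
         chain_plus_isolated (join_irreducibles :: 'l set)"
proof
  let ?I = "join_meet_ideal :: ('l, 'k) mpoly set" and ?P = "join_irreducibles :: 'l set"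
  obtain vs :: "'l list" where vs: "set vs = UNIV" "distinct vs" using finite_distinct_list[OF finite] by blast
  note gr = graded_ideal_join_meet[where ?'l = 'l and ?'k = 'k]
  note exact_iff = ideal_koszul_exact_iff[OF vs(2,1) _ gr, of 2]
  {
    assume lin: "has_linear_resolution ?I"
    show "chain_plus_isolated ?P"
    proof (rule linear_imp_chain_plus_isolated[OF _ assms])
      have "ideal_koszul_exact (map var vs) ?I 3"
        by (rule tor_vanishes_imp_ideal_koszul_exact[OF vs(2,1) _ graded_idealD(1)[OF gr]
            linear_resolution_imp_tor_vanishes[OF lin]]) auto
      then show "koszul_vanishes (map var vs) ?I 2" using exact_iff by simp
      \<comment> \<open>Without join irreducible elements the lattice is a point and the ideal is
        zero, with regularity minus infinity.\<close>
      show "?P \<noteq> {}"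
      proof
        assume "?P = {}"
        then have "a \<le> b" for a b :: 'l using join_irreducible_separates[of a b] by auto
        then have "?I = {0}" unfolding join_meet_ideal_def by (simp add: module.span_empty[OF module_mult])
        then show False using not_has_linear_resolution_zero[OF vs(2,1), where ?'k = 'k] lin by simp
      qed
    qed
  next
    assume cpi: "chain_plus_isolated ?P"
    then obtain q where "q \<in> ?P" unfolding chain_plus_isolated_def by blast
    \<comment> \<open>A single join irreducible element would also be the sum of an empty chain and
      an isolated element, with ideal zero. Simplicity excludes this and provides a nonzero
      generator.\<close>
    then obtain p where pq: "\<not> p \<le> q" "\<not> q \<le> p" using assms unfolding simple_lattice_def by blast
    have "ideal_koszul_exact (map var vs) ?I 3"
      using koszul_vanishes_chain_plus_isolated[OF vs(2,1) cpi] exact_iff by simp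
    then obtain F where F: "graded_free_resolution F ?I" "\<And>i k. fdeg F i k = int i + 2"
      using linear_resolution_exists[OF vs(2,1) gr join_meet_ideal_low, of 2] by auto
    let ?f = "var p * var q - var (inf p q) * var (sup p q) :: ('l, 'k) mpoly"
    show "has_linear_resolution ?I"
    proof (rule has_linear_resolutionI)
      show "tor_vanishes ?I i j" if "j \<noteq> int i + 2" for i j
        by (rule tor_vanishes_of_linear_resolution[OF F that])
      have "?f \<noteq> 0"
      proof
        assume "?f = 0"
        then have "sgl (sgl p (1::nat) + sgl q 1) (1::'k) = sgl (sgl (inf p q) 1 + sgl (sup p q) 1) 1"
          by (simp add: var_mult_var)
        then have "sgl p (1::nat) + sgl q 1 = sgl (inf p q) 1 + sgl (sup p q) 1"
          by (metis keys_single one_neq_zero singleton_inject)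
        then show False using single_add_single_eq pq by (metis inf.cobounded1 inf.cobounded2)
      qed
      moreover have "homogeneous 2 ?f"
        by (intro homogeneous_diff homogeneous_mult[of 1 _ 1, simplified] homogeneous_var)
      ultimately show "\<not> tor_vanishes ?I 0 2"
        using join_meet_generator[OF pq] join_meet_ideal_low
        by (intro not_tor_vanishes_initial_degree[of ?I 2 ?f]) auto
    qed
  }
qed

end
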